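(* Let $A\subset(0,2)$ have $0$ as an accumulation point, let $(x_\alpha)_{\alpha\in A}$ be a family of total one-collision solutions of $M\ddot x=\nabla U_\alpha(x)$, with $x_\alpha$ asymptotic to $K_\alpha\subset\mathcal C_\alpha$, and let $\tilde x_\alpha=\alpha^{-\frac1{\alpha+2}}x_\alpha$ be the corresponding solutions of $M\ddot{\tilde x}=\nabla\widetilde U_\alpha(\tilde x)$, $\widetilde U_\alpha=\frac1\alpha U_\alpha$, with associated variables $(\tilde\rho_\alpha,\tilde s_\alpha,\tau)$. Assume: (UC) for all $\sigma>0$ there exists $\tau_\sigma>0$ such that $\tilde\rho_\alpha(\tau)<\sigma$ for all $\alpha\in A$ and all $\tau\ge\tau_\sigma$; (IC1) $\tilde\rho_\alpha(0)=1$ and $\tilde\rho_\alpha'(\tau)<0$ for all $\alpha\in A$ and all $\tau\ge0$; (IC2) $\tilde s_\alpha(0)\to s_0$ and $\tilde s_\alpha'(0)\to v_0$ as $\alpha\to0$, for some $s_0\in\mathcal E$ and $v_0\in\mathbb R^{Nd}$; (H) the energy of $x_\alpha$ is $h_\alpha=-\alpha^{-\frac{\alpha}{\alpha+2}}\sum_{i<j}m_im_j$ for all $\alpha\in A$. If there exists $\delta>0$ such that $K_\alpha\subset\mathcal C_\alpha\setminus\Delta^\delta$ for all $\alpha\in A$, then there exist $t^*\in(0,1)$ and a sequence $(\alpha_k)_k\subset A$, $\alpha_k\to0$, such that $$d^2\mathcal A_{\alpha_k}(x_{\alpha_k})(\varphi,\varphi)>0$$ for every nonzero compactly supported variation $\varphi$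 with support in $(t^*,1)$.
   Context: Fix $d\ge2$, $N\ge2$ and masses $m_1,\dots,m_N>0$. $M=\operatorname{diag}[m_1,\dots,m_N]$; $|y|^2=\langle My,y\rangle$ for $y\in\mathbb R^{Nd}$ (mass-weighted norm); $U_\alpha(x)=\sum_{i<j}m_im_j|x_i-x_j|^{-\alpha}$; $\Delta=\{x\in\mathbb R^{Nd}:\exists i\ne j,\ x_i=x_j\}$ and $\Delta^\delta$ is its open $\delta$-neighbourhood; $\Lambda=\{x\in\mathbb R^{Nd}\setminus\Delta:\sum_im_ix_i=0\}$; $\mathcal E=\{x\in\Lambda:|x|=1\}$, $T_s\mathcal E=\{v\in\mathbb R^{Nd}:\sum_im_iv_i=0,\ \langle Ms,v\rangle=0\}$; $\mathcal C_\alpha\subset\mathcal E$ is the set of central configurations, i.e. critical points of $U_\alpha$ restricted to $\mathcal E$. $\mathcal A_\alpha(x)=\frac12\int_0^1|\dot x|^2dt+\int_0^1U_\alpha(x)\,dt$; energy $h_\alpha=\frac12|\dot x_\alpha|^2-U_\alpha(x_\alpha)$. The centre of mass is at the origin. Total one-collision solution: a map $x\in C([0,1],\mathbb R^{Nd})\cap C^2((0,1),\mathbb R^{Nd})$ with $x(t)\in\Delta$ for $t\in[0,1]$ only when $t=1$, solving $M\ddot x=\nabla U_\alpha(x)$ in the time interval before the collision, with $\mathcal A_\alpha(x)<+\infty$, and with all bodies colliding at $t=1$ (so $x(1)=0$). It is asymptotic to $K_\alpha$ if $\operatorname{dist}(K_\alpha,x(t)/|x(t)|)\to0$ as $t\to1$.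 Variables: for a total one-collision solution $x$ (or $\tilde x$), $r=|x|$, $s=x/|x|\in\mathcal E$, $\tau$ is defined by $dt=r^{(2+\alpha)/2}d\tau$ with $\tau=0$ at $t=0$ (so $t\to1$ corresponds to $\tau\to+\infty$), $\rho=r^{(2-\alpha)/4}$; primes denote $d/d\tau$. The variables built from $\tilde x_\alpha$ are denoted $\tilde\rho_\alpha,\tilde s_\alpha$. Variations and second differential: a compactly supported variation $\varphi$ with support in $(t^*,1)$ corresponding to $x$ is an element of $H^1([0,1],\mathbb R^{Nd})$ with compact support in $(t^*,1)$ which in the coordinates $(\rho,s)$ corresponds to a pair $(\zeta,v)$, $\zeta$ real-valued and $v(\tau)\in T_{s(\tau)}\mathcal E$ (the components of the tangent vector $\varphi$ along $\rho$ and $s$). In these coordinates $d^2\mathcal A_\alpha(x_\alpha)(\varphi,\varphi)=\frac{\partial^2\mathcal A_\alpha}{\partial\rho^2}(\zeta,\zeta)+2\frac{\partial^2\mathcal A_\alpha}{\partial\rho\,\partial s}(\zeta,v)+\frac{\partial^2\mathcal A_\alpha}{\partial s^2}(v,v)$, where, with $(\rho_\alpha,s_\alpha)$ the variables of $x_\alpha$, $$\frac{\partial^2\mathcal A_\alpha}{\partial\rho^2}(\zeta,\zeta)=\int_0^{+\infty}\Big(\tfrac4{2-\alpha}\Big)^2(\zeta')^2+\zeta^2\big(|s_\alpha'|^2+2U_\alpha(s_\alpha)\big)d\tau,$$ $$\frac{\partial^2\mathcal A_\alpha}{\partial\rho\,\partial s}(\zeta,v)=2\int_0^{+\infty}\rho_\alpha\zeta\big[s_\alpha'\cdot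 v'+\nabla U_{\alpha|\mathcal E}(s_\alpha)\cdot v\big]d\tau,$$ $$\frac{\partial^2\mathcal A_\alpha}{\partial s^2}(v,v)=\int_0^{+\infty}\rho_\alpha^2\big[|v'|^2+\nabla^2U_{\alpha|\mathcal E}(s_\alpha)(v,v)\big]d\tau,$$ with $s_\alpha'\cdot v'$ the mass-weighted inner product, $\nabla U_{\alpha|\mathcal E}(s)\cdot v=\nabla U_\alpha(s)\cdot v$ (ordinary derivative of $U_\alpha$ in the direction $v\in T_s\mathcal E$), and $\nabla^2U_{\alpha|\mathcal E}(s)(v,v)=\nabla^2U_\alpha(s)(v,v)+\alpha U_\alpha(s)|v|^2$ for $v\in T_s\mathcal E$. *)

theory Defs
  imports "HOL-Analysis.Analysis"
begin

text \<open>
  A configuration of \<open>N = CARD('n)\<close> bodies in \<open>\<real>\<^sup>d\<close>, \<open>d = CARD('d)\<close>, is an element of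
  \<open>real^'d^'n\<close>; the linear order on the index type only serves to write sums over \<open>i < j\<close>.
\<close>

definition minner :: "('n::finite \<Rightarrow> real) \<Rightarrow> real^'d^'n \<Rightarrow> real^'d^'n \<Rightarrow> real" where
  "minner m x y = (\<Sum>i\<in>UNIV. m i * ((x $ i) \<bullet> (y $ i)))"

definition mnorm :: "('n::finite \<Rightarrow> real) \<Rightarrow> real^'d^'n \<Rightarrow> real" where
  "mnorm m x = sqrt (minner m x x)"

text \<open>Only meaningful for nonempty \<open>K\<close>.\<close>

definition msetdist :: "('n::finite \<Rightarrow> real) \<Rightarrow> (real^'d^'n) set \<Rightarrow> real^'d^'n \<Rightarrow> real" where
  "msetdist m K y = (INF k\<in>K. mnorm m (y - k))"

definition mass_mult :: "('n::finite \<Rightarrow> real) \<Rightarrow> real^'d^'n \<Rightarrow> real^'d^'n" where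
  "mass_mult m x = (\<chi> i. m i *\<^sub>R (x $ i))"

definition moment :: "('n::finite \<Rightarrow> real) \<Rightarrow> real^'d^'n \<Rightarrow> real^'d" where
  "moment m x = (\<Sum>i\<in>UNIV. m i *\<^sub>R (x $ i))"

definition mass_pairs :: "('n::{finite,linorder} \<Rightarrow> real) \<Rightarrow> real" where
  "mass_pairs m = (\<Sum>(i,j)\<in>{(i,j). i < j}. m i * m j)"

definition potential :: "('n::{finite,linorder} \<Rightarrow> real) \<Rightarrow> real \<Rightarrow> real^'d^'n::{finite,linorder} \<Rightarrow> real" where
  "potential m \<alpha> x = (\<Sum>(i,j)\<in>{(i,j). i < j}. m i * m j * norm (x $ i - x $ j) powr (-\<alpha>))"

definition collisions :: "(real^'d^'n::finite) set" where
  "collisions = {x. \<exists>i j. i \<noteq> j \<and> x $ i = x $ j}"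

definition collisions_nbhd :: "('n::finite \<Rightarrow> real) \<Rightarrow> real \<Rightarrow> (real^'d^'n) set" where
  "collisions_nbhd m \<delta> = {x. \<exists>y\<in>collisions. mnorm m (x - y) < \<delta>}"

definition config_space :: "('n::finite \<Rightarrow> real) \<Rightarrow> (real^'d^'n) set" where
  "config_space m = {x. x \<notin> collisions \<and> moment m x = 0}"

definition ellipsoid :: "('n::finite \<Rightarrow> real) \<Rightarrow> (real^'d^'n) set" where
  "ellipsoid m = {x \<in> config_space m. mnorm m x = 1}"

definition tangent :: "('n::finite \<Rightarrow> real) \<Rightarrow> real^'d^'n \<Rightarrow> (real^'d^'n) set" where
  "tangent m s = {v. moment m v = 0 \<and> minner m s v = 0}"

definition dpot :: "('n::{finite,linorder} \<Rightarrow> real) \<Rightarrow> real \<Rightarrow> real^'d^'n::{finite,linorder} \<Rightarrow> real^'d^'n::{finite,linorder} \<Rightarrow> real" where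
  "dpot m \<alpha> s v = frechet_derivative (potential m \<alpha>) (at s) v"

definition d2pot :: "('n::{finite,linorder} \<Rightarrow> real) \<Rightarrow> real \<Rightarrow> real^'d^'n::{finite,linorder} \<Rightarrow> real^'d^'n::{finite,linorder} \<Rightarrow> real" where
  "d2pot m \<alpha> s v = frechet_derivative (\<lambda>y. dpot m \<alpha> y v) (at s) v"

text \<open>
  Hessian on tangent vectors of the potential restricted to the unit sphere of \<open>mnorm\<close>: the
  second term is the Lagrange multiplier of the constraint, since the potential is homogeneous of
  degree \<open>-\<alpha>\<close>.
\<close>

definition d2pot_E :: "('n::{finite,linorder} \<Rightarrow> real) \<Rightarrow> real \<Rightarrow> real^'d^'n::{finite,linorder} \<Rightarrow> real^'d^'n::{finite,linorder} \<Rightarrow> real" where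
  "d2pot_E m \<alpha> s v = d2pot m \<alpha> s v + \<alpha> * potential m \<alpha> s * (mnorm m v)\<^sup>2"

definition central_configs :: "('n::{finite,linorder} \<Rightarrow> real) \<Rightarrow> real \<Rightarrow> (real^'d^'n::{finite,linorder}) set" where
  "central_configs m \<alpha> = {s \<in> ellipsoid m. \<forall>v\<in>tangent m s. dpot m \<alpha> s v = 0}"

definition velocity :: "(real \<Rightarrow> 'a::real_normed_vector) \<Rightarrow> real \<Rightarrow> 'a" where
  "velocity x t = vector_derivative x (at t)"

definition action :: "('n::{finite,linorder} \<Rightarrow> real) \<Rightarrow> real \<Rightarrow> (real \<Rightarrow> real^'d^'n::{finite,linorder}) \<Rightarrow> ennreal" where
  "action m \<alpha> x =
     (\<integral>\<^sup>+t\<in>{0<..<1}. ennreal ((mnorm m (velocity x t))\<^sup>2 / 2 + potential m \<alpha> (x t)) \<partial>lborel)"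

definition energy :: "('n::{finite,linorder} \<Rightarrow> real) \<Rightarrow> real \<Rightarrow> (real \<Rightarrow> real^'d^'n::{finite,linorder}) \<Rightarrow> real \<Rightarrow> real" where
  "energy m \<alpha> x t = (mnorm m (velocity x t))\<^sup>2 / 2 - potential m \<alpha> (x t)"

definition total_collision_solution ::
  "('n::{finite,linorder} \<Rightarrow> real) \<Rightarrow> real \<Rightarrow> (real \<Rightarrow> real^'d^'n::{finite,linorder}) \<Rightarrow> bool" where
  "total_collision_solution m \<alpha> x \<longleftrightarrow>
     continuous_on {0..1} x \<and>
     x C1_differentiable_on {0<..<1} \<and> velocity x C1_differentiable_on {0<..<1} \<and>
     (\<forall>t\<in>{0..1}. moment m (x t) = 0) \<and>
     (\<forall>t\<in>{0..1}. x t \<in> collisions \<longrightarrow> t = 1) \<and> x 1 = 0 \<and>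
     (\<forall>t\<in>{0<..<1}. GDERIV (potential m \<alpha>) (x t) :> mass_mult m (velocity (velocity x) t)) \<and>
     action m \<alpha> x < \<infinity>"

definition rho_coord :: "('n::finite \<Rightarrow> real) \<Rightarrow> real \<Rightarrow> real^'d^'n \<Rightarrow> real" where
  "rho_coord m \<alpha> y = mnorm m y powr ((2 - \<alpha>) / 4)"

definition s_coord :: "('n::finite \<Rightarrow> real) \<Rightarrow> real^'d^'n \<Rightarrow> real^'d^'n" where
  "s_coord m y = (1 / mnorm m y) *\<^sub>R y"

definition asymptotic_to ::
  "('n::finite \<Rightarrow> real) \<Rightarrow> (real \<Rightarrow> real^'d^'n) \<Rightarrow> (real^'d^'n) set \<Rightarrow> bool" where
  "asymptotic_to m x K \<longleftrightarrow>
     K \<noteq> {} \<and> ((\<lambda>t. msetdist m K (s_coord m (x t))) \<longlongrightarrow> 0) (at_left 1)"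

text \<open>
  The new time satisfies \<open>dt = r powr ((2 + \<alpha>) / 2) d\<tau>\<close> and \<open>\<tau> = 0\<close> at \<open>t = 0\<close>;
  \<open>time_of\<close> is the inverse function, from \<open>{0..}\<close> to \<open>{0..<1}\<close>.
\<close>

definition tau_of :: "('n::finite \<Rightarrow> real) \<Rightarrow> real \<Rightarrow> (real \<Rightarrow> real^'d^'n) \<Rightarrow> real \<Rightarrow> real" where
  "tau_of m \<alpha> x t = integral {0..t} (\<lambda>u. mnorm m (x u) powr (- ((2 + \<alpha>) / 2)))"

definition time_of :: "('n::finite \<Rightarrow> real) \<Rightarrow> real \<Rightarrow> (real \<Rightarrow> real^'d^'n) \<Rightarrow> real \<Rightarrow> real" where
  "time_of m \<alpha> x \<tau> = inv_into {0..<1} (tau_of m \<alpha> x) \<tau>"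

definition rho :: "('n::finite \<Rightarrow> real) \<Rightarrow> real \<Rightarrow> (real \<Rightarrow> real^'d^'n) \<Rightarrow> real \<Rightarrow> real" where
  "rho m \<alpha> x \<tau> = rho_coord m \<alpha> (x (time_of m \<alpha> x \<tau>))"

definition shape :: "('n::finite \<Rightarrow> real) \<Rightarrow> real \<Rightarrow> (real \<Rightarrow> real^'d^'n) \<Rightarrow> real \<Rightarrow> real^'d^'n" where
  "shape m \<alpha> x \<tau> = s_coord m (x (time_of m \<alpha> x \<tau>))"

text \<open>Derivative with respect to \<open>\<tau> \<in> {0..}\<close>, one-sided at \<open>\<tau> = 0\<close>.\<close>

definition dtau :: "(real \<Rightarrow> 'a::real_normed_vector) \<Rightarrow> real \<Rightarrow> 'a" where
  "dtau f \<tau> = vector_derivative f (at \<tau> within {0..})"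

definition rescaled :: "real \<Rightarrow> (real \<Rightarrow> 'a::real_vector) \<Rightarrow> real \<Rightarrow> 'a" where
  "rescaled \<alpha> x t = (\<alpha> powr (- (1 / (\<alpha> + 2)))) *\<^sub>R x t"

text \<open>
  \<open>H\<^sup>1([0,1])\<close>, an element being identified with its absolutely continuous representative;
  \<open>g\<close> is the weak derivative.
\<close>

definition sobolev_H1 :: "(real \<Rightarrow> 'a::euclidean_space) \<Rightarrow> bool" where
  "sobolev_H1 \<phi> \<longleftrightarrow> (\<exists>g. set_borel_measurable lebesgue {0..1} g \<and>
     set_integrable lebesgue {0..1} (\<lambda>t. (norm (g t))\<^sup>2) \<and>
     (\<forall>t\<in>{0..1}. \<phi> t = \<phi> 0 + (LINT u:{0..t}|lebesgue. g u)))"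

text \<open>
  The components \<open>(\<zeta>, v)\<close> of a variation along \<open>\<rho>\<close> and \<open>s\<close>, as functions of \<open>\<tau>\<close>: the
  differentials of the two coordinate functions, applied to the tangent vector \<open>\<phi>\<close>.
\<close>

definition zeta_comp ::
  "('n::finite \<Rightarrow> real) \<Rightarrow> real \<Rightarrow> (real \<Rightarrow> real^'d^'n) \<Rightarrow> (real \<Rightarrow> real^'d^'n) \<Rightarrow> real \<Rightarrow> real" where
  "zeta_comp m \<alpha> x \<phi> \<tau> =
     frechet_derivative (rho_coord m \<alpha>) (at (x (time_of m \<alpha> x \<tau>))) (\<phi> (time_of m \<alpha> x \<tau>))"

definition v_comp ::
  "('n::finite \<Rightarrow> real) \<Rightarrow> real \<Rightarrow> (real \<Rightarrow> real^'d^'n) \<Rightarrow> (real \<Rightarrow> real^'d^'n) \<Rightarrow> real \<Rightarrow> real^'d^'n" where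
  "v_comp m \<alpha> x \<phi> \<tau> =
     frechet_derivative (s_coord m) (at (x (time_of m \<alpha> x \<tau>))) (\<phi> (time_of m \<alpha> x \<tau>))"

text \<open>The last condition says that the centre of mass of \<open>\<phi>\<close> is at the origin.\<close>

definition variation_in ::
  "('n::finite \<Rightarrow> real) \<Rightarrow> real \<Rightarrow> (real \<Rightarrow> real^'d^'n) \<Rightarrow> real \<Rightarrow> (real \<Rightarrow> real^'d^'n) \<Rightarrow> bool" where
  "variation_in m \<alpha> x t0 \<phi> \<longleftrightarrow>
     sobolev_H1 \<phi> \<and> closure {t\<in>{0..1}. \<phi> t \<noteq> 0} \<subseteq> {t0<..<1} \<and>
     (\<forall>\<tau>\<ge>0. v_comp m \<alpha> x \<phi> \<tau> \<in> tangent m (shape m \<alpha> x \<tau>))"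

text \<open>
  In the variables \<open>(\<rho>, s, \<tau>)\<close> the action reads
  \<open>\<integral> ((4 / (2 - \<alpha>))\<^sup>2 \<rho>'\<^sup>2 + \<rho>\<^sup>2 |s'|\<^sup>2) / 2 + \<rho>\<^sup>2 U(s) d\<tau>\<close>. Its second differential is taken in
  these variables, on \<open>\<tau> \<in> {0..}\<close>, without varying the parametrization \<open>\<tau>\<close>.
\<close>

definition d2_rho_rho ::
  "('n::{finite,linorder} \<Rightarrow> real) \<Rightarrow> real \<Rightarrow> (real \<Rightarrow> real^'d^'n::{finite,linorder}) \<Rightarrow> (real \<Rightarrow> real) \<Rightarrow> real" where
  "d2_rho_rho m \<alpha> x \<zeta> = (LINT \<tau>:{0..}|lebesgue.
     (4 / (2 - \<alpha>))\<^sup>2 * (dtau \<zeta> \<tau>)\<^sup>2 +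
     (\<zeta> \<tau>)\<^sup>2 * ((mnorm m (dtau (shape m \<alpha> x) \<tau>))\<^sup>2 + 2 * potential m \<alpha> (shape m \<alpha> x \<tau>)))"

definition d2_rho_s ::
  "('n::{finite,linorder} \<Rightarrow> real) \<Rightarrow> real \<Rightarrow> (real \<Rightarrow> real^'d^'n::{finite,linorder}) \<Rightarrow>
     (real \<Rightarrow> real) \<Rightarrow> (real \<Rightarrow> real^'d^'n::{finite,linorder}) \<Rightarrow> real" where
  "d2_rho_s m \<alpha> x \<zeta> v = 2 * (LINT \<tau>:{0..}|lebesgue.
     rho m \<alpha> x \<tau> * \<zeta> \<tau> *
     (minner m (dtau (shape m \<alpha> x) \<tau>) (dtau v \<tau>) + dpot m \<alpha> (shape m \<alpha> x \<tau>) (v \<tau>)))"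

definition d2_s_s ::
  "('n::{finite,linorder} \<Rightarrow> real) \<Rightarrow> real \<Rightarrow> (real \<Rightarrow> real^'d^'n::{finite,linorder}) \<Rightarrow> (real \<Rightarrow> real^'d^'n::{finite,linorder}) \<Rightarrow> real" where
  "d2_s_s m \<alpha> x v = (LINT \<tau>:{0..}|lebesgue.
     (rho m \<alpha> x \<tau>)\<^sup>2 * ((mnorm m (dtau v \<tau>))\<^sup>2 + d2pot_E m \<alpha> (shape m \<alpha> x \<tau>) (v \<tau>)))"

definition d2_action ::
  "('n::{finite,linorder} \<Rightarrow> real) \<Rightarrow> real \<Rightarrow> (real \<Rightarrow> real^'d^'n::{finite,linorder}) \<Rightarrow> (real \<Rightarrow> real^'d^'n::{finite,linorder}) \<Rightarrow> real" where
  "d2_action m \<alpha> x \<phi> =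
     d2_rho_rho m \<alpha> x (zeta_comp m \<alpha> x \<phi>) +
     2 * d2_rho_s m \<alpha> x (zeta_comp m \<alpha> x \<phi>) (v_comp m \<alpha> x \<phi>) +
     d2_s_s m \<alpha> x (v_comp m \<alpha> x \<phi>)"

end

theory Submission
  imports Defs
begin

text \<open>
  The idea. In the logarithmic limit \<open>\<alpha> \<rightarrow> 0\<close> the weight \<open>\<rho>\<close> of the shape variations contracts at a rate
  that becomes arbitrarily large close to the collision. By a Hardy inequality the term
  \<open>\<integral> \<rho>\<^sup>2 |v'|\<^sup>2\<close> then dominates the possibly negative Hessian term \<open>\<integral> \<rho>\<^sup>2 \<nabla>\<^sup>2U(v, v)\<close>, while the
  radial term has the coercive coefficient \<open>2 U\<close>, which in the rescaled variables is of order
  \<open>1 / \<alpha>\<close> and absorbs the mixed term.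

  Everything is formulated in the original time \<open>t\<close>. Write \<open>r = |x|\<close>, let \<open>s = x / r\<close> be the shape, let a
  prime denote the derivative in the rescaled collision time \<open>\<tau>\<close>, and put
  \<open>V = (U\<^sub>\<alpha>(s) - \<Sum> m\<^sub>i m\<^sub>j) / \<alpha>\<close>, a bounded perturbation of \<open>- \<Sum> m\<^sub>i m\<^sub>j log |s\<^sub>i - s\<^sub>j|\<close> away from the
  collisions. The central quantity is the shape energy \<open>E = |s'|\<^sup>2 / 2 - V\<close>. The prescribed total
  energy makes it a function of \<open>r\<close> and its derivative alone, and the Lagrange-Jacobi identity gives
  \<open>E' = 2 \<lambda> |s'|\<^sup>2\<close>, where \<open>\<lambda> = - \<rho>' / \<rho> > 0\<close> is the contraction rate. The steps are these.

  \<^item> \<open>E\<close> is nondecreasing, hence bounded below by the initial value of \<open>- V\<close> (\<open>shape_energy_lower\<close>), and above because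
    otherwise \<open>|s'| > 1\<close> up to the collision, which would make \<open>E\<close> grow like \<open>- log r\<close>, although
    it is bounded for each \<open>\<alpha>\<close> (\<open>shape_energy_le\<close>). Both bounds are uniform in \<open>\<alpha>\<close>.

  \<^item> The identity \<open>\<lambda>\<^sup>2 / (2 p\<^sup>2) = (\<Sum> m\<^sub>i m\<^sub>j) (1 - R\<^sup>\<alpha>) / \<alpha> - E\<close>, with \<open>p = (2 - \<alpha>) / 4\<close> and
    \<open>R\<close> the rescaled radius, shows that \<open>\<lambda>\<close> exceeds any prescribed number as soon as the rescaled
    radius is small and \<open>\<alpha>\<close> is small (\<open>contraction_rate\<close>).

  \<^item> Since \<open>E\<close> is bounded, \<open>\<integral> |s'|\<^sup>2\<close> is small after such a time. While \<open>|s'| \<le> 1\<close> the shape is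
    away from the collisions, because \<open>V = |s'|\<^sup>2 / 2 - E\<close>. On an interval where \<open>|s'| \<ge> 1\<close> one has
    \<open>|s'| \<le> |s'|\<^sup>2\<close>, so the shape moves only a little. Hence the shape stays uniformly away from
    the collisions and its speed stays bounded (\<open>eventually_separated\<close>, \<open>shape_speed2_bound\<close>).

  \<^item> The identity for \<open>\<lambda>\<close> also bounds \<open>r\<close> from below on bounded intervals of \<open>\<tau>\<close>, so that these late
    values of \<open>\<tau>\<close> are reached before a time \<open>t\<^sup>* < 1\<close> that does not depend on \<open>\<alpha>\<close> (\<open>late_times\<close>).

  \<^item> With these bounds the integrand of the second differential is at least the derivative of a multiple of
    \<open>\<rho>\<^sup>2 |v|\<^sup>2\<close>, whose integral vanishes, plus a positive multiple of
    \<open>\<zeta>\<^sup>2\<close> and of \<open>\<rho>\<^sup>2 |v|\<^sup>2\<close> (\<open>quadratic_form_bound\<close>, \<open>second_variation_pos\<close>). This is the Hardy inequality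
    in differential form; it is integrated after a change of variables from \<open>\<tau>\<close> to \<open>t\<close>.
\<close>

section \<open>Primitives of square-integrable functions\<close>

text \<open>
  \<open>F\<close> is an element of \<open>H\<^sup>1\<close> on the interval, given by its absolutely continuous representative, and
  \<open>f\<close> is a square-integrable weak derivative of \<open>F\<close>.
\<close>

definition h1_primitive :: "(real \<Rightarrow> 'a::euclidean_space) \<Rightarrow> (real \<Rightarrow> 'a) \<Rightarrow> real \<Rightarrow> real \<Rightarrow> bool" where
  "h1_primitive F f a b \<longleftrightarrow>
     f absolutely_integrable_on {a..b} \<and> (\<lambda>t. (norm (f t))\<^sup>2) integrable_on {a..b} \<and>
     (\<forall>t\<in>{a..b}. F t = F a + integral {a..t} f)"

lemma h1_primitiveD:
  assumes "h1_primitive F f a b"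
  shows "f absolutely_integrable_on {a..b}" "(\<lambda>t. (norm (f t))\<^sup>2) integrable_on {a..b}"
  using assms unfolding h1_primitive_def by blast+

lemma borel_measurable_bounded_bilinear:
  fixes h :: "'a::euclidean_space \<Rightarrow> 'b::euclidean_space \<Rightarrow> 'c::euclidean_space"
  assumes "bounded_bilinear h" "f \<in> borel_measurable M" "g \<in> borel_measurable M"
  shows "(\<lambda>x. h (f x) (g x)) \<in> borel_measurable M"
proof -
  interpret bounded_bilinear h by fact
  show ?thesis
    by (rule borel_measurable_continuous_Pair[OF assms(2,3)])
      (intro continuous_on continuous_on_fst continuous_on_snd continuous_on_id)
qed

lemma absolutely_integrable_bilinear_L2:
  fixes h :: "'a::euclidean_space \<Rightarrow> 'b::euclidean_space \<Rightarrow> 'c::euclidean_space"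
  assumes h: "bounded_bilinear h"
    and f: "f absolutely_integrable_on {a..b::real}" "(\<lambda>t. (norm (f t))\<^sup>2) integrable_on {a..b}"
    and g: "g absolutely_integrable_on {a..b}" "(\<lambda>t. (norm (g t))\<^sup>2) integrable_on {a..b}"
  shows "(\<lambda>t. h (f t) (g t)) absolutely_integrable_on {a..b}"
proof -
  interpret bounded_bilinear h by fact
  obtain K where K: "K > 0" "\<And>x y. norm (h x y) \<le> norm x * norm y * K"
    using pos_bounded by blast
  show ?thesis
  proof (rule measurable_bounded_by_integrable_imp_absolutely_integrable)
    show "(\<lambda>t. h (f t) (g t)) \<in> borel_measurable (lebesgue_on {a..b})"
      using f(1) g(1) by (intro borel_measurable_bounded_bilinear[OF h])
        (auto simp: absolutely_integrable_measurable)
    show "(\<lambda>t. K * ((norm (f t))\<^sup>2 + (norm (g t))\<^sup>2)) integrable_on {a..b}"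
      using f(2) g(2) by (intro integrable_on_mult_right integrable_add)
    fix t
    have "2 * (norm (f t) * norm (g t)) \<le> (norm (f t))\<^sup>2 + (norm (g t))\<^sup>2"
      using sum_squares_bound[of "norm (f t)" "norm (g t)"] by simp
    moreover have "norm (f t) * norm (g t) \<ge> 0" by simp
    ultimately have "norm (f t) * norm (g t) \<le> (norm (f t))\<^sup>2 + (norm (g t))\<^sup>2"
      by linarith
    then have "K * (norm (f t) * norm (g t)) \<le> K * ((norm (f t))\<^sup>2 + (norm (g t))\<^sup>2)"
      using K(1) by (intro mult_left_mono) auto
    then show "norm (h (f t) (g t)) \<le> K * ((norm (f t))\<^sup>2 + (norm (g t))\<^sup>2)"
      using K(2)[of "f t" "g t"] by (simp only: mult.commute[of K])
  qed auto
qed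

lemma absolutely_integrable_bilinear_continuous:
  fixes h :: "'a::euclidean_space \<Rightarrow> 'b::euclidean_space \<Rightarrow> 'c::euclidean_space"
  assumes h: "bounded_bilinear h"
    and f: "continuous_on {a..b::real} f" and g: "g absolutely_integrable_on {a..b}"
  shows "(\<lambda>t. h (f t) (g t)) absolutely_integrable_on {a..b}"
proof (rule absolutely_integrable_bounded_measurable_product[where h=h and f=f, OF _ _ _ _ g])
  show "bilinear h" using h by (simp add: bilinear_conv_bounded_bilinear)
  show "bounded (f ` {a..b})"
    by (rule compact_imp_bounded[OF compact_continuous_image[OF f]]) simp
  show "f \<in> borel_measurable (lebesgue_on {a..b})"
    by (rule continuous_imp_measurable_on_sets_lebesgue[OF f]) simp
qed simp

lemma square_integrable_bilinear_continuous:
  fixes h :: "'a::euclidean_space \<Rightarrow> 'b::euclidean_space \<Rightarrow> 'c::euclidean_space"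
  assumes h: "bounded_bilinear h" and f: "continuous_on {a..b::real} f"
    and g: "g absolutely_integrable_on {a..b}" "(\<lambda>t. (norm (g t))\<^sup>2) integrable_on {a..b}"
  shows "(\<lambda>t. (norm (h (f t) (g t)))\<^sup>2) integrable_on {a..b}"
proof -
  interpret bounded_bilinear h by fact
  obtain K where K: "K > 0" "\<And>x y. norm (h x y) \<le> norm x * norm y * K"
    using pos_bounded by blast
  obtain M where M: "\<And>t. t \<in> {a..b} \<Longrightarrow> norm (f t) \<le> M"
    using compact_imp_bounded[OF compact_continuous_image[OF f]] unfolding bounded_iff by blast
  have "(\<lambda>t. (norm (h (f t) (g t)))\<^sup>2) absolutely_integrable_on {a..b}"
  proof (rule measurable_bounded_by_integrable_imp_absolutely_integrable)
    have [measurable]: "(\<lambda>t. h (f t) (g t)) \<in> borel_measurable (lebesgue_on {a..b})"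
      using absolutely_integrable_bilinear_continuous[OF h f g(1)]
      by (simp add: absolutely_integrable_measurable)
    show "(\<lambda>t. (norm (h (f t) (g t)))\<^sup>2) \<in> borel_measurable (lebesgue_on {a..b})"
      by measurable
    show "(\<lambda>t. (M * K)\<^sup>2 * (norm (g t))\<^sup>2) integrable_on {a..b}"
      using g(2) by (rule integrable_on_mult_right)
    fix t assume t: "t \<in> {a..b}"
    have "norm (h (f t) (g t)) \<le> norm (f t) * norm (g t) * K" by (rule K)
    also have "\<dots> = norm (f t) * (norm (g t) * K)" by simp
    also have "\<dots> \<le> M * (norm (g t) * K)"
      using K(1) M[OF t] by (intro mult_right_mono) auto
    finally have "(norm (h (f t) (g t)))\<^sup>2 \<le> (M * (norm (g t) * K))\<^sup>2"
      by (rule power_mono) auto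
    then show "norm ((norm (h (f t) (g t)))\<^sup>2) \<le> (M * K)\<^sup>2 * (norm (g t))\<^sup>2"
      by (simp add: power_mult_distrib mult_ac)
  qed auto
  then show ?thesis by (simp add: absolutely_integrable_on_def)
qed

lemma square_integrable_add:
  fixes f g :: "real \<Rightarrow> 'a::euclidean_space"
  assumes f: "f absolutely_integrable_on {a..b}" "(\<lambda>t. (norm (f t))\<^sup>2) integrable_on {a..b}"
    and g: "g absolutely_integrable_on {a..b}" "(\<lambda>t. (norm (g t))\<^sup>2) integrable_on {a..b}"
  shows "(\<lambda>t. (norm (f t + g t))\<^sup>2) integrable_on {a..b}"
proof -
  have "(\<lambda>t. (norm (f t + g t))\<^sup>2) absolutely_integrable_on {a..b}"
  proof (rule measurable_bounded_by_integrable_imp_absolutely_integrable)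
    have [measurable]: "(\<lambda>t. f t + g t) \<in> borel_measurable (lebesgue_on {a..b})"
      using set_integral_add(1)[OF f(1) g(1)] by (simp add: absolutely_integrable_measurable)
    show "(\<lambda>t. (norm (f t + g t))\<^sup>2) \<in> borel_measurable (lebesgue_on {a..b})"
      by measurable
    show "(\<lambda>t. 2 * ((norm (f t))\<^sup>2 + (norm (g t))\<^sup>2)) integrable_on {a..b}"
      using f(2) g(2) by (intro integrable_on_mult_right integrable_add)
    fix t
    have "(norm (f t + g t))\<^sup>2 \<le> (norm (f t) + norm (g t))\<^sup>2"
      by (intro power_mono norm_triangle_ineq) auto
    also have "\<dots> \<le> 2 * ((norm (f t))\<^sup>2 + (norm (g t))\<^sup>2)"
      using sum_squares_bound[of "norm (f t)" "norm (g t)"] by (simp add: power2_sum)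
    finally show "norm ((norm (f t + g t))\<^sup>2) \<le> 2 * ((norm (f t))\<^sup>2 + (norm (g t))\<^sup>2)" by simp
  qed auto
  then show ?thesis by (simp add: absolutely_integrable_on_def)
qed

lemma h1_primitive_continuous:
  assumes "h1_primitive F f a b" shows "continuous_on {a..b} F"
proof -
  have "continuous_on {a..b} (\<lambda>t. F a + integral {a..t} f)"
    using assms by (intro continuous_intros indefinite_integral_continuous_1)
      (auto simp: h1_primitive_def absolutely_integrable_on_def)
  moreover have "\<And>t. t \<in> {a..b} \<Longrightarrow> F t = F a + integral {a..t} f"
    using assms unfolding h1_primitive_def by blast
  ultimately show ?thesis
    by (rule continuous_on_eq[OF _ sym])
qed

lemma h1_primitive_increment:
  assumes "h1_primitive F f a b" "a \<le> u" "u \<le> v" "v \<le> b"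
  shows "F v - F u = integral {u..v} f"
proof -
  have "f integrable_on {a..v}"
    using assms by (auto simp: h1_primitive_def absolutely_integrable_on_def intro: integrable_subinterval_real)
  then have "integral {a..u} f + integral {u..v} f = integral {a..v} f"
    using assms by (intro Henstock_Kurzweil_Integration.integral_combine) auto
  moreover have "\<forall>t\<in>{a..b}. F t = F a + integral {a..t} f"
    using assms(1) unfolding h1_primitive_def by blast
  then have F: "F v = F a + integral {a..v} f" "F u = F a + integral {a..u} f"
    by (rule bspec, use assms(2-4) in simp)+
  ultimately show ?thesis
    unfolding F by (simp add: algebra_simps)
qed

lemma h1_primitive_C1:
  fixes F :: "real \<Rightarrow> 'a::euclidean_space"
  assumes "\<And>t. t \<in> {a..b} \<Longrightarrow> (F has_vector_derivative f t) (at t)" and "continuous_on {a..b} f"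
  shows "h1_primitive F f a b"
  unfolding h1_primitive_def
proof (intro conjI ballI)
  show "f absolutely_integrable_on {a..b}"
    using assms(2) by (rule absolutely_integrable_continuous_real)
  show "(\<lambda>t. (norm (f t))\<^sup>2) integrable_on {a..b}"
    using assms(2) by (intro integrable_continuous_real continuous_intros)
  fix t assume t: "t \<in> {a..b}"
  have "(f has_integral F t - F a) {a..t}"
    using t assms(1) by (intro fundamental_theorem_of_calculus) (auto intro: has_vector_derivative_at_within)
  then show "F t = F a + integral {a..t} f"
    by (simp add: integral_unique)
qed

text \<open>
  The product rule. The defect \<open>D\<close> of the fundamental theorem for \<open>h (F t) (G t)\<close> is additive over
  adjacent intervals and, by continuity of \<open>F\<close> and \<open>G\<close>, at most \<open>e\<close> times \<open>\<integral> (|f| + |g|)\<close> over short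
  intervals, for every \<open>e > 0\<close>. By bisection the same bound holds over the whole interval.
\<close>

lemma h1_primitive_bilinear:
  fixes h :: "'a::euclidean_space \<Rightarrow> 'b::euclidean_space \<Rightarrow> 'c::euclidean_space"
  assumes h: "bounded_bilinear h"
    and F: "h1_primitive F f a b" and G: "h1_primitive G g a b"
  shows "h1_primitive (\<lambda>t. h (F t) (G t)) (\<lambda>t. h (f t) (G t) + h (F t) (g t)) a b"
proof -
  interpret bounded_bilinear h by fact
  let ?k = "\<lambda>t. h (f t) (G t) + h (F t) (g t)"
  note cF = h1_primitive_continuous[OF F] and cG = h1_primitive_continuous[OF G]
  have fi: "f absolutely_integrable_on {a..b}" "(\<lambda>t. (norm (f t))\<^sup>2) integrable_on {a..b}"
    and gi: "g absolutely_integrable_on {a..b}" "(\<lambda>t. (norm (g t))\<^sup>2) integrable_on {a..b}"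
    using F G by (auto simp: h1_primitive_def)
  obtain K where K: "K > 0" "\<And>x y. norm (h x y) \<le> norm x * norm y * K"
    using pos_bounded by blast
  have k1: "(\<lambda>t. h (F t) (g t)) absolutely_integrable_on {a..b}"
    by (rule absolutely_integrable_bilinear_continuous[OF h cF gi(1)])
  have k2: "(\<lambda>t. h (f t) (G t)) absolutely_integrable_on {a..b}"
    by (rule absolutely_integrable_bilinear_continuous[OF flip cG fi(1)])
  have ki: "?k absolutely_integrable_on {a..b}"
    by (rule set_integral_add(1)[OF k2 k1])
  have ki2: "(\<lambda>t. (norm (?k t))\<^sup>2) integrable_on {a..b}"
    by (rule square_integrable_add[OF k2 square_integrable_bilinear_continuous[OF flip cG fi]
          k1 square_integrable_bilinear_continuous[OF h cF gi]])
  have fI: "f integrable_on {u..v}" "g integrable_on {u..v}" "(\<lambda>t. norm (f t)) integrable_on {u..v}"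
    "(\<lambda>t. norm (g t)) integrable_on {u..v}" "?k integrable_on {u..v}"
    if "a \<le> u" "v \<le> b" for u v
    using that fi(1) gi(1) ki
    by (auto simp: absolutely_integrable_on_def intro: integrable_subinterval_real)
  have fund: "h (F c) (G c) = h (F a) (G a) + integral {a..c} ?k" if c: "c \<in> {a..b}" for c
  proof -
    let ?D = "\<lambda>u v. h (F v) (G v) - h (F u) (G u) - integral {u..v} ?k"
    let ?H = "\<lambda>u v. integral {u..v} (\<lambda>t. norm (f t) + norm (g t))"
    have HI: "(\<lambda>t. norm (f t) + norm (g t)) integrable_on {u..v}" if "a \<le> u" "v \<le> b" for u v
      using fI[OF that] by (intro integrable_add)
    have est: "norm (?D a c) \<le> e * ?H a c" if e: "e > 0" for e
    proof -
      have "a \<le> a \<longrightarrow> c \<le> b \<longrightarrow> norm (?D a c) \<le> e * ?H a c"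
      proof (rule Bolzano[of a c "\<lambda>u v. a \<le> u \<longrightarrow> v \<le> b \<longrightarrow> norm (?D u v) \<le> e * ?H u v"])
        show "a \<le> c" using c by simp
      next
        fix u v w
        assume 1: "a \<le> u \<longrightarrow> v \<le> b \<longrightarrow> norm (?D u v) \<le> e * ?H u v"
          and 2: "a \<le> v \<longrightarrow> w \<le> b \<longrightarrow> norm (?D v w) \<le> e * ?H v w" and uvw: "u \<le> v" "v \<le> w"
        show "a \<le> u \<longrightarrow> w \<le> b \<longrightarrow> norm (?D u w) \<le> e * ?H u w"
        proof (intro impI)
          assume aw: "a \<le> u" "w \<le> b"
          have *: "?H u v + ?H v w = ?H u w" "integral {u..v} ?k + integral {v..w} ?k = integral {u..w} ?k"
            using uvw aw fI(5)[of u w] HI[of u w]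
            by (auto intro!: Henstock_Kurzweil_Integration.integral_combine)
          then have "?D u w = ?D u v + ?D v w"
            by (simp add: algebra_simps flip: *(2))
          then have "norm (?D u w) \<le> norm (?D u v) + norm (?D v w)"
            by (simp only: norm_triangle_ineq)
          also have "\<dots> \<le> e * ?H u v + e * ?H v w"
            using 1 2 uvw aw by (intro add_mono) auto
          also have "\<dots> = e * ?H u w"
            by (simp only: *(1)[symmetric] distrib_left)
          finally show "norm (?D u w) \<le> e * ?H u w" .
        qed
      next
        fix x assume "a \<le> x" "x \<le> c"
        have uF: "uniformly_continuous_on {a..b} F" and uG: "uniformly_continuous_on {a..b} G"
          using cF cG by (auto intro: compact_uniformly_continuous)
        have eK: "e / K > 0" using e K by simp
        obtain d1 where d1: "d1 > 0" "\<And>u v. u \<in> {a..b} \<Longrightarrow> v \<in> {a..b} \<Longrightarrow> dist v u < d1 \<Longrightarrow> dist (F v) (F u) < e / K"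
          using uF[unfolded uniformly_continuous_on_def, rule_format, OF eK] by blast
        obtain d2 where d2: "d2 > 0" "\<And>u v. u \<in> {a..b} \<Longrightarrow> v \<in> {a..b} \<Longrightarrow> dist v u < d2 \<Longrightarrow> dist (G v) (G u) < e / K"
          using uG[unfolded uniformly_continuous_on_def, rule_format, OF eK] by blast
        show "\<exists>d>0. \<forall>u v. u \<le> x \<and> x \<le> v \<and> v - u < d \<longrightarrow> a \<le> u \<longrightarrow> v \<le> b \<longrightarrow> norm (?D u v) \<le> e * ?H u v"
        proof (intro exI[of _ "min d1 d2"] conjI allI impI)
          fix u v assume uv: "u \<le> x \<and> x \<le> v \<and> v - u < min d1 d2" "a \<le> u" "v \<le> b"
          have I1: "integral {u..v} (\<lambda>t. h (f t) (G v)) = h (integral {u..v} f) (G v)"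
            using integral_linear[OF fI(1)[OF uv(2,3)] bounded_linear_left[of "G v"]] by (simp add: o_def)
          have I2: "integral {u..v} (\<lambda>t. h (F u) (g t)) = h (F u) (integral {u..v} g)"
            using integral_linear[OF fI(2)[OF uv(2,3)] bounded_linear_right[of "F u"]] by (simp add: o_def)
          have J1: "(\<lambda>t. h (f t) (G v)) integrable_on {u..v}"
            using integrable_linear[OF fI(1)[OF uv(2,3)] bounded_linear_left[of "G v"]] by (simp add: o_def)
          have J2: "(\<lambda>t. h (F u) (g t)) integrable_on {u..v}"
            using integrable_linear[OF fI(2)[OF uv(2,3)] bounded_linear_right[of "F u"]] by (simp add: o_def)
          have "h (F v) (G v) - h (F u) (G u) = h (F v - F u) (G v) + h (F u) (G v - G u)"
            by (simp add: diff_left diff_right)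
          also have "\<dots> = integral {u..v} (\<lambda>t. h (f t) (G v) + h (F u) (g t))"
            using uv h1_primitive_increment[OF F, of u v] h1_primitive_increment[OF G, of u v]
            by (simp add: I1 I2 Henstock_Kurzweil_Integration.integral_add J1 J2)
          finally have "?D u v = integral {u..v} (\<lambda>t. (h (f t) (G v) + h (F u) (g t)) - ?k t)"
            using fI(5)[OF uv(2,3)] J1 J2
            by (subst Henstock_Kurzweil_Integration.integral_diff) (auto intro: integrable_add)
          also have "norm \<dots> \<le> integral {u..v} (\<lambda>t. e * (norm (f t) + norm (g t)))"
          proof (rule integral_norm_bound_integral)
            show "(\<lambda>t. h (f t) (G v) + h (F u) (g t) - ?k t) integrable_on {u..v}"
              using fI(5)[OF uv(2,3)] J1 J2 by (auto intro!: integrable_add integrable_diff)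
            show "(\<lambda>t. e * (norm (f t) + norm (g t))) integrable_on {u..v}"
              using HI[OF uv(2,3)] by (rule integrable_on_mult_right)
            fix t assume t: "t \<in> {u..v}"
            have 1: "norm (G v - G t) \<le> e / K" "norm (F u - F t) \<le> e / K"
              using t uv d1(2)[of t u] d2(2)[of t v] by (auto simp: dist_norm dist_real_def less_imp_le)
            have "h (f t) (G v) + h (F u) (g t) - ?k t = h (f t) (G v - G t) + h (F u - F t) (g t)"
              by (simp add: diff_left diff_right)
            also have "norm \<dots> \<le> norm (f t) * norm (G v - G t) * K + norm (F u - F t) * norm (g t) * K"
              by (intro order.trans[OF norm_triangle_ineq] add_mono K)
            also have "\<dots> \<le> norm (f t) * (e / K) * K + (e / K) * norm (g t) * K"
              using 1 K(1) by (intro add_mono mult_right_mono mult_left_mono) auto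
            also have "\<dots> = e * (norm (f t) + norm (g t))"
              using K(1) by (simp add: field_simps)
            finally show "norm (h (f t) (G v) + h (F u) (g t) - ?k t) \<le> e * (norm (f t) + norm (g t))" .
          qed
          finally show "norm (?D u v) \<le> e * ?H u v" by simp
        qed (use d1 d2 in auto)
      qed
      then show ?thesis using c by auto
    qed
    have "norm (?D a c) \<le> 0"
    proof (rule field_le_epsilon)
      fix e :: real assume e: "e > 0"
      have H0: "?H a c \<ge> 0"
        using c by (intro Henstock_Kurzweil_Integration.integral_nonneg HI) auto
      have "norm (?D a c) \<le> e / (?H a c + 1) * ?H a c"
        using H0 e by (intro est) auto
      also have "\<dots> \<le> e"
        using H0 e by (simp add: field_simps)
      finally show "norm (?D a c) \<le> 0 + e" by simp
    qed
    then show ?thesis by (simp add: algebra_simps)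
  qed
  show ?thesis
    unfolding h1_primitive_def using ki ki2 fund by blast
qed

text \<open>
  The averages of \<open>f\<close> over \<open>{t..t + h}\<close> converge to \<open>f t\<close> for almost every \<open>t\<close>; the left derivative is
  obtained from the reflected function.
\<close>

lemma h1_primitive_AE_derivative:
  fixes F :: "real \<Rightarrow> 'a::euclidean_space"
  assumes F: "h1_primitive F f a b"
  obtains N where "negligible N"
    and "\<And>t. t \<in> {a<..<b} - N \<Longrightarrow> (F has_vector_derivative f t) (at t)"
proof -
  define f0 where "f0 t = (if t \<in> {a..b} then f t else 0)" for t
  have "f integrable_on {a..b}"
    using F by (auto simp: h1_primitive_def absolutely_integrable_on_def)
  then have U: "f0 integrable_on UNIV"
    unfolding f0_def integrable_restrict_UNIV .
  then have f0i: "f0 integrable_on cbox u v" for u v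
    by (rule integrable_on_subcbox) auto
  have f0r: "(\<lambda>t. f0 (- t)) integrable_on cbox u v" for u v
    using f0i[of "-v" "-u"] Henstock_Kurzweil_Integration.integrable_reflect_real[where f=f0 and a="-v" and b="-u"] by (simp only: minus_minus box_real)
  obtain N1 where N1: "negligible N1" "\<And>x e. \<lbrakk>x \<notin> N1; 0 < e\<rbrakk> \<Longrightarrow>
      \<exists>d>0. \<forall>h. 0 < h \<and> h < d \<longrightarrow> norm (integral (cbox x (x + h *\<^sub>R One)) f0 /\<^sub>R h ^ DIM(real) - f0 x) < e"
    using integrable_ccontinuous_explicit[OF f0i] by metis
  obtain N2 where N2: "negligible N2" "\<And>x e. \<lbrakk>x \<notin> N2; 0 < e\<rbrakk> \<Longrightarrow>
      \<exists>d>0. \<forall>h. 0 < h \<and> h < d \<longrightarrow>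
        norm (integral (cbox x (x + h *\<^sub>R One)) (\<lambda>t. f0 (- t)) /\<^sub>R h ^ DIM(real) - f0 (- x)) < e"
    using integrable_ccontinuous_explicit[OF f0r] by metis
  have "negligible (uminus ` N2)"
    using N2(1) by (intro negligible_differentiable_image_negligible) (auto intro!: derivative_intros simp: differentiable_on_def)
  then have neg: "negligible (N1 \<union> uminus ` N2)"
    using N1(1) by simp
  have "(F has_vector_derivative f x) (at x)" if x: "x \<in> {a<..<b} - (N1 \<union> uminus ` N2)" for x
  proof -
    have nN: "x \<notin> N1" "- x \<notin> N2" and xab: "a < x" "x < b"
      using x by (auto simp: image_iff)
    have fx: "f0 x = f x" using xab by (simp add: f0_def)
    have "((\<lambda>h. (F (x + h) - F x) /\<^sub>R h) \<longlongrightarrow> f x) (at 0)"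
      unfolding LIM_def
    proof (intro allI impI)
      fix e :: real assume e: "e > 0"
      obtain d1 where d1: "d1 > 0" "\<And>h. 0 < h \<Longrightarrow> h < d1 \<Longrightarrow> norm (integral {x..x+h} f0 /\<^sub>R h - f x) < e"
        using N1(2)[OF nN(1) e] fx by auto
      obtain d2 where d2: "d2 > 0" "\<And>h. 0 < h \<Longrightarrow> h < d2 \<Longrightarrow>
          norm (integral {-x..-x+h} (\<lambda>t. f0 (- t)) /\<^sub>R h - f x) < e"
        using N2(2)[OF nN(2) e] fx by auto
      have eq: "integral {u..v} f0 = F v - F u" if "a \<le> u" "u \<le> v" "v \<le> b" for u v
      proof -
        have "integral {u..v} f0 = integral {u..v} f"
          using that by (intro integral_cong) (auto simp: f0_def)
        then show ?thesis using h1_primitive_increment[OF F that] by simp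
      qed
      let ?d = "min (min d1 d2) (min (x - a) (b - x))"
      show "\<exists>d>0. \<forall>h. h \<noteq> 0 \<and> dist h 0 < d \<longrightarrow> dist ((F (x + h) - F x) /\<^sub>R h) (f x) < e"
      proof (intro exI[of _ ?d] conjI allI impI)
        fix h :: real assume h: "h \<noteq> 0 \<and> dist h 0 < ?d"
        show "dist ((F (x + h) - F x) /\<^sub>R h) (f x) < e"
        proof (cases "h > 0")
          case True
          then show ?thesis
            using h d1(2)[of h] eq[of x "x + h"] xab by (simp add: dist_norm)
        next
          case False
          then have hn: "-h > 0" using h by linarith
          have "integral {-x..-x+(-h)} (\<lambda>t. f0 (- t)) = integral {x+h..x} f0"
            using Henstock_Kurzweil_Integration.integral_reflect_real[where f=f0 and b=x and a="x+h"] by simp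
          also have "\<dots> = F x - F (x + h)"
            using h hn xab by (intro eq) auto
          finally have "norm ((F x - F (x + h)) /\<^sub>R (- h) - f x) < e"
            using d2(2)[of "-h"] h hn by simp
          moreover have "(F x - F (x + h)) /\<^sub>R (- h) = (F (x + h) - F x) /\<^sub>R h"
            by (simp add: scaleR_diff_right)
          ultimately show ?thesis by (simp add: dist_norm)
        qed
      qed (use d1 d2 xab in auto)
    qed
    then have "((\<lambda>h. norm ((F (x + h) - F x) /\<^sub>R h - f x)) \<longlongrightarrow> 0) (at 0)"
      by (rule tendsto_norm_zero[OF LIM_zero])
    moreover have "norm ((F (x + h) - F x) /\<^sub>R h - f x) = norm (F (x + h) - F x - h *\<^sub>R f x) / norm h"
      if "h \<noteq> 0" for h
    proof -
      have "(F (x + h) - F x) /\<^sub>R h - f x = (F (x + h) - F x - h *\<^sub>R f x) /\<^sub>R h"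
        using that by (simp add: scaleR_diff_right)
      then show ?thesis by (simp add: divide_inverse_commute)
    qed
    then have "\<forall>\<^sub>F h in at 0. norm ((F (x + h) - F x) /\<^sub>R h - f x) = norm (F (x + h) - F x - h *\<^sub>R f x) / norm h"
      by (simp add: eventually_at_filter)
    ultimately have "((\<lambda>h. norm (F (x + h) - F x - h *\<^sub>R f x) / norm h) \<longlongrightarrow> 0) (at 0)"
      by (rule Lim_transform_eventually)
    then show ?thesis
      unfolding has_vector_derivative_def has_derivative_at
      by (auto intro: bounded_linear_scaleR_left)
  qed
  with neg show thesis using that by blast
qed

lemma h1_primitive_diff:
  fixes F G :: "real \<Rightarrow> 'a::euclidean_space"
  assumes F: "h1_primitive F f a b" and G: "h1_primitive G g a b"
  shows "h1_primitive (\<lambda>t. F t - G t) (\<lambda>t. f t - g t) a b"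
proof -
  have fi: "f absolutely_integrable_on {a..b}" "(\<lambda>t. (norm (f t))\<^sup>2) integrable_on {a..b}"
    and gi: "g absolutely_integrable_on {a..b}" "(\<lambda>t. (norm (g t))\<^sup>2) integrable_on {a..b}"
    by (rule h1_primitiveD[OF F] h1_primitiveD[OF G])+
  have ki: "(\<lambda>t. f t - g t) absolutely_integrable_on {a..b}"
    by (rule set_integral_diff(1)[OF fi(1) gi(1)])
  have gn: "(\<lambda>t. - g t) absolutely_integrable_on {a..b}"
    using gi(1) by (simp add: set_integrable_def)
  have "(\<lambda>t. (norm (f t - g t))\<^sup>2) integrable_on {a..b}"
    using square_integrable_add[OF fi gn] gi(2) by simp
  moreover have "F t - G t = F a - G a + integral {a..t} (\<lambda>t. f t - g t)" if t: "t \<in> {a..b}" for t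
  proof -
    have "f integrable_on {a..t}" "g integrable_on {a..t}"
      using t fi(1) gi(1) by (auto simp: absolutely_integrable_on_def intro: integrable_subinterval_real)
    then have "integral {a..t} (\<lambda>t. f t - g t) = integral {a..t} f - integral {a..t} g"
      by (rule Henstock_Kurzweil_Integration.integral_diff)
    also have "\<dots> = (F t - F a) - (G t - G a)"
      using h1_primitive_increment[OF F, of a t] h1_primitive_increment[OF G, of a t] t by simp
    finally show ?thesis by simp
  qed
  ultimately show ?thesis
    using ki unfolding h1_primitive_def by blast
qed

lemma h1_primitive_subinterval:
  fixes F :: "real \<Rightarrow> 'a::euclidean_space"
  assumes F: "h1_primitive F f a b" and sub: "a \<le> c" "d \<le> b"
  shows "h1_primitive F f c d"
  unfolding h1_primitive_def
proof (intro conjI ballI)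
  have fi: "f absolutely_integrable_on {a..b}" "(\<lambda>t. (norm (f t))\<^sup>2) integrable_on {a..b}"
    by (rule h1_primitiveD[OF F])+
  show "f absolutely_integrable_on {c..d}"
    using fi(1) by (rule absolutely_integrable_on_subinterval) (use sub in auto)
  show "(\<lambda>t. (norm (f t))\<^sup>2) integrable_on {c..d}"
    using fi(2) by (rule integrable_subinterval_real) (use sub in auto)
  fix t assume "t \<in> {c..d}"
  then have "F t - F c = integral {c..t} f" using sub by (intro h1_primitive_increment[OF F]) auto
  then show "F t = F c + integral {c..t} f" by (simp add: algebra_simps)
qed

lemma has_vector_derivative_off_support:
  assumes "t \<in> {0<..<1} - {a..b}" and "\<And>u. u \<in> {0..<1} - {a<..<b} \<Longrightarrow> F u = 0"
  shows "(F has_vector_derivative 0) (at t)"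
  by (rule has_vector_derivative_transform_within_open[OF has_vector_derivative_const,
        where S = "{0<..<1} - {a..b}"])
    (use assms in auto)

lemma sobolev_H1_imp_h1_primitive:
  assumes "sobolev_H1 \<phi>"
  obtains g where "h1_primitive \<phi> g 0 1"
proof -
  obtain g where g: "set_borel_measurable lebesgue {0..1} g"
      "set_integrable lebesgue {0..1} (\<lambda>t. (norm (g t))\<^sup>2)"
      "\<forall>t\<in>{0..1}. \<phi> t = \<phi> 0 + (LINT u:{0..t}|lebesgue. g u)"
    using assms unfolding sobolev_H1_def by blast
  have sq: "(\<lambda>t. (norm (g t))\<^sup>2) integrable_on {0..1}"
    using g(2) by (simp add: absolutely_integrable_on_def)
  have gi: "g absolutely_integrable_on {0..1}"
  proof (rule measurable_bounded_by_integrable_imp_absolutely_integrable)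
    have "(\<lambda>t. indicator {0..1} t *\<^sub>R g t) \<in> borel_measurable lebesgue"
      using g(1) by (simp add: set_borel_measurable_def)
    then show "g \<in> borel_measurable (lebesgue_on {0..1})"
      by (subst borel_measurable_restrict_space_iff) auto
    show "(\<lambda>t. 1 + (norm (g t))\<^sup>2) integrable_on {0..1}"
      using sq by (intro integrable_add) auto
    fix t
    have "(norm (g t) - 1)\<^sup>2 \<ge> 0" by simp
    then have "2 * norm (g t) \<le> 1 + (norm (g t))\<^sup>2" unfolding power2_diff by simp
    moreover have "norm (g t) \<ge> 0" by simp
    ultimately show "norm (g t) \<le> 1 + (norm (g t))\<^sup>2" by linarith
  qed auto
  have "\<phi> t = \<phi> 0 + integral {0..t} g" if t: "t \<in> {0..1}" for t
  proof -
    have "g absolutely_integrable_on {0..t}"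
      using gi by (rule absolutely_integrable_on_subinterval) (use t in auto)
    then have "(LINT u:{0..t}|lebesgue. g u) = integral {0..t} g"
      by (rule set_lebesgue_integral_eq_integral(2))
    then show ?thesis using g(3) t by metis
  qed
  then have "h1_primitive \<phi> g 0 1" unfolding h1_primitive_def using gi sq by blast
  then show thesis by (rule that)
qed

lemma absolutely_integrable_extend_zero:
  fixes f :: "real \<Rightarrow> real"
  assumes "f absolutely_integrable_on {a..b}" "{a..b} \<subseteq> S" "\<And>t. t \<in> S - {a..b} \<Longrightarrow> f t = 0"
  shows "f absolutely_integrable_on S" "integral S f = integral {a..b} f"
proof -
  have "{x \<in> {a..b} - S. f x \<noteq> 0} = {}" "{x \<in> S - {a..b}. f x \<noteq> 0} = {}"
    using assms(2,3) by blast+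
  then have n: "negligible {x \<in> {a..b} - S. f x \<noteq> 0}" "negligible {x \<in> S - {a..b}. f x \<noteq> 0}"
    by (simp_all only: negligible_empty)
  show "f absolutely_integrable_on S"
    using absolutely_integrable_spike_set_eq[OF n] assms(1) by simp
  show "integral S f = integral {a..b} f"
    by (rule integral_spike_set[OF n(2,1)])
qed

section \<open>The mass inner product and the potential\<close>

text \<open>
  The linear map that carries the mass inner product to the Euclidean one.
\<close>

definition msc :: "('n::finite \<Rightarrow> real) \<Rightarrow> real^'d^'n \<Rightarrow> real^'d^'n" where
  "msc m x = (\<chi> i. sqrt (m i) *\<^sub>R (x $ i))"

text \<open>The index set of all sums over pairs of bodies, each pair being counted once.\<close>

definition pairs :: "('n::{finite,linorder} \<times> 'n) set" where
  "pairs = {(i, j). i < j}"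

abbreviation gap :: "real^'d^'n \<Rightarrow> 'n \<times> 'n \<Rightarrow> real^'d" where
  "gap x p \<equiv> x $ fst p - x $ snd p"

text \<open>All mutual distances are at least \<open>d\<close>, measured in the Euclidean norm without masses.\<close>

definition separated :: "real \<Rightarrow> real^'d^'n \<Rightarrow> bool" where
  "separated d s \<longleftrightarrow> (\<forall>i j. i \<noteq> j \<longrightarrow> d \<le> norm (s $ i - s $ j))"

lemma bounded_bilinear_minner: "bounded_bilinear (minner m)"
proof -
  have "bilinear (minner m)"
    unfolding bilinear_def
    by (intro conjI allI linearI)
      (simp_all add: minner_def inner_add_left inner_add_right distrib_left sum.distrib
        sum_distrib_left mult_ac)
  then show ?thesis by (simp add: bilinear_conv_bounded_bilinear)
qed

lemma has_derivative_norm_powr: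
  fixes z :: "'a::real_inner"
  assumes "z \<noteq> 0"
  shows "((\<lambda>z. norm z powr b) has_derivative (\<lambda>h. b * norm z powr (b - 2) * (z \<bullet> h))) (at z)"
proof -
  have "((\<lambda>z. norm z powr b) has_derivative
      (\<lambda>h. norm z powr b * (0 * ln (norm z) + (h \<bullet> sgn z) * b / norm z))) (at z)"
    by (rule has_derivative_powr[OF has_derivative_norm[OF assms] has_derivative_const]) (use assms in auto)
  moreover have "norm z powr b * (0 * ln (norm z) + (h \<bullet> sgn z) * b / norm z)
      = b * norm z powr (b - 2) * (z \<bullet> h)" for h
    using assms by (simp add: sgn_div_norm powr_diff power2_eq_square field_simps inner_commute)
  ultimately show ?thesis by simp
qed

lemma closed_collisions: "closed (collisions :: (real^'d^'n::finite) set)"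
proof -
  have eq: "collisions = (\<Union>p\<in>{p. fst p \<noteq> snd p}. {x::real^'d^'n. x $ fst p = x $ snd p})"
    by (force simp: collisions_def)
  show ?thesis
    unfolding eq by (intro closed_UN finite closed_Collect_eq continuous_intros ballI)
qed

lemma not_collisionsD: "x \<notin> collisions \<Longrightarrow> p \<in> pairs \<Longrightarrow> gap x p \<noteq> 0"
  by (auto simp: collisions_def pairs_def) (metis less_irrefl)

lemma separated_not_collisions: "separated d s \<Longrightarrow> d > 0 \<Longrightarrow> s \<notin> collisions"
  by (force simp: separated_def collisions_def)

lemma potential_pairs:
  "potential m \<alpha> x = (\<Sum>p\<in>pairs. m (fst p) * m (snd p) * norm (gap x p) powr (-\<alpha>))"
  unfolding potential_def pairs_def by (intro sum.cong) auto

lemma mass_pairs_pairs: "mass_pairs m = (\<Sum>p\<in>pairs. m (fst p) * m (snd p))"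
  unfolding mass_pairs_def pairs_def by (intro sum.cong) auto

lemma potential_has_derivative:
  assumes "x \<notin> collisions"
  shows "(potential m \<alpha> has_derivative (\<lambda>v. \<Sum>p\<in>pairs. m (fst p) * m (snd p) *
    (- \<alpha> * norm (gap x p) powr (- \<alpha> - 2) *
      ((gap x p) \<bullet> (gap v p))))) (at x)"
proof -
  have "((\<lambda>x. norm (gap x p) powr (-\<alpha>)) has_derivative
      (\<lambda>v. - \<alpha> * norm (gap x p) powr (- \<alpha> - 2) *
      ((gap x p) \<bullet> (gap v p)))) (at x)" if "p \<in> pairs" for p
  proof -
    have "((\<lambda>x. gap x p) has_derivative (\<lambda>v. gap v p)) (at x)"
      by (intro derivative_intros bounded_linear_imp_has_derivative bounded_linear_vec_nth)
    from diff_chain_at[OF this has_derivative_norm_powr[OF not_collisionsD[OF assms that], of "-\<alpha>"]]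
    show ?thesis by (simp add: o_def)
  qed
  then have "((\<lambda>x. \<Sum>p\<in>pairs. m (fst p) * m (snd p) * norm (gap x p) powr (-\<alpha>)) has_derivative
     (\<lambda>v. \<Sum>p\<in>pairs. m (fst p) * m (snd p) *
    (- \<alpha> * norm (gap x p) powr (- \<alpha> - 2) *
      ((gap x p) \<bullet> (gap v p))))) (at x)"
    by (intro has_derivative_sum has_derivative_mult_right)
  then show ?thesis by (simp add: potential_pairs[abs_def])
qed

lemma dpot_eq:
  assumes "x \<notin> collisions"
  shows "dpot m \<alpha> x v = (\<Sum>p\<in>pairs. m (fst p) * m (snd p) *
    (- \<alpha> * norm (gap x p) powr (- \<alpha> - 2) *
      ((gap x p) \<bullet> (gap v p))))"
  unfolding dpot_def frechet_derivative_at[OF potential_has_derivative[OF assms], symmetric] by simp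

lemma d2pot_eq:
  fixes x :: "real^'d^'n::{finite,linorder}"
  assumes "x \<notin> collisions"
  shows "d2pot m \<alpha> x v = (\<Sum>p\<in>pairs. m (fst p) * m (snd p) * (- \<alpha> *
      (norm (gap x p) powr (- \<alpha> - 2) * (norm (gap v p))\<^sup>2
       - (\<alpha> + 2) * norm (gap x p) powr (- \<alpha> - 4) *
         ((gap x p) \<bullet> (gap v p))\<^sup>2)))"
proof -
  let ?f = "\<lambda>y p. - \<alpha> * norm (gap y p) powr (- \<alpha> - 2) *
      ((gap y p) \<bullet> (gap v p))"
  let ?d = "\<lambda>w p. - \<alpha> * (norm (gap x p) powr (- \<alpha> - 2) *
        ((gap w p) \<bullet> (gap v p))
       + (- \<alpha> - 2) * norm (gap x p) powr (- \<alpha> - 2 - 2) *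
         ((gap x p) \<bullet> (gap w p)) *
         ((gap x p) \<bullet> (gap v p)))"
  have "((\<lambda>y. ?f y p) has_derivative (\<lambda>w. ?d w p)) (at x)" if "p \<in> pairs" for p
  proof -
    have 1: "((\<lambda>x. gap x p) has_derivative (\<lambda>v. gap v p)) (at x)"
      by (intro derivative_intros bounded_linear_imp_has_derivative bounded_linear_vec_nth)
    from diff_chain_at[OF this has_derivative_norm_powr[OF not_collisionsD[OF assms that], of "-\<alpha> - 2"]]
    have 2: "((\<lambda>x. norm (gap x p) powr (- \<alpha> - 2)) has_derivative
      (\<lambda>w. (- \<alpha> - 2) * norm (gap x p) powr (- \<alpha> - 2 - 2) *
       ((gap x p) \<bullet> (gap w p)))) (at x)"
      by (simp add: o_def)
    have "((\<lambda>y. - \<alpha> * (norm (gap y p) powr (- \<alpha> - 2) *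
      ((gap y p) \<bullet> (gap v p)))) has_derivative (\<lambda>w. ?d w p)) (at x)"
      by (rule has_derivative_mult_right[OF has_derivative_mult[OF 2 has_derivative_inner_left[OF 1]]])
    then show ?thesis by (simp add: mult.assoc)
  qed
  then have D: "((\<lambda>y. \<Sum>p\<in>pairs. m (fst p) * m (snd p) * ?f y p) has_derivative
     (\<lambda>w. \<Sum>p\<in>pairs. m (fst p) * m (snd p) * ?d w p)) (at x)"
    by (intro has_derivative_sum has_derivative_mult_right)
  have "((\<lambda>y. dpot m \<alpha> y v) has_derivative (\<lambda>w. \<Sum>p\<in>pairs. m (fst p) * m (snd p) * ?d w p)) (at x)"
  proof (rule has_derivative_transform_within_open[OF D, of "- collisions"])
    show "open (- collisions :: (real^'d^'n::{finite,linorder}) set)" using closed_collisions by (rule open_Compl)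
  qed (use assms in \<open>auto simp: dpot_eq\<close>)
  from frechet_derivative_at[OF this, symmetric]
  have "d2pot m \<alpha> x v = (\<Sum>p\<in>pairs. m (fst p) * m (snd p) * ?d v p)"
    by (simp add: d2pot_def)
  also have "\<dots> = (\<Sum>p\<in>pairs. m (fst p) * m (snd p) * (- \<alpha> *
      (norm (gap x p) powr (- \<alpha> - 2) * (norm (gap v p))\<^sup>2
       - (\<alpha> + 2) * norm (gap x p) powr (- \<alpha> - 4) *
         ((gap x p) \<bullet> (gap v p))\<^sup>2)))"
    by (intro sum.cong refl, simp only: power2_norm_eq_inner) (simp add: algebra_simps power2_eq_square)
  finally show ?thesis .
qed

text \<open>Euler's identity for the homogeneous function \<open>U\<^sub>\<alpha>\<close>.\<close>

lemma dpot_self: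
  assumes "x \<notin> collisions"
  shows "dpot m \<alpha> x x = - \<alpha> * potential m \<alpha> x"
proof -
  have "norm (gap x p) powr (- \<alpha> - 2) * ((gap x p) \<bullet> (gap x p))
      = norm (gap x p) powr (-\<alpha>)" if "p \<in> pairs" for p
    using not_collisionsD[OF assms that]
    by (simp add: powr_diff power2_norm_eq_inner[symmetric] powr_numeral)
  then show ?thesis
    unfolding dpot_eq[OF assms] potential_pairs sum_distrib_left
    by (intro sum.cong refl) (simp add: mult_ac)
qed

lemma potential_scaleR:
  assumes "c > 0"
  shows "potential m \<alpha> (c *\<^sub>R x) = c powr (-\<alpha>) * potential m \<alpha> x"
proof -
  have "norm ((c *\<^sub>R x) $ i - (c *\<^sub>R x) $ j) = c * norm (x $ i - x $ j)" for i j
    using assms by (simp flip: scaleR_diff_right)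
  then show ?thesis
    using assms by (simp add: potential_pairs sum_distrib_left powr_mult mult_ac)
qed

lemma continuous_on_potential: "continuous_on (- collisions) (potential m \<alpha>)"
  by (intro continuous_at_imp_continuous_on ballI)
    (metis ComplD has_derivative_continuous[OF potential_has_derivative])

lemma collisions_scaleR [simp]: "c \<noteq> 0 \<Longrightarrow> c *\<^sub>R x \<in> collisions \<longleftrightarrow> x \<in> collisions"
  by (auto simp: collisions_def)

lemma continuous_on_dpot:
  assumes "continuous_on S s" "continuous_on S w" "\<And>t. t \<in> S \<Longrightarrow> s t \<notin> collisions"
  shows "continuous_on S (\<lambda>t. dpot m \<alpha> (s t) (w t))"
proof -
  have ne: "\<forall>t\<in>S. norm (gap (s t) p) \<noteq> 0" if "p \<in> pairs" for p
    using not_collisionsD[OF assms(3) that] by simp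
  have "continuous_on S (\<lambda>t. \<Sum>p\<in>pairs. m (fst p) * m (snd p) *
    (- \<alpha> * norm (gap (s t) p) powr (- \<alpha> - 2) *
      ((gap (s t) p) \<bullet> (gap (w t) p))))"
    by (intro continuous_intros assms(1,2) ne)
  then show ?thesis by (rule continuous_on_eq) (simp add: dpot_eq assms(3))
qed

lemma continuous_on_d2pot:
  fixes s w :: "real \<Rightarrow> real^'d^'n::{finite,linorder}"
  assumes "continuous_on S s" "continuous_on S w" "\<And>t. t \<in> S \<Longrightarrow> s t \<notin> collisions"
  shows "continuous_on S (\<lambda>t. d2pot m \<alpha> (s t) (w t))"
proof -
  have ne: "\<forall>t\<in>S. norm (gap (s t) p) \<noteq> 0" if "p \<in> pairs" for p
    using not_collisionsD[OF assms(3) that] by simp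
  have "continuous_on S (\<lambda>t. \<Sum>p\<in>pairs. m (fst p) * m (snd p) * (- \<alpha> *
      (norm (gap (s t) p) powr (- \<alpha> - 2) * (norm (gap (w t) p))\<^sup>2
       - (\<alpha> + 2) * norm (gap (s t) p) powr (- \<alpha> - 4) *
         ((gap (s t) p) \<bullet> (gap (w t) p))\<^sup>2)))"
    by (intro continuous_intros assms(1,2) ne)
  then show ?thesis by (rule continuous_on_eq) (simp add: d2pot_eq assms(3))
qed

locale masses =
  fixes m :: "'n::{finite,linorder} \<Rightarrow> real"
  assumes mass_pos: "\<And>i. m i > 0"
begin

lemma minner_msc: "minner m x y = msc m x \<bullet> msc m y"
proof -
  have "msc m x \<bullet> msc m y = (\<Sum>i\<in>UNIV. msc m x $ i \<bullet> msc m y $ i)"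
    by (rule inner_vec_def)
  also have "\<dots> = minner m x y"
    unfolding minner_def
  proof (rule sum.cong[OF refl])
    fix i
    have "sqrt (m i) * (sqrt (m i) * (x $ i \<bullet> y $ i)) = m i * (x $ i \<bullet> y $ i)"
      using mass_pos[of i] by (simp add: mult.assoc[symmetric])
    then show "msc m x $ i \<bullet> msc m y $ i = m i * (x $ i \<bullet> y $ i)"
      by (simp only: msc_def vec_lambda_beta inner_scaleR_left inner_scaleR_right)
  qed
  finally show ?thesis by simp
qed

lemma mnorm_msc: "mnorm m x = norm (msc m x)"
  by (simp add: mnorm_def minner_msc norm_eq_sqrt_inner)

lemma mnorm_power2: "(mnorm m x)\<^sup>2 = minner m x x"
  by (simp add: mnorm_msc minner_msc power2_norm_eq_inner)

lemma mnorm_nonneg [simp]: "mnorm m x \<ge> 0"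
  by (simp add: mnorm_msc)

lemma msc_linear: "msc m (x + y) = msc m x + msc m y" "msc m (x - y) = msc m x - msc m y"
  "msc m (c *\<^sub>R x) = c *\<^sub>R msc m x" "msc m 0 = 0"
  by (simp_all add: msc_def vec_eq_iff scaleR_add_right scaleR_diff_right)

lemma bounded_linear_msc: "bounded_linear (msc m :: real^'d^'n::{finite,linorder} \<Rightarrow> _)"
  by (simp add: linear_conv_bounded_linear[symmetric] linearI msc_linear)

lemma mnorm_scaleR: "mnorm m (c *\<^sub>R x) = \<bar>c\<bar> * mnorm m x"
  by (simp add: mnorm_msc msc_linear)

lemma s_coord_scaleR: "c > 0 \<Longrightarrow> s_coord m (c *\<^sub>R x) = s_coord m x"
  by (simp add: s_coord_def mnorm_scaleR)

lemma mnorm_triangle: "mnorm m (x + y) \<le> mnorm m x + mnorm m y"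
  by (simp add: mnorm_msc msc_linear norm_triangle_ineq)

lemma mnorm_minus_commute: "mnorm m (x - y) = mnorm m (y - x)"
  by (simp add: mnorm_msc msc_linear norm_minus_commute)

lemma minner_commute: "minner m x y = minner m y x"
  by (simp add: minner_msc inner_commute)

lemma minner_le: "\<bar>minner m x y\<bar> \<le> mnorm m x * mnorm m y"
  by (simp add: mnorm_msc minner_msc Cauchy_Schwarz_ineq2)

lemma mnorm_component: "sqrt (m i) * norm (x $ i) \<le> mnorm m x"
proof -
  have "norm (msc m x $ i) \<le> norm (msc m x)" by (rule Finite_Cartesian_Product.norm_nth_le)
  then show ?thesis using mass_pos[of i] by (simp add: mnorm_msc msc_def)
qed

lemma mnorm_eq_0 [simp]: "mnorm m x = 0 \<longleftrightarrow> x = 0"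
proof
  assume 0: "mnorm m x = 0"
  have "norm (x $ i) \<le> 0" for i
    using mnorm_component[of i x] mass_pos[of i] 0 by (simp add: mult_le_0_iff)
  then show "x = 0" by (simp add: vec_eq_iff)
qed (simp add: mnorm_msc msc_linear)

text \<open>An upper bound for the mutual distances in a configuration of mass norm \<open>1\<close>.\<close>

definition diam :: real where "diam = 2 * (\<Sum>i\<in>UNIV. 1 / sqrt (m i))"

lemma diam_pos: "diam > 0"
proof -
  have "(\<Sum>i\<in>UNIV. 1 / sqrt (m i)) > 0"
    using mass_pos by (intro sum_pos) auto
  then show ?thesis by (simp add: diam_def)
qed

lemma norm_diff_le_diam: "norm (x $ i - x $ j) \<le> diam * mnorm m x"
proof -
  have c: "norm (x $ k) \<le> (\<Sum>i\<in>UNIV. 1 / sqrt (m i)) * mnorm m x" for k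
  proof -
    have "norm (x $ k) \<le> 1 / sqrt (m k) * mnorm m x"
      using mnorm_component[of k x] mass_pos[of k] by (simp add: field_simps)
    also have "\<dots> \<le> (\<Sum>i\<in>UNIV. 1 / sqrt (m i)) * mnorm m x"
      using mass_pos by (intro mult_right_mono member_le_sum) (auto simp: less_imp_le)
    finally show ?thesis .
  qed
  have "norm (x $ i - x $ j) \<le> norm (x $ i) + norm (x $ j)" by (rule norm_triangle_ineq4)
  also have "\<dots> \<le> diam * mnorm m x" using c[of i] c[of j] by (simp add: diam_def algebra_simps)
  finally show ?thesis .
qed

lemma mass_pairs_pos:
  assumes "CARD('n) \<ge> 2" shows "mass_pairs m > 0"
proof -
  have "\<exists>a b::'n. a \<noteq> b"
    using assms card_le_Suc0_iff_eq[of "UNIV::'n set"] by auto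
  then obtain a b :: 'n where "a < b" by (metis linorder_neq_iff)
  then have "(a, b) \<in> pairs" by (simp add: pairs_def)
  then show ?thesis
    unfolding mass_pairs_pairs using mass_pos
    by (intro sum_pos2[of pairs "(a, b)"]) (auto simp: less_imp_le)
qed

lemma weighted_sum_ge:
  assumes "\<And>p. p \<in> P \<Longrightarrow> p \<in> pairs \<Longrightarrow> B \<le> f p"
  shows "(\<Sum>p\<in>P \<inter> pairs. m (fst p) * m (snd p)) * B \<le> (\<Sum>p\<in>P \<inter> pairs. m (fst p) * m (snd p) * f p)"
  unfolding sum_distrib_right using assms mass_pos
  by (intro sum_mono mult_left_mono) (auto simp: less_imp_le)

lemma mass_pairs_weighted_ge:
  assumes "\<And>p. p \<in> pairs \<Longrightarrow> B \<le> f p"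
  shows "mass_pairs m * B \<le> (\<Sum>p\<in>pairs. m (fst p) * m (snd p) * f p)"
  using weighted_sum_ge[of UNIV B f] assms by (simp add: mass_pairs_pairs)

lemma mass_pairs_weighted_le:
  assumes "\<And>p. p \<in> pairs \<Longrightarrow> f p \<le> B"
  shows "(\<Sum>p\<in>pairs. m (fst p) * m (snd p) * f p) \<le> mass_pairs m * B"
  using mass_pairs_weighted_ge[of "-B" "\<lambda>p. - f p"] assms by (simp add: sum_negf)

lemma mass_pairs_nonneg: "mass_pairs m \<ge> 0"
  unfolding mass_pairs_pairs using mass_pos by (intro sum_nonneg) (simp add: less_imp_le)

text \<open>
  The lower bound \<open>U\<^sub>\<alpha> \<ge> \<Sum> m\<^sub>i m\<^sub>j - \<alpha> logdiam\<close> holds on the unit sphere of the mass norm.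
\<close>

definition logdiam :: real where "logdiam = mass_pairs m * \<bar>ln diam\<bar>"

lemma logdiam_nonneg: "logdiam \<ge> 0"
  using mass_pairs_nonneg by (simp add: logdiam_def)

lemma pair_potential_ge:
  assumes "mnorm m s = 1" "s \<notin> collisions" "\<alpha> > 0" "p \<in> pairs"
  shows "norm (gap s p) powr (-\<alpha>) - 1 \<ge> - \<alpha> * \<bar>ln diam\<bar>"
    and "norm (gap s p) powr (-\<alpha>) - 1 \<ge> - \<alpha> * ln (norm (gap s p))"
proof -
  let ?n = "norm (gap s p)"
  have n: "?n > 0" using not_collisionsD[OF assms(2,4)] by simp
  have "exp (- \<alpha> * ln ?n) \<ge> 1 + (- \<alpha> * ln ?n)" by (rule exp_ge_add_one_self)
  then show 1: "?n powr (-\<alpha>) - 1 \<ge> - \<alpha> * ln ?n" using n by (simp add: powr_def)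
  have "?n \<le> diam"
    using norm_diff_le_diam[of s "fst p" "snd p"] assms(1) by simp
  then have "ln ?n \<le> ln diam"
    using n diam_pos by (intro ln_le_cancel_iff[THEN iffD2]) auto
  then have "ln ?n \<le> \<bar>ln diam\<bar>" by simp
  then have "\<alpha> * ln ?n \<le> \<alpha> * \<bar>ln diam\<bar>" using assms(3) by simp
  then show "?n powr (-\<alpha>) - 1 \<ge> - \<alpha> * \<bar>ln diam\<bar>" using 1 by simp
qed

lemma potential_ge:
  assumes "mnorm m s = 1" "s \<notin> collisions" "\<alpha> > 0"
  shows "potential m \<alpha> s \<ge> mass_pairs m - \<alpha> * logdiam"
proof -
  have "potential m \<alpha> s - mass_pairs m
      = (\<Sum>p\<in>pairs. m (fst p) * m (snd p) * (norm (gap s p) powr (-\<alpha>) - 1))"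
    by (simp add: potential_pairs mass_pairs_pairs right_diff_distrib sum_subtractf)
  also have "\<dots> \<ge> mass_pairs m * (- \<alpha> * \<bar>ln diam\<bar>)"
    using pair_potential_ge(1)[OF assms] by (rule mass_pairs_weighted_ge)
  finally show ?thesis by (simp add: logdiam_def mult_ac)
qed

lemma potential_le:
  assumes "separated d s" "0 < d" "d \<le> 1" "\<alpha> > 0" "\<alpha> * (- ln d) \<le> 1"
  shows "potential m \<alpha> s \<le> mass_pairs m + \<alpha> * (2 * mass_pairs m * (- ln d))"
proof -
  have "norm (gap s p) powr (-\<alpha>) \<le> 1 + 2 * (\<alpha> * (- ln d))" if "p \<in> pairs" for p
  proof -
    have "d \<le> norm (gap s p)"
      using that assms(1) by (auto simp: separated_def pairs_def)
    then have "norm (gap s p) powr (-\<alpha>) \<le> d powr (-\<alpha>)"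
      using assms by (intro powr_mono2') auto
    also have "\<dots> = exp (\<alpha> * (- ln d))" using assms by (simp add: powr_def)
    also have "\<dots> \<le> 1 + \<alpha> * (- ln d) + (\<alpha> * (- ln d))\<^sup>2"
      using assms by (intro exp_bound) (auto simp: mult_le_0_iff)
    also have "(\<alpha> * (- ln d))\<^sup>2 \<le> \<alpha> * (- ln d)"
      using assms mult_left_le[of "\<alpha> * (- ln d)" "\<alpha> * (- ln d)"]
      by (auto simp: power2_eq_square mult_le_0_iff)
    finally show ?thesis by simp
  qed
  then have "potential m \<alpha> s \<le> mass_pairs m * (1 + 2 * (\<alpha> * (- ln d)))"
    unfolding potential_pairs by (rule mass_pairs_weighted_le)
  then show ?thesis by (simp add: algebra_simps)
qed

text \<open>
  The potential controls the distance to the collisions uniformly in the exponent: since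
  \<open>\<delta>\<^sup>-\<^sup>\<alpha> - 1 \<ge> - \<alpha> log \<delta>\<close> for a mutual distance \<open>\<delta>\<close>, an excess of \<open>U\<^sub>\<alpha>\<close> of order \<open>\<alpha>\<close> over
  \<open>\<Sum> m\<^sub>i m\<^sub>j\<close> bounds all \<open>- log \<delta>\<close> from above.
\<close>

lemma separated_of_potential_le:
  assumes "B \<ge> 0"
  obtains d where "0 < d" "d \<le> 1"
    "\<And>(s::real^'d^'n::{finite,linorder}) \<alpha>. \<lbrakk>mnorm m s = 1; s \<notin> collisions; \<alpha> > 0; potential m \<alpha> s \<le> mass_pairs m + \<alpha> * B\<rbrakk>
      \<Longrightarrow> separated d s"
proof -
  define \<mu> where "\<mu> = (Min (range m))\<^sup>2"
  have Mp: "Min (range m) > 0" using mass_pos by (subst Min_gr_iff) auto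
  have \<mu>: "\<mu> > 0" "\<And>i j. \<mu> \<le> m i * m j"
    using Mp unfolding \<mu>_def power2_eq_square by (auto intro!: mult_mono less_imp_le[OF mass_pos])
  define d where "d = exp (- ((B + logdiam) / \<mu>))"
  have lt: "d \<le> norm (s $ i - s $ j)"
    if s: "mnorm m s = 1" "s \<notin> collisions" "\<alpha> > 0" "potential m \<alpha> s \<le> mass_pairs m + \<alpha> * B" and ij: "i < j"
    for s :: "real^'d^'n::{finite,linorder}" and \<alpha> i j
  proof -
    let ?n = "norm (s $ i - s $ j)"
    let ?q = "(i, j)"
    let ?f = "\<lambda>p. m (fst p) * m (snd p) * (norm (gap s p) powr (-\<alpha>) - 1)"
    have q: "?q \<in> pairs" using ij by (simp add: pairs_def)
    have n: "?n > 0" using not_collisionsD[OF s(2) q] by simp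
    have rest: "- \<alpha> * logdiam \<le> (\<Sum>p\<in>pairs - {?q}. ?f p)"
    proof -
      have "(\<Sum>p\<in>- {?q} \<inter> pairs. m (fst p) * m (snd p)) \<le> mass_pairs m"
        unfolding mass_pairs_pairs using mass_pos by (intro sum_mono2) (auto simp: less_imp_le)
      then have "(\<Sum>p\<in>- {?q} \<inter> pairs. m (fst p) * m (snd p)) * (\<alpha> * \<bar>ln diam\<bar>) \<le> \<alpha> * logdiam"
        using s(3) mult_right_mono[of "\<Sum>p\<in>- {?q} \<inter> pairs. m (fst p) * m (snd p)" "mass_pairs m" "\<alpha> * \<bar>ln diam\<bar>"]
        by (simp add: logdiam_def mult_ac)
      moreover have "(\<Sum>p\<in>- {?q} \<inter> pairs. m (fst p) * m (snd p)) * (- \<alpha> * \<bar>ln diam\<bar>) \<le> (\<Sum>p\<in>- {?q} \<inter> pairs. ?f p)"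
        using pair_potential_ge(1)[OF s(1-3)] by (intro weighted_sum_ge)
      moreover have "- {?q} \<inter> pairs = pairs - {?q}" by auto
      ultimately show ?thesis by simp
    qed
    have "potential m \<alpha> s - mass_pairs m = (\<Sum>p\<in>pairs. ?f p)"
      by (simp add: potential_pairs mass_pairs_pairs right_diff_distrib sum_subtractf)
    also have "\<dots> = ?f ?q + (\<Sum>p\<in>pairs - {?q}. ?f p)"
      using q by (subst sum.remove[of _ ?q]) auto
    finally have "?f ?q \<le> (potential m \<alpha> s - mass_pairs m) - - \<alpha> * logdiam" using rest by linarith
    also have "\<dots> \<le> \<alpha> * (B + logdiam)" using s(4) by (simp add: algebra_simps)
    finally have "?f ?q \<le> \<alpha> * (B + logdiam)" .
    moreover have "?f ?q \<ge> m i * m j * (- \<alpha> * ln ?n)"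
    proof -
      have "m i * m j \<ge> 0" using mass_pos by (simp add: less_imp_le)
      from mult_left_mono[OF pair_potential_ge(2)[OF s(1-3) q] this] show ?thesis by simp
    qed
    ultimately have "\<alpha> * (m i * m j * (- ln ?n)) \<le> \<alpha> * (B + logdiam)" by (simp add: mult_ac)
    then have *: "m i * m j * (- ln ?n) \<le> B + logdiam" by (rule mult_left_le_imp_le[OF _ s(3)])
    have "- ln ?n \<le> (B + logdiam) / \<mu>"
    proof (cases "- ln ?n \<le> 0")
      case True
      then show ?thesis using assms logdiam_nonneg \<mu>(1) by (intro order.trans[OF True]) auto
    next
      case False
      then have "\<mu> * (- ln ?n) \<le> m i * m j * (- ln ?n)" using \<mu>(2) by (intro mult_right_mono) auto
      with * show ?thesis using \<mu>(1) by (simp add: field_simps)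
    qed
    then have "d \<le> exp (ln ?n)" unfolding d_def by (simp only: exp_le_cancel_iff)
    then show ?thesis using n by simp
  qed
  show thesis
  proof
    show "0 < d" "d \<le> 1" using assms logdiam_nonneg \<mu>(1) by (auto simp: d_def)
    show "separated d s" if "mnorm m s = 1" "s \<notin> collisions" "\<alpha> > 0" "potential m \<alpha> s \<le> mass_pairs m + \<alpha> * B"
      for s :: "real^'d^'n::{finite,linorder}" and \<alpha>
      unfolding separated_def
    proof (intro allI impI)
      fix i j :: 'n assume "i \<noteq> j"
      then consider "i < j" | "j < i" by (rule linorder_neqE)
      then show "d \<le> norm (s $ i - s $ j)"
        by cases (use lt[OF that, of i j] lt[OF that, of j i] norm_minus_commute[of "s $ i" "s $ j"] in auto)
    qed
  qed
qed

lemma dpot_le: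
  assumes "separated d s" "0 < d" "d \<le> 1" "0 < \<alpha>" "\<alpha> \<le> 1"
  shows "\<bar>dpot m \<alpha> s v\<bar> \<le> \<alpha> * (mass_pairs m * diam / d\<^sup>2) * mnorm m v"
proof -
  let ?n = "\<lambda>p. norm (gap s p)"
  have nc: "s \<notin> collisions" using assms separated_not_collisions by blast
  have *: "\<bar>- \<alpha> * ?n p powr (- \<alpha> - 2) * ((gap s p) \<bullet> (gap v p))\<bar>
      \<le> \<alpha> * (diam / d\<^sup>2) * mnorm m v" if p: "p \<in> pairs" for p
  proof -
    have np: "?n p > 0" using not_collisionsD[OF nc p] by simp
    have "d \<le> ?n p" using p assms(1) by (auto simp: separated_def pairs_def)
    then have "?n p powr (- \<alpha> - 1) \<le> d powr (- \<alpha> - 1)" using assms by (intro powr_mono2') auto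
    also have "\<dots> \<le> d powr (-2)" using assms by (intro powr_mono') auto
    also have "\<dots> = 1 / d\<^sup>2" using assms by (simp add: powr_minus powr_numeral field_simps)
    finally have a: "?n p powr (- \<alpha> - 1) \<le> 1 / d\<^sup>2" .
    have "\<bar>- \<alpha> * ?n p powr (- \<alpha> - 2) * ((gap s p) \<bullet> (gap v p))\<bar>
        \<le> \<alpha> * ?n p powr (- \<alpha> - 2) * (?n p * norm (gap v p))"
      using assms Cauchy_Schwarz_ineq2[of "gap s p" "gap v p"]
      by (simp add: abs_mult mult_left_mono)
    also have "\<dots> = \<alpha> * (?n p powr (- \<alpha> - 1) * norm (gap v p))"
      using np by (simp add: powr_diff power2_eq_square)
    also have "\<dots> \<le> \<alpha> * (1 / d\<^sup>2 * (diam * mnorm m v))"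
      using assms a norm_diff_le_diam[of v "fst p" "snd p"]
      by (intro mult_left_mono mult_mono) auto
    finally show ?thesis by simp
  qed
  let ?t = "\<lambda>p. - \<alpha> * ?n p powr (- \<alpha> - 2) * ((gap s p) \<bullet> (gap v p))"
  let ?B = "\<alpha> * (diam / d\<^sup>2) * mnorm m v"
  have "\<And>p. p \<in> pairs \<Longrightarrow> ?t p \<le> ?B" and "\<And>p. p \<in> pairs \<Longrightarrow> - ?B \<le> ?t p"
    using * by (force simp: abs_le_iff)+
  from mass_pairs_weighted_le[of ?t, OF this(1)] mass_pairs_weighted_ge[of _ ?t, OF this(2)]
  have "\<bar>dpot m \<alpha> s v\<bar> \<le> mass_pairs m * ?B"
    unfolding dpot_eq[OF nc] by (intro abs_leI) linarith+
  then show ?thesis by (simp add: mult_ac)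
qed

lemma d2pot_ge:
  assumes "separated d s" "0 < d" "d \<le> 1" "0 < \<alpha>" "\<alpha> \<le> 1"
  shows "d2pot m \<alpha> s v \<ge> - \<alpha> * (mass_pairs m * diam\<^sup>2 / d ^ 3) * (mnorm m v)\<^sup>2"
proof -
  let ?n = "\<lambda>p. norm (gap s p)"
  have nc: "s \<notin> collisions" using assms separated_not_collisions by blast
  have "- \<alpha> * (diam\<^sup>2 / d ^ 3) * (mnorm m v)\<^sup>2 \<le> - \<alpha> *
      (?n p powr (- \<alpha> - 2) * (norm (gap v p))\<^sup>2
       - (\<alpha> + 2) * ?n p powr (- \<alpha> - 4) * ((gap s p) \<bullet> (gap v p))\<^sup>2)"
    if p: "p \<in> pairs" for p
  proof -
    have "d \<le> ?n p" using p assms(1) by (auto simp: separated_def pairs_def)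
    then have "?n p powr (- \<alpha> - 2) \<le> d powr (- \<alpha> - 2)" using assms by (intro powr_mono2') auto
    also have "\<dots> \<le> d powr (-3)" using assms by (intro powr_mono') auto
    also have "\<dots> = 1 / d ^ 3" using assms by (simp add: powr_minus powr_numeral field_simps)
    finally have a: "?n p powr (- \<alpha> - 2) \<le> 1 / d ^ 3" .
    have "?n p powr (- \<alpha> - 2) * (norm (gap v p))\<^sup>2 \<le> 1 / d ^ 3 * (diam * mnorm m v)\<^sup>2"
      using assms a norm_diff_le_diam[of v "fst p" "snd p"]
      by (intro mult_mono power_mono) auto
    moreover have "(\<alpha> + 2) * ?n p powr (- \<alpha> - 4) * ((gap s p) \<bullet> (gap v p))\<^sup>2 \<ge> 0"
      using assms by simp
    ultimately have "?n p powr (- \<alpha> - 2) * (norm (gap v p))\<^sup>2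
       - (\<alpha> + 2) * ?n p powr (- \<alpha> - 4) * ((gap s p) \<bullet> (gap v p))\<^sup>2
       \<le> 1 / d ^ 3 * (diam * mnorm m v)\<^sup>2"
      by linarith
    then have "\<alpha> * (?n p powr (- \<alpha> - 2) * (norm (gap v p))\<^sup>2
       - (\<alpha> + 2) * ?n p powr (- \<alpha> - 4) * ((gap s p) \<bullet> (gap v p))\<^sup>2)
       \<le> \<alpha> * (1 / d ^ 3 * (diam * mnorm m v)\<^sup>2)"
      using assms by (intro mult_left_mono) auto
    then show ?thesis by (simp add: power_mult_distrib)
  qed
  from mass_pairs_weighted_ge[OF this]
  have "d2pot m \<alpha> s v \<ge> mass_pairs m * (- \<alpha> * (diam\<^sup>2 / d ^ 3) * (mnorm m v)\<^sup>2)"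
    unfolding d2pot_eq[OF nc] .
  then show ?thesis by (simp add: mult_ac)
qed

lemma mnorm_powr_has_derivative:
  fixes y :: "real^'d^'n::{finite,linorder}"
  assumes "y \<noteq> 0"
  shows "((\<lambda>y. mnorm m y powr b) has_derivative (\<lambda>h. b * mnorm m y powr (b - 2) * minner m y h)) (at y)"
proof -
  have "(msc m has_derivative msc m) (at y)"
    by (rule bounded_linear_imp_has_derivative[OF bounded_linear_msc])
  moreover have "msc m y \<noteq> 0" using assms mnorm_eq_0[of y] by (simp add: mnorm_msc)
  ultimately have "((\<lambda>z. norm z powr b) \<circ> msc m has_derivative
      (\<lambda>h. b * norm (msc m y) powr (b - 2) * (msc m y \<bullet> h)) \<circ> msc m) (at y)"
    by (intro diff_chain_at has_derivative_norm_powr)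
  then show ?thesis by (simp add: o_def mnorm_msc minner_msc)
qed

lemma rho_coord_derivative:
  fixes y :: "real^'d^'n::{finite,linorder}"
  assumes "y \<noteq> 0"
  shows "frechet_derivative (rho_coord m \<alpha>) (at y) h
    = (2 - \<alpha>) / 4 * mnorm m y powr ((2 - \<alpha>) / 4 - 2) * minner m y h"
  using frechet_derivative_at[OF mnorm_powr_has_derivative[OF assms, of "(2 - \<alpha>) / 4"]]
  by (simp add: rho_coord_def[abs_def] fun_eq_iff)

lemma s_coord_derivative:
  fixes y :: "real^'d^'n::{finite,linorder}"
  assumes "y \<noteq> 0"
  shows "frechet_derivative (s_coord m) (at y) h
    = mnorm m y powr (-1) *\<^sub>R h - (mnorm m y powr (-3) * minner m y h) *\<^sub>R y"
proof -
  have "((\<lambda>y. mnorm m y powr (-1) *\<^sub>R y) has_derivative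
    (\<lambda>h. mnorm m y powr (-1) *\<^sub>R h + (- 1 * mnorm m y powr (-1 - 2) * minner m y h) *\<^sub>R y)) (at y)"
    by (rule has_derivative_scaleR[OF mnorm_powr_has_derivative[OF assms] has_derivative_ident])
  moreover have "s_coord m = (\<lambda>y::real^'d^'n::{finite,linorder}. mnorm m y powr (-1) *\<^sub>R y)"
    by (simp add: s_coord_def fun_eq_iff powr_minus_divide)
  ultimately have "(s_coord m has_derivative
    (\<lambda>h. mnorm m y powr (-1) *\<^sub>R h + (- 1 * mnorm m y powr (-1 - 2) * minner m y h) *\<^sub>R y)) (at y)"
    by metis
  from frechet_derivative_at[OF this, symmetric] show ?thesis by simp
qed

end

section \<open>The collision time\<close>

text \<open>
  A continuous path \<open>z\<close> that can only vanish at time \<open>1\<close>, and its collision time \<open>\<tau>\<close>, whose derivative is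
  called \<open>speed\<close> below.
\<close>

locale time_change = masses m for m :: "'n::{finite,linorder} \<Rightarrow> real" +
  fixes \<alpha> :: real and z :: "real \<Rightarrow> real^'d^'n::{finite,linorder}"
  assumes z_cont: "continuous_on {0..1} z" and z_nonzero: "\<And>t. 0 \<le> t \<Longrightarrow> t < 1 \<Longrightarrow> z t \<noteq> 0"
begin

definition speed :: "real \<Rightarrow> real" where
  "speed t = mnorm m (z t) powr (- ((2 + \<alpha>) / 2))"

abbreviation tau :: "real \<Rightarrow> real" where "tau \<equiv> tau_of m \<alpha> z"

lemma mnorm_z_pos: "0 \<le> t \<Longrightarrow> t < 1 \<Longrightarrow> mnorm m (z t) > 0"
  using z_nonzero[of t] by (simp add: order.strict_iff_order)

lemma continuous_on_mnorm_z: "continuous_on {0..1} (\<lambda>t. mnorm m (z t))"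
  unfolding mnorm_def
  by (intro continuous_intros bounded_bilinear.continuous_on[OF bounded_bilinear_minner] z_cont)

lemma speed_pos: "0 \<le> t \<Longrightarrow> t < 1 \<Longrightarrow> speed t > 0"
  using z_nonzero[of t] by (simp add: speed_def)

lemma continuous_on_speed: "continuous_on {0..<1} speed"
  unfolding speed_def
proof (intro continuous_on_powr continuous_intros)
  show "continuous_on {0..<1} (\<lambda>t. mnorm m (z t))"
    by (rule continuous_on_subset[OF continuous_on_mnorm_z]) auto
  show "\<forall>t\<in>{0..<1}. mnorm m (z t) \<noteq> 0"
    using mnorm_z_pos by (metis atLeastLessThan_iff less_irrefl)
qed

lemma tau_eq: "tau t = integral {0..t} speed"
  by (simp add: tau_of_def speed_def[abs_def])

lemma tau_0: "tau 0 = 0"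
  by (simp add: tau_eq)

lemma continuous_on_tau: "b < 1 \<Longrightarrow> continuous_on {0..b} tau"
  unfolding tau_eq[abs_def]
  by (intro indefinite_integral_continuous_1 integrable_continuous_real
      continuous_on_subset[OF continuous_on_speed]) auto

lemma tau_deriv:
  assumes "0 < t" "t < 1"
  shows "(tau has_real_derivative speed t) (at t)"
proof -
  let ?b = "(t + 1) / 2"
  have b: "t < ?b" "?b < 1" using assms by auto
  have "((\<lambda>u. integral {0..u} speed) has_real_derivative speed t) (at t within {0..?b})"
    using assms b by (intro integral_has_real_derivative continuous_on_subset[OF continuous_on_speed]) auto
  moreover have "at t within {0..?b} = at t"
    using assms b by (intro at_within_interior) auto
  ultimately show ?thesis unfolding tau_eq[abs_def] by simp
qed

lemma tau_strict_mono:
  assumes "0 \<le> t" "t < u" "u < 1" shows "tau t < tau u"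
proof (rule DERIV_pos_imp_increasing_open[OF assms(2)])
  show "\<exists>y. (tau has_real_derivative y) (at x) \<and> 0 < y" if "t < x" "x < u" for x
    using tau_deriv[of x] speed_pos[of x] that assms by auto
  show "continuous_on {t..u} tau"
    using continuous_on_subset[OF continuous_on_tau[OF assms(3)]] assms by auto
qed

lemma tau_le_iff: "0 \<le> t \<Longrightarrow> t < 1 \<Longrightarrow> 0 \<le> u \<Longrightarrow> u < 1 \<Longrightarrow> tau t \<le> tau u \<longleftrightarrow> t \<le> u"
  using tau_strict_mono[of t u] tau_strict_mono[of u t] by force

lemma tau_inj: "inj_on tau {0..<1}"
  by (rule inj_onI) (metis atLeastLessThan_iff antisym tau_le_iff order_refl)

lemma time_of_tau: "0 \<le> t \<Longrightarrow> t < 1 \<Longrightarrow> time_of m \<alpha> z (tau t) = t"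
  unfolding time_of_def by (rule inv_into_f_f[OF tau_inj]) simp

lemma time_of_deriv:
  assumes "0 < t" "t < 1"
  shows "(time_of m \<alpha> z has_real_derivative inverse (speed t)) (at (tau t))"
  unfolding has_field_derivative_def
proof (rule has_derivative_inverse_strong[of "{0<..<1}" t tau])
  show "(tau has_derivative (*) (speed t)) (at t)"
    using tau_deriv[OF assms] by (simp add: has_field_derivative_def)
  show "(*) (speed t) \<circ> (*) (inverse (speed t)) = id"
    using speed_pos[of t] assms by (auto simp: fun_eq_iff)
  show "continuous_on {0<..<1} tau"
    by (intro continuous_at_imp_continuous_on ballI DERIV_isCont) (auto intro: tau_deriv)
  show "time_of m \<alpha> z (tau x) = x" if "x \<in> {0<..<1}" for x
    using that by (simp add: time_of_tau)
qed (use assms in auto)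

lemma tau_pos: "0 < t \<Longrightarrow> t < 1 \<Longrightarrow> tau t > 0"
  using tau_strict_mono[of 0 t] by (simp add: tau_0)

lemma dtau_time_of:
  assumes "0 < t" "t < 1" and F: "(F has_vector_derivative D) (at t)"
  shows "dtau (\<lambda>\<tau>. F (time_of m \<alpha> z \<tau>)) (tau t) = inverse (speed t) *\<^sub>R D"
proof -
  have "((F \<circ> time_of m \<alpha> z) has_vector_derivative inverse (speed t) *\<^sub>R D) (at (tau t))"
    using assms time_of_deriv[OF assms(1,2)]
    by (intro vector_diff_chain_at) (auto simp: time_of_tau has_real_derivative_iff_has_vector_derivative)
  moreover have "at (tau t) within {0..} = at (tau t)"
    using tau_pos[OF assms(1,2)] by (intro at_within_interior) simp
  ultimately show ?thesis
    by (simp add: dtau_def o_def vector_derivative_at)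
qed

end

text \<open>
  If \<open>\<tau>\<close> is unbounded, it maps \<open>{0..<1}\<close> onto \<open>{0..}\<close>.
\<close>

locale complete_time_change = time_change +
  assumes tau_unbounded: "\<And>B. \<exists>t. 0 \<le> t \<and> t < 1 \<and> B \<le> tau_of m \<alpha> z t"
begin

lemma tau_surj:
  assumes "\<tau> \<ge> 0" obtains t where "0 \<le> t" "t < 1" "tau t = \<tau>"
proof -
  obtain b where b: "0 \<le> b" "b < 1" "\<tau> \<le> tau b" using tau_unbounded by blast
  have "\<exists>t\<ge>0. t \<le> b \<and> tau t = \<tau>"
    using b assms continuous_on_tau[OF b(2)] by (intro IVT') (auto simp: tau_0)
  then show thesis using that b by force
qed

lemma tau_image: "tau ` {0<..<1} = {0<..}"
proof
  show "tau ` {0<..<1} \<subseteq> {0<..}" using tau_pos by auto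
  show "{0<..} \<subseteq> tau ` {0<..<1}"
  proof
    fix \<tau> :: real assume \<tau>: "\<tau> \<in> {0<..}"
    then obtain t where t: "0 \<le> t" "t < 1" "tau t = \<tau>" using tau_surj[of \<tau>] by auto
    then have "t \<noteq> 0" using \<tau> tau_0 by auto
    then show "\<tau> \<in> tau ` {0<..<1}" using t by auto
  qed
qed

text \<open>
  Integrals over \<open>\<tau>\<close> of functions that are known almost everywhere as functions of \<open>t\<close>.
\<close>

lemma LINT_tau:
  fixes F Q :: "real \<Rightarrow> real"
  assumes "(\<lambda>t. Q t * speed t) absolutely_integrable_on {0<..<1}"
    and "negligible N" and FQ: "\<And>t. t \<in> {0<..<1} - N \<Longrightarrow> F (tau t) = Q t"
  shows "(LINT \<tau>:{0..}|lebesgue. F \<tau>) = integral {0<..<1} (\<lambda>t. Q t * speed t)"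
proof -
  have eq: "\<bar>speed t\<bar> * F (tau t) = Q t * speed t" if "t \<in> {0<..<1} - N" for t
    using FQ[OF that] speed_pos[of t] that by simp
  have 1: "(\<lambda>t. \<bar>speed t\<bar> * F (tau t)) absolutely_integrable_on {0<..<1}"
    by (rule absolutely_integrable_spike[OF assms(1,2)]) (use eq in auto)
  have 2: "integral {0<..<1} (\<lambda>t. \<bar>speed t\<bar> * F (tau t)) = integral {0<..<1} (\<lambda>t. Q t * speed t)"
    by (rule integral_spike[OF assms(2)]) (use eq in auto)
  have "F absolutely_integrable_on (tau ` {0<..<1}) \<and>
      integral (tau ` {0<..<1}) F = integral {0<..<1} (\<lambda>t. Q t * speed t)"
  proof (rule has_absolute_integral_change_of_variables_1'[THEN iffD1])
    show "(tau has_real_derivative speed t) (at t within {0<..<1})" if "t \<in> {0<..<1}" for t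
      using that by (intro DERIV_subset[OF tau_deriv]) auto
    show "inj_on tau {0<..<1}" by (rule inj_on_subset[OF tau_inj]) auto
  qed (use 1 2 in auto)
  then have 3: "F absolutely_integrable_on {0<..}" "integral {0<..} F = integral {0<..<1} (\<lambda>t. Q t * speed t)"
    unfolding tau_image by auto
  have sd: "negligible {x \<in> {0<..} - {0..}. F x \<noteq> 0}" "negligible {x \<in> {0..} - {0<..}. F x \<noteq> 0}"
    by (rule negligible_subset[of "{0::real}"]; force)+
  have "F absolutely_integrable_on {0..}"
    using 3(1) absolutely_integrable_spike_set_eq[OF sd] by simp
  then have "(LINT \<tau>:{0..}|lebesgue. F \<tau>) = integral {0..} F"
    by (rule set_lebesgue_integral_eq_integral(2))
  also have "\<dots> = integral {0<..} F"
    by (rule integral_spike_set[OF sd(2,1)])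
  finally show ?thesis using 3(2) by simp
qed

end

lemma (in masses) tau_of_scaleR:
  assumes "c > 0"
  shows "tau_of m \<alpha> (\<lambda>t. c *\<^sub>R z t) t = c powr (- ((2 + \<alpha>) / 2)) * tau_of m \<alpha> z t"
  using assms unfolding tau_of_def
  by (simp add: mnorm_scaleR powr_mult flip: integral_mult_right)

section \<open>Total collision motions: radius, shape and shape energy\<close>

text \<open>
  A total collision motion with the prescribed energy whose shape stays away from the collisions as
  \<open>t \<rightarrow> 1\<close>. The distance \<open>d\<close> in the last assumption may depend on the motion.
\<close>

locale collapse = masses m for m :: "'n::{finite,linorder} \<Rightarrow> real" +
  fixes \<alpha> :: real and x :: "real \<Rightarrow> real^'d^'n::{finite,linorder}"
  assumes alpha_pos: "0 < \<alpha>" and alpha_less: "\<alpha> < 2"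
    and two_bodies: "CARD('n) \<ge> 2"
    and solution: "total_collision_solution m \<alpha> x"
    and energy_eq: "\<And>t. t \<in> {0<..<1} \<Longrightarrow>
      energy m \<alpha> x t = - (\<alpha> powr (- (\<alpha> / (\<alpha> + 2)))) * mass_pairs m"
    and finally_separated: "\<exists>t1 d. 0 < t1 \<and> t1 < 1 \<and> 0 < d \<and>
      (\<forall>t\<in>{t1..<1}. separated d (s_coord m (x t)))"
begin

text \<open>
  The factor between \<open>x\<close> and the rescaled motion, the radius \<open>r\<close> and its derivative, and the shape and its
  derivative, all with respect to \<open>t\<close>.
\<close>

definition scale :: real where "scale = \<alpha> powr (- (1 / (\<alpha> + 2)))"

definition r :: "real \<Rightarrow> real" where "r t = mnorm m (x t)"

definition dr :: "real \<Rightarrow> real" where "dr t = minner m (x t) (velocity x t) / r t"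

definition sh :: "real \<Rightarrow> real^'d^'n::{finite,linorder}" where "sh t = s_coord m (x t)"

definition dsh :: "real \<Rightarrow> real^'d^'n::{finite,linorder}" where
  "dsh t = (1 / r t) *\<^sub>R velocity x t - (dr t / (r t)\<^sup>2) *\<^sub>R x t"

text \<open>
  The shape energy, expressed by the radius. It equals \<open>|s'|\<^sup>2 / 2 - (U\<^sub>\<alpha>(s) - \<Sum> m\<^sub>i m\<^sub>j) / \<alpha>\<close>, with the
  derivative taken in the rescaled collision time, by \<open>shape_energy_eq\<close>.
\<close>

definition shape_energy :: "real \<Rightarrow> real" where
  "shape_energy t = (mass_pairs m - (scale * r t) powr \<alpha> * mass_pairs m - r t powr \<alpha> * (dr t)\<^sup>2 / 2) / \<alpha>"

text \<open>
  The squared speed \<open>|s'|\<^sup>2\<close> of the shape in the rescaled collision time, by \<open>mnorm_dsh_speed2\<close>.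
\<close>

definition shape_speed2 :: "real \<Rightarrow> real" where
  "shape_speed2 t = r t powr \<alpha> * ((mnorm m (velocity x t))\<^sup>2 - (dr t)\<^sup>2) / \<alpha>"

lemma scale_pos: "scale > 0"
  using alpha_pos by (simp add: scale_def)

lemma scale_powr_alpha: "scale powr \<alpha> = \<alpha> powr (- (\<alpha> / (\<alpha> + 2)))"
  by (simp add: scale_def powr_powr)

lemma scale_powr_half: "scale powr (- ((2 + \<alpha>) / 2)) = sqrt \<alpha>"
proof -
  have "- (1 / (\<alpha> + 2)) * (- ((2 + \<alpha>) / 2)) = 1 / 2"
    using alpha_pos by (simp add: field_simps)
  then have "scale powr (- ((2 + \<alpha>) / 2)) = \<alpha> powr (1 / 2)"
    unfolding scale_def powr_powr by (simp only:)
  then show ?thesis using alpha_pos by (simp add: powr_half_sqrt)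
qed

lemma rescaled_eq: "rescaled \<alpha> x = (\<lambda>t. scale *\<^sub>R x t)"
  by (simp add: rescaled_def scale_def fun_eq_iff)

lemma mp_pos: "mass_pairs m > 0"
  using mass_pairs_pos[OF two_bodies] .

lemma x_cont: "continuous_on {0..1} x"
  and x_noncollision: "\<And>t. 0 \<le> t \<Longrightarrow> t < 1 \<Longrightarrow> x t \<notin> collisions"
  and x_1: "x 1 = 0"
  using solution by (fastforce simp: total_collision_solution_def)+

lemma x_nonzero: "0 \<le> t \<Longrightarrow> t < 1 \<Longrightarrow> x t \<noteq> 0"
proof
  assume t: "0 \<le> t" "t < 1" "x t = 0"
  have "\<not> (\<forall>a b::'n. a = b)"
    using two_bodies card_le_Suc0_iff_eq[of "UNIV::'n set"] by auto
  then have "x t \<in> collisions" using t(3) by (auto simp: collisions_def)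
  then show False using x_noncollision t by blast
qed

text \<open>
  The prefix \<open>X\<close> refers to the collision time of \<open>x\<close>, the prefix \<open>Y\<close> to that of the rescaled motion; the second
  is \<open>sqrt \<alpha>\<close> times the first.
\<close>

sublocale X: time_change m \<alpha> x
  by unfold_locales (use x_cont x_nonzero in auto)

sublocale Y: time_change m \<alpha> "rescaled \<alpha> x"
  unfolding rescaled_eq
  by unfold_locales (use x_cont x_nonzero scale_pos in \<open>auto intro: continuous_intros\<close>)

lemma r_pos: "0 \<le> t \<Longrightarrow> t < 1 \<Longrightarrow> r t > 0"
  using X.mnorm_z_pos by (simp add: r_def)

lemma r_cont: "continuous_on {0..1} r"
  using X.continuous_on_mnorm_z by (simp add: r_def[abs_def])

lemma r_1: "r 1 = 0"
  by (simp add: r_def x_1)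

lemma X_speed: "X.speed t = r t powr (- ((2 + \<alpha>) / 2))"
  by (simp add: X.speed_def r_def)

lemma mnorm_rescaled: "mnorm m (rescaled \<alpha> x t) = scale * r t"
  using scale_pos by (simp add: rescaled_eq mnorm_scaleR r_def)

lemma Y_speed: "Y.speed t = sqrt \<alpha> * r t powr (- ((2 + \<alpha>) / 2))"
  unfolding Y.speed_def mnorm_rescaled using scale_pos scale_powr_half by (simp add: powr_mult r_def)

lemma Y_tau: "Y.tau t = sqrt \<alpha> * X.tau t"
  unfolding rescaled_eq tau_of_scaleR[OF scale_pos] scale_powr_half ..

lemma x_deriv: "0 < t \<Longrightarrow> t < 1 \<Longrightarrow> (x has_vector_derivative velocity x t) (at t)"
  and v_deriv: "0 < t \<Longrightarrow> t < 1 \<Longrightarrow> (velocity x has_vector_derivative velocity (velocity x) t) (at t)"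
  using solution unfolding total_collision_solution_def C1_differentiable_on_eq
  by (auto simp: velocity_def[abs_def] vector_derivative_works)

lemma v_cont: "continuous_on {0<..<1} (velocity x)"
  using solution unfolding total_collision_solution_def C1_differentiable_on_eq
  by (auto simp: velocity_def[abs_def])

text \<open>
  The product of \<open>x\<close> with the acceleration, from the equation of motion and Euler's identity.
\<close>

lemma lagrange_jacobi:
  assumes "0 < t" "t < 1"
  shows "minner m (x t) (velocity (velocity x) t) = - \<alpha> * potential m \<alpha> (x t)"
proof -
  have "GDERIV (potential m \<alpha>) (x t) :> mass_mult m (velocity (velocity x) t)"
    using solution assms by (auto simp: total_collision_solution_def)
  then have D: "(potential m \<alpha> has_derivative (\<lambda>h. h \<bullet> mass_mult m (velocity (velocity x) t))) (at (x t))"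
    by (simp add: gderiv_def)
  have "dpot m \<alpha> (x t) (x t) = x t \<bullet> mass_mult m (velocity (velocity x) t)"
    unfolding dpot_def frechet_derivative_at[OF D, symmetric] ..
  also have "\<dots> = minner m (x t) (velocity (velocity x) t)"
  proof -
    have "x t \<bullet> mass_mult m (velocity (velocity x) t)
        = (\<Sum>i\<in>UNIV. x t $ i \<bullet> mass_mult m (velocity (velocity x) t) $ i)"
      by (rule inner_vec_def)
    then show ?thesis by (simp only: minner_def mass_mult_def vec_lambda_beta inner_scaleR_right)
  qed
  finally show ?thesis using dpot_self[OF x_noncollision] assms by simp
qed

lemma r_power2: "(r t)\<^sup>2 = minner m (x t) (x t)"
  by (simp add: r_def mnorm_power2)

lemma minner_x_v: "0 \<le> t \<Longrightarrow> t < 1 \<Longrightarrow> minner m (x t) (velocity x t) = r t * dr t"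
  using r_pos[of t] by (simp add: dr_def)

lemma minner_deriv:
  assumes "(f has_vector_derivative f') (at t)" "(g has_vector_derivative g') (at t)"
  shows "((\<lambda>t. minner m (f t) (g t)) has_real_derivative (minner m f' (g t) + minner m (f t) g')) (at t)"
  using bounded_bilinear.has_vector_derivative[OF bounded_bilinear_minner assms]
  by (simp add: has_real_derivative_iff_has_vector_derivative add.commute)

lemma r_deriv:
  assumes "0 < t" "t < 1"
  shows "(r has_real_derivative dr t) (at t)"
proof -
  have "((\<lambda>t. minner m (x t) (x t)) has_real_derivative 2 * (r t * dr t)) (at t)"
    by (rule DERIV_cong[OF minner_deriv[OF x_deriv[OF assms] x_deriv[OF assms]]])
      (use assms in \<open>simp add: minner_commute[of "velocity x t"] minner_x_v\<close>)
  from DERIV_chain2[OF DERIV_real_sqrt this]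
  have D: "((\<lambda>t. sqrt (minner m (x t) (x t))) has_real_derivative
      (inverse (sqrt (minner m (x t) (x t))) / 2) * (2 * (r t * dr t))) (at t)"
    using r_pos[of t] assms by (simp flip: r_power2)
  have "(inverse (sqrt (minner m (x t) (x t))) / 2) * (2 * (r t * dr t)) = dr t"
    using r_pos[of t] assms by (simp flip: r_power2)
  from DERIV_cong[OF D this] show ?thesis by (simp add: r_def[abs_def] mnorm_def)
qed

lemma dr_deriv:
  assumes "0 < t" "t < 1"
  shows "(dr has_real_derivative
    ((mnorm m (velocity x t))\<^sup>2 - \<alpha> * potential m \<alpha> (x t) - (dr t)\<^sup>2) / r t) (at t)"
proof -
  have "((\<lambda>t. minner m (x t) (velocity x t) / r t) has_real_derivative
      ((minner m (velocity x t) (velocity x t) + minner m (x t) (velocity (velocity x) t)) * r t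
        - minner m (x t) (velocity x t) * dr t) / (r t * r t)) (at t)"
    using r_pos[of t] assms by (intro DERIV_divide minner_deriv x_deriv v_deriv r_deriv) auto
  moreover have "((minner m (velocity x t) (velocity x t) + minner m (x t) (velocity (velocity x) t)) * r t
        - minner m (x t) (velocity x t) * dr t) / (r t * r t)
      = ((mnorm m (velocity x t))\<^sup>2 - \<alpha> * potential m \<alpha> (x t) - (dr t)\<^sup>2) / r t"
    using r_pos[of t] assms unfolding mnorm_power2
    by (simp add: lagrange_jacobi minner_x_v field_simps power2_eq_square)
  ultimately show ?thesis by (simp add: dr_def[abs_def])
qed

lemma energy_identity:
  assumes "0 < t" "t < 1"
  shows "(mnorm m (velocity x t))\<^sup>2 / 2 - potential m \<alpha> (x t) = - (scale powr \<alpha>) * mass_pairs m"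
  using energy_eq[of t] assms by (simp add: energy_def scale_powr_alpha)

lemma sh_eq: "sh t = (1 / r t) *\<^sub>R x t"
  by (simp add: sh_def s_coord_def r_def)

lemma mnorm_sh: "0 \<le> t \<Longrightarrow> t < 1 \<Longrightarrow> mnorm m (sh t) = 1"
  using r_pos[of t] by (simp add: sh_eq mnorm_scaleR flip: r_def)

lemma sh_noncollision: "0 \<le> t \<Longrightarrow> t < 1 \<Longrightarrow> sh t \<notin> collisions"
  using r_pos[of t] x_noncollision[of t] by (simp add: sh_eq)

lemma potential_sh: "0 \<le> t \<Longrightarrow> t < 1 \<Longrightarrow> potential m \<alpha> (sh t) = r t powr \<alpha> * potential m \<alpha> (x t)"
  using r_pos[of t] by (simp add: sh_eq potential_scaleR powr_minus powr_divide)

lemma sh_cont: "continuous_on {0..<1} sh"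
  unfolding sh_eq[abs_def]
  using r_pos by (intro continuous_intros continuous_on_subset[OF x_cont] continuous_on_subset[OF r_cont])
    (auto simp: less_le)

lemma sh_deriv:
  assumes "0 < t" "t < 1"
  shows "(sh has_vector_derivative dsh t) (at t)"
proof -
  have "((\<lambda>t. 1 / r t) has_real_derivative (- (dr t / (r t)\<^sup>2))) (at t)"
    using r_pos[of t] assms
    by (auto intro!: derivative_eq_intros r_deriv simp: power2_eq_square)
  from has_vector_derivative_scaleR[OF this x_deriv[OF assms]]
  show ?thesis by (simp add: sh_eq[abs_def] dsh_def)
qed

lemma mnorm_dsh:
  assumes "0 < t" "t < 1"
  shows "(mnorm m (dsh t))\<^sup>2 = ((mnorm m (velocity x t))\<^sup>2 - (dr t)\<^sup>2) / (r t)\<^sup>2"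
proof -
  interpret minn: bounded_bilinear "minner m" by (rule bounded_bilinear_minner)
  have "minner m (a *\<^sub>R v - b *\<^sub>R y) (a *\<^sub>R v - b *\<^sub>R y)
      = a\<^sup>2 * minner m v v - 2 * a * b * minner m y v + b\<^sup>2 * minner m y y"
    for a b and v y :: "real^'d^'n::{finite,linorder}"
    by (simp add: minn.diff_left minn.diff_right minn.scaleR_left minn.scaleR_right
        minner_commute[of v y] power2_eq_square algebra_simps)
  then have "(mnorm m (dsh t))\<^sup>2 = (1 / r t)\<^sup>2 * (mnorm m (velocity x t))\<^sup>2
      - 2 * (1 / r t) * (dr t / (r t)\<^sup>2) * (r t * dr t) + (dr t / (r t)\<^sup>2)\<^sup>2 * (r t)\<^sup>2"
    using assms by (simp add: mnorm_power2 dsh_def r_power2[symmetric] minner_x_v)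
  also have "\<dots> = ((mnorm m (velocity x t))\<^sup>2 - (dr t)\<^sup>2) / (r t)\<^sup>2"
    using r_pos[of t] assms by (simp add: field_simps power2_eq_square)
  finally show ?thesis .
qed

lemma mnorm_dsh_speed2:
  assumes "0 < t" "t < 1"
  shows "(mnorm m (dsh t))\<^sup>2 = shape_speed2 t * (Y.speed t)\<^sup>2"
    and "(mnorm m (dsh t))\<^sup>2 = \<alpha> * shape_speed2 t * (X.speed t)\<^sup>2"
proof -
  have r: "r t > 0" using r_pos assms by simp
  have "(r t powr (- ((2 + \<alpha>) / 2)))\<^sup>2 = r t powr (- (2 + \<alpha>))"
    using r by (simp add: power2_eq_square flip: powr_add)
  also have "\<dots> = r t powr (- \<alpha>) / (r t)\<^sup>2"
  proof -
    have "- (2 + \<alpha>) = - \<alpha> - 2" by simp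
    then show ?thesis using r by (simp only: powr_diff) simp
  qed
  finally have *: "(r t powr (- ((2 + \<alpha>) / 2)))\<^sup>2 = r t powr (- \<alpha>) / (r t)\<^sup>2" .
  show "(mnorm m (dsh t))\<^sup>2 = \<alpha> * shape_speed2 t * (X.speed t)\<^sup>2"
    using r alpha_pos unfolding X_speed *
    by (simp add: mnorm_dsh[OF assms] shape_speed2_def powr_minus)
  then show "(mnorm m (dsh t))\<^sup>2 = shape_speed2 t * (Y.speed t)\<^sup>2"
    using alpha_pos by (simp add: X_speed Y_speed power_mult_distrib)
qed

lemma shape_speed2_nonneg:
  assumes "0 < t" "t < 1" shows "shape_speed2 t \<ge> 0"
proof -
  have "0 \<le> shape_speed2 t * (Y.speed t)\<^sup>2"
    by (simp flip: mnorm_dsh_speed2(1)[OF assms])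
  then show ?thesis
    using Y.speed_pos[of t] assms by (simp add: zero_le_mult_iff)
qed

lemma shape_energy_eq:
  assumes "0 < t" "t < 1"
  shows "shape_energy t = shape_speed2 t / 2 - (potential m \<alpha> (sh t) - mass_pairs m) / \<alpha>"
proof -
  have r: "r t > 0" using r_pos assms by simp
  have "(scale * r t) powr \<alpha> * mass_pairs m = - (r t powr \<alpha> * (- (scale powr \<alpha>) * mass_pairs m))"
    using scale_pos r by (simp add: powr_mult)
  also have "\<dots> = - (r t powr \<alpha> * ((mnorm m (velocity x t))\<^sup>2 / 2 - potential m \<alpha> (x t)))"
    by (simp only: energy_identity[OF assms])
  finally have "mass_pairs m - (scale * r t) powr \<alpha> * mass_pairs m - r t powr \<alpha> * (dr t)\<^sup>2 / 2
      = r t powr \<alpha> * ((mnorm m (velocity x t))\<^sup>2 - (dr t)\<^sup>2) / 2 - (potential m \<alpha> (sh t) - mass_pairs m)"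
    using assms by (simp add: potential_sh field_simps)
  then show ?thesis
    unfolding shape_energy_def shape_speed2_def by (simp only: diff_divide_distrib) (simp add: mult.commute)
qed

text \<open>
  In the rescaled collision time this is \<open>E' = 2 \<lambda> |s'|\<^sup>2\<close>, where
  \<open>\<lambda> = - \<rho>' / \<rho>\<close> and \<open>\<rho>\<close> is the power \<open>(2 - \<alpha>) / 4\<close> of the radius.
\<close>

lemma shape_energy_deriv:
  assumes "0 < t" "t < 1"
  shows "(shape_energy has_real_derivative ((2 - \<alpha>) / 2 * (- dr t / r t) * shape_speed2 t)) (at t)"
proof -
  have r: "r t > 0" using r_pos assms by simp
  let ?A = "(mnorm m (velocity x t))\<^sup>2 - \<alpha> * potential m \<alpha> (x t) - (dr t)\<^sup>2"
  have eq: "shape_energy = (\<lambda>t. (mass_pairs m - (scale * r t) powr \<alpha> * mass_pairs m - r t powr \<alpha> * (dr t)\<^sup>2 / 2) / \<alpha>)"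
    by (simp add: shape_energy_def fun_eq_iff)
  have 1: "((\<lambda>t. r t powr \<alpha>) has_real_derivative (\<alpha> * r t powr (\<alpha> - 1) * dr t)) (at t)"
    using DERIV_fun_powr[OF r_deriv[OF assms] r, of \<alpha>] by (simp add: mult_ac)
  have 2: "((\<lambda>t. (scale * r t) powr \<alpha>) has_real_derivative (\<alpha> * (scale * r t) powr (\<alpha> - 1) * (scale * dr t))) (at t)"
    using DERIV_fun_powr[OF DERIV_cmult[OF r_deriv[OF assms], of scale], of \<alpha>] r scale_pos by (simp add: mult_ac)
  have 3: "((\<lambda>t. (dr t)\<^sup>2) has_real_derivative (2 * dr t * (?A / r t))) (at t)"
    using DERIV_power[OF dr_deriv[OF assms], of 2] by (simp add: mult_ac)
  have "(shape_energy has_real_derivative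
    ((0 - \<alpha> * (scale * r t) powr (\<alpha> - 1) * (scale * dr t) * mass_pairs m
      - ((\<alpha> * r t powr (\<alpha> - 1) * dr t) * (dr t)\<^sup>2 + (2 * dr t * (?A / r t)) * r t powr \<alpha>) / 2) / \<alpha>)) (at t)"
    unfolding eq
    by (intro DERIV_cdivide DERIV_diff DERIV_const DERIV_cmult_right DERIV_mult 1 2 3)
  moreover have "((0 - \<alpha> * (scale * r t) powr (\<alpha> - 1) * (scale * dr t) * mass_pairs m
      - ((\<alpha> * r t powr (\<alpha> - 1) * dr t) * (dr t)\<^sup>2 + (2 * dr t * (?A / r t)) * r t powr \<alpha>) / 2) / \<alpha>)
      = (2 - \<alpha>) / 2 * (- dr t / r t) * shape_speed2 t"
  proof -
    have p1: "r t powr (\<alpha> - 1) = r t powr \<alpha> / r t" using r by (simp add: powr_diff)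
    have p2: "(scale * r t) powr (\<alpha> - 1) * scale = scale powr \<alpha> * (r t powr \<alpha> / r t)"
      using r scale_pos by (simp add: powr_diff powr_mult)
    have e: "scale powr \<alpha> * mass_pairs m = potential m \<alpha> (x t) - (mnorm m (velocity x t))\<^sup>2 / 2"
      using energy_identity[OF assms] by simp
    have "\<alpha> * (scale * r t) powr (\<alpha> - 1) * (scale * dr t) * mass_pairs m
        = \<alpha> * ((scale * r t) powr (\<alpha> - 1) * scale) * dr t * mass_pairs m" by simp
    also have "\<dots> = \<alpha> * (scale powr \<alpha> * mass_pairs m) * (r t powr \<alpha> / r t) * dr t"
      by (simp only: p2) simp
    also have "\<dots> = \<alpha> * (potential m \<alpha> (x t) - (mnorm m (velocity x t))\<^sup>2 / 2) * (r t powr \<alpha> / r t) * dr t"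
      by (simp only: e)
    finally have e2: "\<alpha> * (scale * r t) powr (\<alpha> - 1) * (scale * dr t) * mass_pairs m
       = \<alpha> * (potential m \<alpha> (x t) - (mnorm m (velocity x t))\<^sup>2 / 2) * (r t powr \<alpha> / r t) * dr t" .
    show ?thesis
      unfolding e2 p1 shape_speed2_def using alpha_pos r
      by (simp add: field_simps power2_eq_square)
  qed
  ultimately show ?thesis by simp
qed

lemma shape_energy_ge:
  assumes "0 < t" "t < 1"
  shows "shape_energy t \<ge> - ((potential m \<alpha> (sh t) - mass_pairs m) / \<alpha>)"
  using shape_energy_eq[OF assms] shape_speed2_nonneg[OF assms] by simp

lemma shape_speed2_le:
  assumes "0 < t" "t < 1"
  shows "shape_energy t \<le> shape_speed2 t / 2 + logdiam"
proof -
  have "potential m \<alpha> (sh t) \<ge> mass_pairs m - \<alpha> * logdiam"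
    using assms alpha_pos by (intro potential_ge mnorm_sh sh_noncollision) auto
  then have "(potential m \<alpha> (sh t) - mass_pairs m) / \<alpha> \<ge> - logdiam"
    using alpha_pos by (simp add: field_simps)
  then show ?thesis using shape_energy_eq[OF assms] by simp
qed

text \<open>
  Near \<open>t = 1\<close> the potential of the shape is bounded, so the energy relation gives
  \<open>r\<^sup>\<alpha> (dr / dt)\<^sup>2 \<le> 2 C\<close>. Hence \<open>r\<close> to the power \<open>q = (2 + \<alpha>) / 2\<close> is at most \<open>k (1 - t)\<close>, and the
  integrand of \<open>\<tau>\<close> is at least \<open>1 / (k (1 - t))\<close>, which is not integrable.
\<close>

lemma X_tau_unbounded: "\<exists>t. 0 \<le> t \<and> t < 1 \<and> B \<le> X.tau t"
proof -
  obtain t1 d where t1: "0 < t1" "t1 < 1" "0 < d" "\<And>t. t \<in> {t1..<1} \<Longrightarrow> separated d (sh t)"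
    using finally_separated by (auto simp: sh_def)
  define C where "C = mass_pairs m * d powr (-\<alpha>)"
  have C: "potential m \<alpha> (sh t) \<le> C" if "t \<in> {t1..<1}" for t
    unfolding C_def potential_pairs
  proof (rule mass_pairs_weighted_le)
    fix p :: "'n \<times> 'n" assume "p \<in> pairs"
    then have "d \<le> norm (gap (sh t) p)"
      using t1(4)[OF that] by (auto simp: separated_def pairs_def)
    then show "norm (gap (sh t) p) powr (- \<alpha>) \<le> d powr (- \<alpha>)"
      using t1(3) alpha_pos by (intro powr_mono2') auto
  qed
  have C_pos: "C > 0" using mp_pos t1(3) by (simp add: C_def)
  define q where "q = (2 + \<alpha>) / 2"
  define k where "k = q * sqrt (2 * C)"
  have q: "q > 0" using alpha_pos by (simp add: q_def)
  have k: "k > 0" using q C_pos by (simp add: k_def)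
  have dr_bound: "r t powr (\<alpha> / 2) * \<bar>dr t\<bar> \<le> sqrt (2 * C)" if t: "t \<in> {t1..<1}" for t
  proof -
    have t': "0 < t" "t < 1" "0 \<le> t" using t t1 by auto
    have r: "r t > 0" using r_pos t' by simp
    have "(dr t)\<^sup>2 \<le> (mnorm m (velocity x t))\<^sup>2"
      using shape_speed2_nonneg[OF t'(1,2)] alpha_pos r by (simp add: shape_speed2_def zero_le_divide_iff zero_le_mult_iff)
    also have "\<dots> \<le> 2 * potential m \<alpha> (x t)"
    proof -
      have "scale powr \<alpha> * mass_pairs m \<ge> 0" using mp_pos by simp
      then show ?thesis using energy_identity[OF t'(1,2)] by simp
    qed
    finally have "r t powr \<alpha> * (dr t)\<^sup>2 \<le> r t powr \<alpha> * (2 * potential m \<alpha> (x t))"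
      by (intro mult_left_mono) auto
    also have "\<dots> = 2 * potential m \<alpha> (sh t)" using t' by (simp add: potential_sh)
    also have "\<dots> \<le> 2 * C" using C[OF t] by simp
    finally have "(r t powr (\<alpha> / 2) * \<bar>dr t\<bar>)\<^sup>2 \<le> 2 * C"
      using r by (simp add: power_mult_distrib power2_eq_square[of "r t powr (\<alpha> / 2)"] flip: powr_add)
    then show ?thesis by (rule real_le_rsqrt)
  qed
  have r_le: "r t powr q \<le> k * (1 - t)" if t: "t \<in> {t1..<1}" for t
  proof -
    have "r t powr q - k * (1 - t) \<le> r 1 powr q - k * (1 - 1)"
    proof (rule DERIV_nonneg_imp_increasing_open[of t 1 "\<lambda>t. r t powr q - k * (1 - t)"])
      fix u assume u: "t < u" "u < 1"
      then have u': "0 < u" "u \<in> {t1..<1}" using t t1 by auto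
      have "((\<lambda>t. k * (1 - t)) has_real_derivative (- k)) (at u)"
        by (auto intro!: derivative_eq_intros)
      from DERIV_diff[OF DERIV_fun_powr[OF r_deriv[OF u'(1) u(2)], of q] this]
      have "((\<lambda>t. r t powr q - k * (1 - t)) has_real_derivative (q * r u powr (q - 1) * dr u + k)) (at u)"
        using r_pos[of u] u u' by simp
      moreover have "q * r u powr (q - 1) * dr u + k \<ge> 0"
      proof -
        have "q - 1 = \<alpha> / 2" by (simp add: q_def field_simps)
        then have "r u powr (q - 1) * \<bar>dr u\<bar> \<le> sqrt (2 * C)" using dr_bound[OF u'(2)] by (simp only:)
        then have "q * (r u powr (q - 1) * \<bar>dr u\<bar>) \<le> k"
          using q by (simp add: k_def mult_left_mono)
        moreover have "q * (r u powr (q - 1) * dr u) \<ge> - (q * (r u powr (q - 1) * \<bar>dr u\<bar>))"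
        proof -
          have "r u powr (q - 1) * dr u \<ge> - (r u powr (q - 1) * \<bar>dr u\<bar>)"
            using mult_left_mono[of "- \<bar>dr u\<bar>" "dr u" "r u powr (q - 1)"] by simp
          from mult_left_mono[OF this, of q] show ?thesis using q by simp
        qed
        ultimately show ?thesis by (simp add: mult.assoc)
      qed
      ultimately show "\<exists>y. ((\<lambda>t. r t powr q - k * (1 - t)) has_real_derivative y) (at u) \<and> 0 \<le> y" by blast
    next
      have "continuous_on {t..1} r" using t t1 by (intro continuous_on_subset[OF r_cont]) auto
      then show "continuous_on {t..1} (\<lambda>t. r t powr q - k * (1 - t))"
        using q r_pos t t1 by (intro continuous_intros continuous_on_powr') (auto simp: r_def)
    qed (use t in auto)
    then show ?thesis using q by (simp add: r_1)
  qed
  define M where "M = max 0 (B - X.tau t1)"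
  \<comment> \<open>The time at which \<open>1 / k\<close> times \<open>ln ((1 - t1) / (1 - t2))\<close> equals \<open>M\<close>.\<close>
  define t2 where "t2 = 1 - (1 - t1) * exp (- k * M)"
  have "exp (- k * M) \<le> 1" "exp (- k * M) > 0" using k by (auto simp: M_def)
  then have "(1 - t1) * exp (- k * M) \<le> 1 - t1" "(1 - t1) * exp (- k * M) > 0"
    using t1 by (auto simp: mult_left_le)
  then have t2: "t1 \<le> t2" "t2 < 1" by (auto simp: t2_def)
  have "X.tau t1 + 1 / k * ln (1 - t1) \<le> X.tau t2 + 1 / k * ln (1 - t2)"
  proof (rule DERIV_nonneg_imp_nondecreasing[OF t2(1), of "\<lambda>t. X.tau t + 1 / k * ln (1 - t)"])
    fix u assume u: "t1 \<le> u" "u \<le> t2"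
    then have u': "0 < u" "u < 1" "u \<in> {t1..<1}" using t1 t2 by auto
    have "((\<lambda>t. ln (1 - t)) has_real_derivative (- (1 / (1 - u)))) (at u)"
      using u' by (auto intro!: derivative_eq_intros simp: divide_inverse)
    from DERIV_add[OF X.tau_deriv[OF u'(1,2)] DERIV_cmult[OF this, of "1 / k"]]
    have "((\<lambda>t. X.tau t + 1 / k * ln (1 - t)) has_real_derivative (X.speed u - 1 / k * (1 / (1 - u)))) (at u)"
      by simp
    moreover have "X.speed u - 1 / k * (1 / (1 - u)) \<ge> 0"
    proof -
      have "r u powr q > 0" using r_pos[of u] u' by simp
      then have "1 / (k * (1 - u)) \<le> 1 / (r u powr q)"
        using r_le[OF u'(3)] by (intro divide_left_mono) (auto simp: mult_pos_pos u' k)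
      also have "\<dots> = X.speed u" by (simp add: X_speed q_def powr_minus_divide del: minus_divide_left)
      finally show ?thesis by simp
    qed
    ultimately show "\<exists>y. ((\<lambda>t. X.tau t + 1 / k * ln (1 - t)) has_real_derivative y) (at u) \<and> 0 \<le> y" by blast
  qed
  moreover have "ln (1 - t2) = ln (1 - t1) - k * M"
    using t1 by (simp add: t2_def ln_mult)
  then have "1 / k * ln (1 - t2) = 1 / k * ln (1 - t1) - M" using k by (simp add: diff_divide_distrib)
  ultimately have "X.tau t1 + M \<le> X.tau t2" by linarith
  then have "B \<le> X.tau t2" by (simp add: M_def)
  then show ?thesis using t1 t2 by (intro exI[of _ t2]) auto
qed

end

sublocale collapse \<subseteq> X: complete_time_change m \<alpha> x
  by unfold_locales (rule X_tau_unbounded)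

sublocale collapse \<subseteq> Y: complete_time_change m \<alpha> "rescaled \<alpha> x"
proof
  fix B
  obtain t where "0 \<le> t" "t < 1" "B / sqrt \<alpha> \<le> X.tau t" using X_tau_unbounded by blast
  then show "\<exists>t. 0 \<le> t \<and> t < 1 \<and> B \<le> Y.tau t"
    using alpha_pos by (intro exI[of _ t]) (simp add: Y_tau field_simps)
qed

section \<open>Uniform estimates near the collision\<close>

text \<open>
  The rescaled radius is \<open>1\<close> at the initial time and the radius decreases.
\<close>

locale decreasing_collapse = collapse m \<alpha> x
  for m :: "'n::{finite,linorder} \<Rightarrow> real" and \<alpha> :: real
    and x :: "real \<Rightarrow> real^'d^'n::{finite,linorder}" +
  assumes initial_size: "scale * r 0 = 1"
    and dr_neg: "\<And>t. 0 < t \<Longrightarrow> t < 1 \<Longrightarrow> dr t < 0"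
begin

lemma shape_energy_mono:
  assumes "0 < t" "t \<le> u" "u < 1"
  shows "shape_energy t \<le> shape_energy u"
proof (rule DERIV_nonneg_imp_nondecreasing[OF assms(2)])
  fix w assume "t \<le> w" "w \<le> u"
  then have w: "0 < w" "w < 1" using assms by auto
  have "(2 - \<alpha>) / 2 * (- dr w / r w) * shape_speed2 w \<ge> 0"
    using w dr_neg[OF w] r_pos[of w] shape_speed2_nonneg[OF w] alpha_less
    by (intro mult_nonneg_nonneg divide_nonneg_nonneg) auto
  then show "\<exists>y. (shape_energy has_real_derivative y) (at w) \<and> 0 \<le> y"
    using shape_energy_deriv[OF w] by blast
qed

text \<open>
  If \<open>E\<close> exceeds this bound at one time, then \<open>|s'|\<^sup>2 \<ge> 2 (E - logdiam) > 1\<close> from then on. The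
  derivative of \<open>E\<close> then dominates that of \<open>- (2 - \<alpha>) / 2 log r\<close>. But \<open>E \<le> (\<Sum> m\<^sub>i m\<^sub>j) / \<alpha>\<close>, whereas
  \<open>log r \<rightarrow> - \<infinity>\<close> at the collision.
\<close>

lemma shape_energy_le:
  assumes "0 < t" "t < 1"
  shows "shape_energy t \<le> 1 / 2 + logdiam"
proof (rule ccontr)
  assume neg: "\<not> ?thesis"
  let ?f = "\<lambda>u. shape_energy u + (2 - \<alpha>) / 2 * ln (r u)"
  have f_mono: "?f t \<le> ?f u" if u: "t \<le> u" "u < 1" for u
  proof (rule DERIV_nonneg_imp_nondecreasing[OF u(1)])
    fix w assume "t \<le> w" "w \<le> u"
    then have w: "0 < w" "w < 1" "t \<le> w" using assms u by auto
    have "((\<lambda>u. ln (r u)) has_real_derivative dr w / r w) (at w)"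
      using DERIV_chain2[OF DERIV_ln_divide r_deriv[OF w(1,2)]] r_pos[of w] w by simp
    then have "(?f has_real_derivative (2 - \<alpha>) / 2 * (- dr w / r w) * (shape_speed2 w - 1)) (at w)"
      by (intro DERIV_cong[OF DERIV_add[OF shape_energy_deriv[OF w(1,2)] DERIV_cmult]])
        (auto simp: right_diff_distrib)
    moreover have "shape_speed2 w \<ge> 1"
      using neg shape_energy_mono[OF assms(1) w(3,2)] shape_speed2_le[OF w(1,2)] by simp
    then have "(2 - \<alpha>) / 2 * (- dr w / r w) * (shape_speed2 w - 1) \<ge> 0"
      using w dr_neg[of w] r_pos[of w] alpha_less
      by (intro mult_nonneg_nonneg divide_nonneg_nonneg) auto
    ultimately show "\<exists>y. (?f has_real_derivative y) (at w) \<and> 0 \<le> y" by blast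
  qed
  define e where "e = exp ((?f t - mass_pairs m / \<alpha>) / ((2 - \<alpha>) / 2))"
  have lower: "e \<le> r u" if u: "t \<le> u" "u < 1" for u
  proof -
    have "shape_energy u \<le> mass_pairs m / \<alpha>"
      unfolding shape_energy_def using alpha_pos mp_pos
      by (intro divide_right_mono) (auto simp: diff_le_eq intro!: add_nonneg_nonneg)
    then have "?f t - mass_pairs m / \<alpha> \<le> (2 - \<alpha>) / 2 * ln (r u)"
      using f_mono[OF u] by linarith
    then have "(?f t - mass_pairs m / \<alpha>) / ((2 - \<alpha>) / 2) \<le> ln (r u)"
      using alpha_less by (simp add: field_simps)
    then have "e \<le> exp (ln (r u))" unfolding e_def by (simp only: exp_le_cancel_iff)
    then show ?thesis using r_pos[of u] u assms by simp
  qed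
  have "e > 0" by (simp add: e_def)
  then obtain d where d: "d > 0" "\<And>u. u \<in> {0..1} \<Longrightarrow> dist u 1 < d \<Longrightarrow> dist (r u) (r 1) < e"
    using r_cont[unfolded continuous_on_iff, rule_format, of 1 e] by auto
  define u where "u = max t (1 - d / 2)"
  have u: "t \<le> u" "u < 1" "dist u 1 < d" using d(1) assms by (auto simp: u_def dist_real_def)
  then have "r u < e" using d(2)[of u] assms r_pos[of u] by (simp add: r_1)
  then show False using lower[OF u(1,2)] by simp
qed

lemma shape_energy_lower:
  assumes "potential m \<alpha> (sh 0) \<le> mass_pairs m + \<alpha> * B" and "0 < t" "t < 1"
  shows "shape_energy t \<ge> - B"
proof -
  let ?g = "\<lambda>u. - ((potential m \<alpha> (sh u) - mass_pairs m) / \<alpha>)"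
  have "continuous_on {0..<1} ?g"
    using sh_noncollision alpha_pos
    by (intro continuous_intros continuous_on_compose2[OF continuous_on_potential sh_cont]) auto
  then have "(?g \<longlongrightarrow> ?g 0) (at 0 within {0..<1})"
    by (simp add: continuous_on)
  then have "(?g \<longlongrightarrow> ?g 0) (at 0 within {0..1/2})"
    by (rule tendsto_within_subset) auto
  then have lim: "(?g \<longlongrightarrow> ?g 0) (at_right 0)"
    by (simp add: at_within_Icc_at_right)
  have "\<forall>\<^sub>F u in at_right 0. 0 < u \<and> u < t"
    using assms(2) by (auto simp: eventually_at_right_field)
  then have "\<forall>\<^sub>F u in at_right 0. ?g u \<le> shape_energy t"
  proof eventually_elim
    case (elim u)
    then show ?case
      using shape_energy_ge[of u] shape_energy_mono[of u t] assms by simp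
  qed
  from tendsto_upperbound[OF lim this] have "?g 0 \<le> shape_energy t" by simp
  moreover have "(potential m \<alpha> (sh 0) - mass_pairs m) / \<alpha> \<le> B"
    using assms(1) alpha_pos by (simp add: field_simps)
  ultimately show ?thesis by simp
qed

lemma Y_speed_power2: "0 \<le> t \<Longrightarrow> t < 1 \<Longrightarrow> (Y.speed t)\<^sup>2 = \<alpha> / (r t powr \<alpha> * (r t)\<^sup>2)"
proof -
  assume t: "0 \<le> t" "t < 1"
  have r: "r t > 0" using r_pos[OF t] .
  have "(r t powr (- ((2 + \<alpha>) / 2)))\<^sup>2 = r t powr (- (\<alpha> + 2))"
  proof -
    have "- ((2 + \<alpha>) / 2) + - ((2 + \<alpha>) / 2) = - (\<alpha> + 2)" by simp
    then show ?thesis by (simp only: power2_eq_square flip: powr_add)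
  qed
  also have "\<dots> = 1 / (r t powr \<alpha> * r t powr 2)"
    using r by (simp only: powr_minus_divide powr_add)
  also have "\<dots> = 1 / (r t powr \<alpha> * (r t)\<^sup>2)" using r by simp
  finally show ?thesis
    using alpha_pos by (simp add: Y_speed power_mult_distrib)
qed

lemma radial_identity:
  assumes "0 < t" "t < 1"
  shows "(dr t)\<^sup>2 = 2 * (mass_pairs m * ((1 - (scale * r t) powr \<alpha>) / \<alpha>) - shape_energy t) * ((r t)\<^sup>2 * (Y.speed t)\<^sup>2)"
proof -
  have r: "r t > 0" using r_pos assms by simp
  have "2 * (mass_pairs m * ((1 - (scale * r t) powr \<alpha>) / \<alpha>) - shape_energy t) = r t powr \<alpha> * (dr t)\<^sup>2 / \<alpha>"
    using alpha_pos unfolding shape_energy_def by (simp add: field_simps)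
  then show ?thesis
    using assms r alpha_pos by (simp add: Y_speed_power2)
qed

text \<open>
  The right-hand side is the contraction rate \<open>\<lambda>\<close> times the derivative of the rescaled collision time. The
  constant \<open>8 \<Lambda>\<^sup>2\<close> comes from \<open>\<lambda>\<^sup>2 = 2 p\<^sup>2 (...)\<close> with \<open>p = (2 - \<alpha>) / 4 \<ge> 1 / 4\<close>.
\<close>

lemma contraction_rate:
  assumes "0 < t" "t < 1" and "\<alpha> \<le> 1" "L \<ge> 0" "2 * L * \<alpha> \<le> 1" "(scale * r t) powr \<alpha> \<le> exp (- (2 * L * \<alpha>))"
    and "\<Lambda> \<ge> 0" "8 * \<Lambda>\<^sup>2 + 1 / 2 + logdiam \<le> mass_pairs m * L"
  shows "\<Lambda> * Y.speed t \<le> (2 - \<alpha>) / 4 * (- dr t / r t)"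
proof -
  have r: "r t > 0" using r_pos assms by simp
  let ?x = "2 * L * \<alpha>"
  have x0: "?x \<ge> 0" using assms alpha_pos by simp
  have "exp (- ?x) \<le> 1 / (1 + ?x)"
    using exp_ge_add_one_self[of ?x] x0 by (simp add: exp_minus inverse_eq_divide frac_le del: exp_ge_add_one_self)
  also have "\<dots> \<le> 1 - ?x / 2"
  proof -
    have "1 \<le> (1 - ?x / 2) * (1 + ?x)"
    proof -
      have "(1 - ?x / 2) * (1 + ?x) = 1 + ?x * (1 - ?x) / 2" by algebra
      moreover have "?x * (1 - ?x) \<ge> 0" by (rule mult_nonneg_nonneg[OF x0]) (use assms(5) in simp)
      ultimately show ?thesis by linarith
    qed
    then show ?thesis using x0 by (subst divide_le_eq) auto
  qed
  finally have "L * \<alpha> \<le> 1 - (scale * r t) powr \<alpha>" using assms(6) by simp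
  then have "L \<le> (1 - (scale * r t) powr \<alpha>) / \<alpha>" using alpha_pos by (simp add: field_simps)
  then have "mass_pairs m * L \<le> mass_pairs m * ((1 - (scale * r t) powr \<alpha>) / \<alpha>)"
    using mp_pos by (intro mult_left_mono) auto
  then have "8 * \<Lambda>\<^sup>2 \<le> mass_pairs m * ((1 - (scale * r t) powr \<alpha>) / \<alpha>) - shape_energy t"
    using assms(8) shape_energy_le[OF assms(1,2)] by linarith
  then have "16 * \<Lambda>\<^sup>2 * ((r t)\<^sup>2 * (Y.speed t)\<^sup>2) \<le> (dr t)\<^sup>2"
    unfolding radial_identity[OF assms(1,2)] by (intro mult_right_mono) auto
  then have "(4 * \<Lambda> * r t * Y.speed t)\<^sup>2 \<le> (- dr t)\<^sup>2"
    by (simp add: power_mult_distrib mult.assoc)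
  then have "4 * \<Lambda> * r t * Y.speed t \<le> - dr t"
    by (rule power2_le_imp_le) (use dr_neg[OF assms(1,2)] in simp)
  then have "\<Lambda> * Y.speed t \<le> 1 / 4 * (- dr t / r t)"
    using r by (simp add: field_simps)
  also have "\<dots> \<le> (2 - \<alpha>) / 4 * (- dr t / r t)"
    using assms(3) r dr_neg[OF assms(1,2)] by (intro mult_right_mono divide_nonneg_nonneg) auto
  finally show ?thesis .
qed

lemma scaled_size_le: "0 \<le> t \<Longrightarrow> t < 1 \<Longrightarrow> scale * r t \<le> 1"
proof -
  assume t: "0 \<le> t" "t < 1"
  have "- r 0 \<le> - r t"
  proof (rule DERIV_nonneg_imp_increasing_open[OF t(1)])
    show "\<exists>y. ((\<lambda>t. - r t) has_real_derivative y) (at u) \<and> 0 \<le> y" if "0 < u" "u < t" for u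
      using DERIV_minus[OF r_deriv[of u]] dr_neg[of u] that t by (intro exI[of _ "- dr u"]) auto
    show "continuous_on {0..t} (\<lambda>t. - r t)"
      using t by (intro continuous_intros continuous_on_subset[OF r_cont]) auto
  qed
  then have "scale * r t \<le> scale * r 0" using scale_pos by simp
  then show ?thesis using initial_size by simp
qed

text \<open>
  A lower bound for the rescaled radius. For \<open>l = - log (scale r)\<close> and \<open>M = \<Sum> m\<^sub>i m\<^sub>j\<close> one has
  \<open>l'\<^sup>2 \<le> 2 (M l + B) \<le> (M l + B + 1)\<^sup>2\<close>, so \<open>M l + B + 1\<close> grows at most
  exponentially in the rescaled collision time.
\<close>

lemma log_size_le:
  assumes lower: "\<And>t. 0 < t \<Longrightarrow> t < 1 \<Longrightarrow> shape_energy t \<ge> - B" and B: "B \<ge> 0"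
    and t: "0 < t" "t < 1"
  shows "- ln (scale * r t) \<le> (B + 1) * exp (mass_pairs m * Y.tau t) / mass_pairs m"
proof -
  let ?l = "\<lambda>u. - ln (scale * r u)"
  let ?k = "\<lambda>u. mass_pairs m * ?l u + (B + 1)"
  have l0: "?l u \<ge> 0" if "0 \<le> u" "u < 1" for u
    using scaled_size_le[OF that] scale_pos r_pos[OF that] by simp
  have k1: "?k u \<ge> 1" if "0 \<le> u" "u < 1" for u
  proof -
    have "mass_pairs m * ?l u \<ge> 0" using l0[OF that] mp_pos by (intro mult_nonneg_nonneg) auto
    then show ?thesis using B by linarith
  qed
  let ?g = "\<lambda>u. mass_pairs m * Y.tau u - ln (?k u)"
  have "?g 0 \<le> ?g t"
  proof (rule DERIV_nonneg_imp_increasing_open[of 0 t ?g])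
    show "0 \<le> t" using t by simp
    fix u assume u: "0 < u" "u < t"
    then have u': "0 < u" "u < 1" "0 \<le> u" using t by auto
    have r: "r u > 0" using r_pos u' by simp
    have sr: "scale * r u > 0" using r scale_pos by simp
    have "((\<lambda>u. ln (scale * r u)) has_real_derivative dr u / r u) (at u)"
      using DERIV_chain2[OF DERIV_ln_divide[OF sr] DERIV_cmult[OF r_deriv[OF u'(1,2)], of scale]] scale_pos
      by simp
    then have kd: "(?k has_real_derivative mass_pairs m * (- dr u / r u)) (at u)"
      using DERIV_add[OF DERIV_cmult[OF DERIV_minus, of "\<lambda>u. ln (scale * r u)"] DERIV_const, of _ u _ "mass_pairs m" "B + 1"]
      by fastforce
    have "(?g has_real_derivative (mass_pairs m * Y.speed u - mass_pairs m * (- dr u / r u) / ?k u)) (at u)"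
    proof (rule DERIV_cong[OF DERIV_diff[OF DERIV_cmult[OF Y.tau_deriv[OF u'(1,2)], of "mass_pairs m"]
          DERIV_chain2[OF DERIV_ln_divide kd]]])
      show "?k u > 0" using k1[OF u'(3,2)] by linarith
    qed simp
    moreover have "mass_pairs m * Y.speed u - mass_pairs m * (- dr u / r u) / ?k u \<ge> 0"
    proof -
      have "(scale * r u) powr \<alpha> = exp (- (\<alpha> * ?l u))"
        using sr scale_pos r by (simp add: powr_def)
      also have "\<dots> \<ge> 1 + - (\<alpha> * ?l u)" by (rule exp_ge_add_one_self)
      finally have "(1 - (scale * r u) powr \<alpha>) / \<alpha> \<le> ?l u"
        using alpha_pos by (simp add: field_simps)
      then have "mass_pairs m * ((1 - (scale * r u) powr \<alpha>) / \<alpha>) \<le> mass_pairs m * ?l u"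
        using mp_pos by (intro mult_left_mono) auto
      then have "2 * (mass_pairs m * ((1 - (scale * r u) powr \<alpha>) / \<alpha>) - shape_energy u) \<le> 2 * (?k u - 1)"
      proof -
        have "2 * (a - E) \<le> 2 * (b + (B + 1) - 1)" if "a \<le> b" "- B \<le> E" for a b E :: real
          using add_mono[OF that(1), of "- E" B] that(2) by simp
        from this[OF _ lower[OF u'(1,2)]] show ?thesis
          using \<open>mass_pairs m * ((1 - (scale * r u) powr \<alpha>) / \<alpha>) \<le> mass_pairs m * ?l u\<close> .
      qed
      also have "\<dots> \<le> (?k u)\<^sup>2"
      proof -
        have "(?k u - 1)\<^sup>2 \<ge> 0" by simp
        then show ?thesis unfolding power2_diff by simp
      qed
      finally have "(dr u)\<^sup>2 \<le> (?k u)\<^sup>2 * ((r u)\<^sup>2 * (Y.speed u)\<^sup>2)"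
        unfolding radial_identity[OF u'(1,2)] by (intro mult_right_mono) auto
      then have "(- dr u)\<^sup>2 \<le> (?k u * (r u * Y.speed u))\<^sup>2"
        unfolding power_mult_distrib power2_minus .
      then have "- dr u \<le> ?k u * (r u * Y.speed u)"
      proof (rule power2_le_imp_le)
        show "0 \<le> ?k u * (r u * Y.speed u)"
          using k1[OF u'(3,2)] r Y.speed_pos[OF u'(3,2)]
          by (intro mult_nonneg_nonneg) (linarith, simp_all)
      qed
      note * = this
      have "- dr u / r u / ?k u \<le> Y.speed u"
      proof -
        have k0: "?k u > 0" using k1[OF u'(3,2)] by linarith
        have "- dr u / r u / ?k u = - dr u / (?k u * r u)" by simp
        also have "\<dots> \<le> Y.speed u"
          using * k0 r by (subst pos_divide_le_eq) (simp_all only: mult_pos_pos mult_ac)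
        finally show ?thesis .
      qed
      then have "mass_pairs m * (- dr u / r u / ?k u) \<le> mass_pairs m * Y.speed u"
        using mp_pos by (intro mult_left_mono) auto
      then show ?thesis by simp
    qed
    ultimately show "\<exists>y. (?g has_real_derivative y) (at u) \<and> 0 \<le> y" by blast
  next
    have rc: "continuous_on {0..t} r" using t by (intro continuous_on_subset[OF r_cont]) auto
    have "\<forall>u\<in>{0..t}. scale * r u \<noteq> 0" "\<forall>u\<in>{0..t}. ?k u \<noteq> 0"
      using r_pos scale_pos k1 t by (fastforce simp del: ln_mult)+
    then show "continuous_on {0..t} ?g"
      using Y.continuous_on_tau[OF t(2)] rc
      by (intro continuous_intros) auto
  qed
  then have "ln (?k t) \<le> ln (B + 1) + mass_pairs m * Y.tau t"
    by (simp add: initial_size Y.tau_0)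
  then have "exp (ln (?k t)) \<le> exp (ln (B + 1) + mass_pairs m * Y.tau t)" by (simp only: exp_le_cancel_iff)
  then have "?k t \<le> (B + 1) * exp (mass_pairs m * Y.tau t)"
    using k1[of t] t B by (simp add: exp_add)
  then have "mass_pairs m * ?l t \<le> (B + 1) * exp (mass_pairs m * Y.tau t)" using B by linarith
  then show ?thesis using mp_pos by (simp add: field_simps)
qed

text \<open>
  Up to the rescaled collision time \<open>T + 1\<close> the radius is bounded below, hence \<open>dt / d\<tau>\<close> is at least the
  exponential in the statement, and so is the time needed to pass from \<open>T\<close> to \<open>T + 1\<close>. As this passage ends
  before \<open>t = 1\<close>, the value \<open>T\<close> is reached by the stated time.
\<close>

lemma late_times:
  assumes lower: "\<And>t. 0 < t \<Longrightarrow> t < 1 \<Longrightarrow> shape_energy t \<ge> - B" and B: "B \<ge> 0"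
    and T: "T \<ge> 0" and t: "t < 1"
      "1 - exp (- (2 * ((B + 1) * exp (mass_pairs m * (T + 1)) / mass_pairs m))) \<le> t"
  shows "T \<le> Y.tau t"
proof -
  define M where "M = (B + 1) * exp (mass_pairs m * (T + 1)) / mass_pairs m"
  obtain t1 where t1: "0 \<le> t1" "t1 < 1" "Y.tau t1 = T" using Y.tau_surj T by metis
  obtain t2 where t2: "0 \<le> t2" "t2 < 1" "Y.tau t2 = T + 1" using Y.tau_surj[of "T + 1"] T by auto
  have t12: "t1 < t2" using Y.tau_le_iff[of t2 t1] t1 t2 by force
  let ?e = "exp (- (2 * M))"
  have "t1 - ?e * Y.tau t1 \<le> t2 - ?e * Y.tau t2"
  proof (rule DERIV_nonneg_imp_increasing_open[of t1 t2 "\<lambda>u. u - ?e * Y.tau u"])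
    show "t1 \<le> t2" using t12 by simp
    fix u assume "t1 < u" "u < t2"
    then have u: "0 < u" "u < 1" "0 \<le> u" "Y.tau u \<le> T + 1" using t1 t2 Y.tau_le_iff[of u t2] by auto
    have sr: "scale * r u > 0" using r_pos[OF u(3,2)] scale_pos by simp
    have "exp (mass_pairs m * Y.tau u) \<le> exp (mass_pairs m * (T + 1))"
      using u mp_pos by (simp add: mult_left_mono)
    then have "(B + 1) * exp (mass_pairs m * Y.tau u) / mass_pairs m \<le> M"
      unfolding M_def using B mp_pos by (intro divide_right_mono mult_left_mono) auto
    then have l: "- ln (scale * r u) \<le> M" using log_size_le[OF lower B u(1,2)] by linarith
    have "Y.speed u = exp ((2 + \<alpha>) / 2 * (- ln (scale * r u)))"
    proof -
      have "scale * r u \<noteq> 0" using sr by (rule less_imp_neq[symmetric])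
      then show ?thesis unfolding Y.speed_def mnorm_rescaled by (simp only: powr_def if_False) simp
    qed
    also have "\<dots> \<le> exp (2 * M)"
    proof -
      have "- ln (scale * r u) \<ge> 0" using scaled_size_le[OF u(3,2)] sr by simp
      then have "(2 + \<alpha>) / 2 * (- ln (scale * r u)) \<le> 2 * (- ln (scale * r u))"
        using alpha_less by (intro mult_right_mono) auto
      also have "\<dots> \<le> 2 * M" using l by simp
      finally show ?thesis by simp
    qed
    finally have "?e * Y.speed u \<le> ?e * exp (2 * M)" by simp
    then have "?e * Y.speed u \<le> 1" by (simp flip: exp_add)
    moreover have "((\<lambda>u. u - ?e * Y.tau u) has_real_derivative (1 - ?e * Y.speed u)) (at u)"
      by (intro DERIV_diff DERIV_ident DERIV_cmult Y.tau_deriv u)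
    ultimately show "\<exists>y. ((\<lambda>u. u - ?e * Y.tau u) has_real_derivative y) (at u) \<and> 0 \<le> y"
      by (intro exI[of _ "1 - ?e * Y.speed u"]) auto
  next
    have "continuous_on {t1..t2} Y.tau"
      by (rule continuous_on_subset[OF Y.continuous_on_tau[OF t2(2)]]) (use t1 in auto)
    then show "continuous_on {t1..t2} (\<lambda>u. u - ?e * Y.tau u)" by (intro continuous_intros)
  qed
  then have "t1 + ?e \<le> t2" using t1 t2 by (simp add: algebra_simps)
  then have "t1 \<le> t" using t t2 by (simp add: M_def)
  then show ?thesis using Y.tau_le_iff[of t1 t] t1 t by auto
qed

text \<open>
  While \<open>|s'| \<ge> 1\<close> and \<open>\<lambda> \<ge> \<Lambda>\<close>, the displacement of the shape is at most
  \<open>\<integral> |s'|\<^sup>2 \<le> \<integral> E' / (2 \<Lambda>)\<close>.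
\<close>

lemma mnorm_sh_diff:
  assumes ab: "0 < a" "a \<le> b" "b < 1" and \<Lambda>: "\<Lambda> > 0"
    and rate: "\<And>t. a < t \<Longrightarrow> t < b \<Longrightarrow> \<Lambda> * Y.speed t \<le> (2 - \<alpha>) / 4 * (- dr t / r t)"
    and fast: "\<And>t. a < t \<Longrightarrow> t < b \<Longrightarrow> shape_speed2 t \<ge> 1"
  shows "mnorm m (sh b - sh a) \<le> (shape_energy b - shape_energy a) / (2 * \<Lambda>)"
proof (cases "a = b")
  case True
  then show ?thesis by (simp add: mnorm_msc msc_linear)
next
  case False
  then have "a < b" using ab by simp
  have "norm (msc m (sh b) - msc m (sh a)) \<le> shape_energy b / (2 * \<Lambda>) - shape_energy a / (2 * \<Lambda>)"
  proof (rule differentiable_bound_general[OF \<open>a < b\<close>])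
    show "continuous_on {a..b} (\<lambda>t. msc m (sh t))"
      using ab by (intro bounded_linear.continuous_on[OF bounded_linear_msc] continuous_on_subset[OF sh_cont]) auto
    show "continuous_on {a..b} (\<lambda>t. shape_energy t / (2 * \<Lambda>))"
      using ab \<Lambda> by (intro continuous_intros continuous_at_imp_continuous_on ballI DERIV_isCont[OF shape_energy_deriv]) auto
    fix t assume t: "a < t" "t < b"
    then have t': "0 < t" "t < 1" using ab by auto
    show "((\<lambda>t. msc m (sh t)) has_vector_derivative msc m (dsh t)) (at t)"
      by (rule bounded_linear.has_vector_derivative[OF bounded_linear_msc sh_deriv[OF t']])
    show "((\<lambda>t. shape_energy t / (2 * \<Lambda>)) has_vector_derivative
        ((2 - \<alpha>) / 2 * (- dr t / r t) * shape_speed2 t) / (2 * \<Lambda>)) (at t)"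
      using DERIV_cdivide[OF shape_energy_deriv[OF t'], of "2 * \<Lambda>"]
      by (simp only: has_real_derivative_iff_has_vector_derivative)
    have s: "shape_speed2 t \<ge> 1" and sp: "Y.speed t > 0" using fast[OF t] Y.speed_pos[of t] t' by auto
    have "(mnorm m (dsh t))\<^sup>2 = shape_speed2 t * (Y.speed t)\<^sup>2" by (rule mnorm_dsh_speed2(1)[OF t'])
    also have "\<dots> \<le> (shape_speed2 t * Y.speed t)\<^sup>2"
      using s by (simp add: power_mult_distrib mult_right_mono self_le_power)
    finally have "mnorm m (dsh t) \<le> shape_speed2 t * Y.speed t"
      by (rule power2_le_imp_le) (use s sp in \<open>intro mult_nonneg_nonneg, auto\<close>)
    also have "\<dots> \<le> shape_speed2 t * ((2 - \<alpha>) / 4 * (- dr t / r t) / \<Lambda>)"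
    proof (rule mult_left_mono)
      show "Y.speed t \<le> (2 - \<alpha>) / 4 * (- dr t / r t) / \<Lambda>"
        by (subst pos_le_divide_eq[OF \<Lambda>]) (use rate[OF t] in \<open>simp only: mult.commute\<close>)
    qed (use s in simp)
    also have "\<dots> = ((2 - \<alpha>) / 2 * (- dr t / r t) * shape_speed2 t) / (2 * \<Lambda>)"
      by (simp add: field_simps)
    finally show "norm (msc m (dsh t)) \<le> ((2 - \<alpha>) / 2 * (- dr t / r t) * shape_speed2 t) / (2 * \<Lambda>)"
      by (simp add: mnorm_msc)
  qed
  then show ?thesis by (simp add: mnorm_msc msc_linear diff_divide_distrib)
qed

text \<open>
  Slow times, with \<open>|s'| \<le> 1\<close>, are good because of \<open>V = |s'|\<^sup>2 / 2 - E \<le> 1 / 2 + B\<close>. One occurs between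
  the rescaled collision times \<open>T\<close> and \<open>T + 1\<close>, since otherwise \<open>E\<close> would increase by \<open>2 \<Lambda>\<close> there. A given later
  time is compared with the last slow time \<open>b\<close> before it.
\<close>

lemma eventually_separated:
  assumes lower: "\<And>t. 0 < t \<Longrightarrow> t < 1 \<Longrightarrow> shape_energy t \<ge> - B"
    and \<Lambda>: "\<Lambda> > 0" "1 / 2 + logdiam + B < 2 * \<Lambda>" "diam * ((1 / 2 + logdiam + B) / (2 * \<Lambda>)) \<le> d"
    and T: "T > 0"
    and rate: "\<And>t. 0 < t \<Longrightarrow> t < 1 \<Longrightarrow> T \<le> Y.tau t \<Longrightarrow> \<Lambda> * Y.speed t \<le> (2 - \<alpha>) / 4 * (- dr t / r t)"
    and sep: "\<And>s::real^'d^'n::{finite,linorder}.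
      \<lbrakk>mnorm m s = 1; s \<notin> collisions; potential m \<alpha> s \<le> mass_pairs m + \<alpha> * (1 / 2 + B)\<rbrakk> \<Longrightarrow> separated (2 * d) s"
    and t: "0 < t" "t < 1" "T + 1 \<le> Y.tau t"
  shows "separated d (sh t)"
proof -
  let ?S = "1 / 2 + logdiam + B"
  have d0: "d \<ge> 0"
  proof -
    have "?S \<ge> 0" using shape_energy_le[OF t(1,2)] lower[OF t(1,2)] by linarith
    then have "diam * (?S / (2 * \<Lambda>)) \<ge> 0" using diam_pos \<Lambda> by simp
    then show ?thesis using \<Lambda>(3) by linarith
  qed
  have slow: "separated (2 * d) (sh u)" if u: "0 < u" "u < 1" "shape_speed2 u \<le> 1" for u
  proof (rule sep)
    show "mnorm m (sh u) = 1" "sh u \<notin> collisions" using u by (simp_all add: mnorm_sh sh_noncollision)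
    have "(potential m \<alpha> (sh u) - mass_pairs m) / \<alpha> \<le> 1 / 2 + B"
      using shape_energy_eq[OF u(1,2)] lower[OF u(1,2)] u(3) by linarith
    then show "potential m \<alpha> (sh u) \<le> mass_pairs m + \<alpha> * (1 / 2 + B)"
      using alpha_pos by (simp add: field_simps)
  qed
  obtain a where a: "0 \<le> a" "a < 1" "Y.tau a = T" using Y.tau_surj[of T] T by auto
  have a0: "0 < a" using a T Y.tau_0 by (cases "a = 0") auto
  have at: "a < t" using Y.tau_le_iff[of t a] a t by force
  have rate': "\<Lambda> * Y.speed u \<le> (2 - \<alpha>) / 4 * (- dr u / r u)" if "a < u" "u < t" for u
    using rate[of u] Y.tau_le_iff[of a u] that a t by auto
  have ec: "continuous_on {a..t} shape_energy"
    using a0 t by (intro continuous_at_imp_continuous_on ballI DERIV_isCont[OF shape_energy_deriv]) auto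
  \<comment> \<open>The slow times before \<open>t\<close>.\<close>
  define A where "A = {u \<in> {a..t}. shape_speed2 u \<le> 1}"
  have "\<exists>u\<in>{a..t}. shape_speed2 u \<le> 1"
  proof (rule ccontr)
    assume neg: "\<not> ?thesis"
    have "shape_energy a - 2 * \<Lambda> * Y.tau a \<le> shape_energy t - 2 * \<Lambda> * Y.tau t"
    proof (rule DERIV_nonneg_imp_increasing_open[of a t "\<lambda>u. shape_energy u - 2 * \<Lambda> * Y.tau u"])
      show "a \<le> t" using at by simp
      fix u assume u: "a < u" "u < t"
      then have u': "0 < u" "u < 1" using a0 t by auto
      have "2 * \<Lambda> * Y.speed u \<le> 2 * \<Lambda> * Y.speed u * shape_speed2 u"
      proof -
        have "1 \<le> shape_speed2 u" using neg u by (auto simp: not_le less_imp_le)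
        moreover have "0 \<le> 2 * \<Lambda> * Y.speed u" using \<Lambda>(1) Y.speed_pos[of u] u' by simp
        ultimately show ?thesis using mult_left_mono[of 1 "shape_speed2 u"] by fastforce
      qed
      also have "\<dots> \<le> (2 - \<alpha>) / 2 * (- dr u / r u) * shape_speed2 u"
        using rate'[OF u] shape_speed2_nonneg[OF u'] by (intro mult_right_mono) auto
      finally have "0 \<le> (2 - \<alpha>) / 2 * (- dr u / r u) * shape_speed2 u - 2 * \<Lambda> * Y.speed u" by simp
      moreover have "((\<lambda>u. shape_energy u - 2 * \<Lambda> * Y.tau u) has_real_derivative
          ((2 - \<alpha>) / 2 * (- dr u / r u) * shape_speed2 u - 2 * \<Lambda> * Y.speed u)) (at u)"
        by (intro DERIV_diff DERIV_cmult shape_energy_deriv Y.tau_deriv u')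
      ultimately show "\<exists>y. ((\<lambda>u. shape_energy u - 2 * \<Lambda> * Y.tau u) has_real_derivative y) (at u) \<and> 0 \<le> y"
        by blast
    next
      have "continuous_on {a..t} Y.tau"
        using a by (intro continuous_on_subset[OF Y.continuous_on_tau[OF t(2)]]) auto
      then show "continuous_on {a..t} (\<lambda>u. shape_energy u - 2 * \<Lambda> * Y.tau u)"
        by (intro continuous_intros ec)
    qed
    moreover have "2 * \<Lambda> * (T + 1) \<le> 2 * \<Lambda> * Y.tau t" using \<Lambda>(1) t(3) by simp
    ultimately have "2 * \<Lambda> \<le> shape_energy t - shape_energy a" using a(3) by (simp add: algebra_simps)
    then show False using \<Lambda>(2) shape_energy_le[OF t(1,2)] lower[OF a0 a(2)] by linarith
  qed
  then have A_ne: "A \<noteq> {}" by (auto simp: A_def)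
  have "continuous_on {a..t} shape_speed2"
  proof -
    have "continuous_on {a..t} (\<lambda>u. 2 * (shape_energy u + (potential m \<alpha> (sh u) - mass_pairs m) / \<alpha>))"
      using a0 t alpha_pos sh_noncollision
      by (intro continuous_intros ec continuous_on_compose2[OF continuous_on_potential continuous_on_subset[OF sh_cont]]) auto
    then show ?thesis
      by (rule continuous_on_eq) (use a0 t shape_energy_eq in auto)
  qed
  then have "closed A"
    unfolding A_def by (intro continuous_on_closed_Collect_le continuous_intros) auto
  moreover have "bdd_above A" by (auto simp: A_def)
  ultimately have Sup: "Sup A \<in> A" using A_ne closed_contains_Sup by blast
  define b where "b = Sup A"
  have b: "a \<le> b" "b \<le> t" "shape_speed2 b \<le> 1" using Sup by (auto simp: A_def b_def)
  have fast: "shape_speed2 u \<ge> 1" if "b < u" "u < t" for u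
  proof (rule ccontr)
    assume "\<not> ?thesis"
    then have "u \<in> A" using that b by (auto simp: A_def)
    then have "u \<le> b" unfolding b_def using \<open>bdd_above A\<close> by (rule cSup_upper)
    then show False using that by simp
  qed
  have b': "0 < b" "b < 1" using b a0 t by auto
  have "mnorm m (sh t - sh b) \<le> (shape_energy t - shape_energy b) / (2 * \<Lambda>)"
    using b a0 t \<Lambda> rate' fast by (intro mnorm_sh_diff) auto
  also have "\<dots> \<le> ?S / (2 * \<Lambda>)"
    using shape_energy_le[OF t(1,2)] lower[OF b'] \<Lambda> by (intro divide_right_mono) auto
  finally have "diam * mnorm m (sh t - sh b) \<le> diam * (?S / (2 * \<Lambda>))"
    using diam_pos by (intro mult_left_mono) auto
  then have move: "diam * mnorm m (sh t - sh b) \<le> d" using \<Lambda>(3) by linarith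
  show ?thesis
    unfolding separated_def
  proof (intro allI impI)
    fix i j :: 'n assume "i \<noteq> j"
    then have "2 * d \<le> norm (sh b $ i - sh b $ j)"
      using slow[OF b' b(3)] by (simp add: separated_def)
    also have "\<dots> \<le> norm (sh t $ i - sh t $ j) + norm ((sh t - sh b) $ i - (sh t - sh b) $ j)"
    proof -
      have "sh b $ i - sh b $ j = (sh t $ i - sh t $ j) - ((sh t - sh b) $ i - (sh t - sh b) $ j)" by simp
      then show ?thesis by (simp only: norm_triangle_ineq4)
    qed
    also have "norm ((sh t - sh b) $ i - (sh t - sh b) $ j) \<le> d"
      using norm_diff_le_diam[of "sh t - sh b" i j] move by linarith
    finally show "d \<le> norm (sh t $ i - sh t $ j)" by simp
  qed
qed

lemma shape_speed2_bound:
  assumes "0 < t" "t < 1" "separated d (sh t)" "0 < d" "d \<le> 1" "\<alpha> * (- ln d) \<le> 1"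
  shows "shape_speed2 t \<le> 2 * (1 / 2 + logdiam + 2 * mass_pairs m * (- ln d))"
proof -
  define c where "c = 2 * mass_pairs m * (- ln d)"
  have "potential m \<alpha> (sh t) \<le> mass_pairs m + \<alpha> * c"
    unfolding c_def by (rule potential_le[OF assms(3-5) alpha_pos assms(6)])
  then have c: "(potential m \<alpha> (sh t) - mass_pairs m) / \<alpha> \<le> c"
    using alpha_pos by (simp add: field_simps)
  have "shape_speed2 t = 2 * (shape_energy t + (potential m \<alpha> (sh t) - mass_pairs m) / \<alpha>)"
    using shape_energy_eq[OF assms(1,2)] by simp
  also have "\<dots> \<le> 2 * (1 / 2 + logdiam + c)"
    using c shape_energy_le[OF assms(1,2)] by (intro mult_left_mono add_mono) simp_all
  finally show ?thesis by (simp only: c_def)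
qed

end

section \<open>The components of a variation\<close>

context collapse
begin

text \<open>The components of a variation along \<open>\<rho>\<close> and along the shape, as functions of \<open>t\<close>.\<close>

definition zeta_t :: "(real \<Rightarrow> real^'d^'n::{finite,linorder}) \<Rightarrow> real \<Rightarrow> real" where
  "zeta_t \<phi> t = (2 - \<alpha>) / 4 * r t powr ((2 - \<alpha>) / 4 - 2) * minner m (x t) (\<phi> t)"

definition v_t :: "(real \<Rightarrow> real^'d^'n::{finite,linorder}) \<Rightarrow> real \<Rightarrow> real^'d^'n::{finite,linorder}" where
  "v_t \<phi> t = r t powr (-1) *\<^sub>R \<phi> t - (r t powr (-3) * minner m (x t) (\<phi> t)) *\<^sub>R x t"

lemma coord_derivatives:
  assumes "0 \<le> t" "t < 1"
  shows "frechet_derivative (rho_coord m \<alpha>) (at (x t)) (\<phi> t) = zeta_t \<phi> t"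
    and "frechet_derivative (s_coord m) (at (x t)) (\<phi> t) = v_t \<phi> t"
  using x_nonzero[OF assms]
  by (simp_all add: rho_coord_derivative s_coord_derivative zeta_t_def v_t_def r_def)

lemma tau_components:
  assumes "0 \<le> t" "t < 1"
  shows "zeta_comp m \<alpha> x \<phi> (X.tau t) = zeta_t \<phi> t" "v_comp m \<alpha> x \<phi> (X.tau t) = v_t \<phi> t"
    "shape m \<alpha> x (X.tau t) = sh t" "rho m \<alpha> x (X.tau t) = r t powr ((2 - \<alpha>) / 4)"
  using assms
  by (simp_all add: zeta_comp_def v_comp_def shape_def rho_def X.time_of_tau coord_derivatives
      sh_def rho_coord_def r_def)

lemma dtau_components:
  assumes t: "0 < t" "t < 1"
  shows "(zeta_t \<phi> has_vector_derivative zd) (at t) \<Longrightarrow>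
      dtau (zeta_comp m \<alpha> x \<phi>) (X.tau t) = zd / X.speed t"
    and "(v_t \<phi> has_vector_derivative vd) (at t) \<Longrightarrow>
      dtau (v_comp m \<alpha> x \<phi>) (X.tau t) = inverse (X.speed t) *\<^sub>R vd"
    and "dtau (shape m \<alpha> x) (X.tau t) = inverse (X.speed t) *\<^sub>R dsh t"
proof -
  assume "(zeta_t \<phi> has_vector_derivative zd) (at t)"
  then have "((\<lambda>t. frechet_derivative (rho_coord m \<alpha>) (at (x t)) (\<phi> t)) has_vector_derivative zd) (at t)"
    by (rule has_vector_derivative_transform_within_open[of _ _ _ "{0<..<1}"])
      (use t coord_derivatives in auto)
  from X.dtau_time_of[OF t this]
  show "dtau (zeta_comp m \<alpha> x \<phi>) (X.tau t) = zd / X.speed t"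
    by (simp add: zeta_comp_def[abs_def] divide_inverse mult.commute)
next
  assume "(v_t \<phi> has_vector_derivative vd) (at t)"
  then have "((\<lambda>t. frechet_derivative (s_coord m) (at (x t)) (\<phi> t)) has_vector_derivative vd) (at t)"
    by (rule has_vector_derivative_transform_within_open[of _ _ _ "{0<..<1}"])
      (use t coord_derivatives in auto)
  from X.dtau_time_of[OF t this]
  show "dtau (v_comp m \<alpha> x \<phi>) (X.tau t) = inverse (X.speed t) *\<^sub>R vd"
    by (simp add: v_comp_def[abs_def])
next
  show "dtau (shape m \<alpha> x) (X.tau t) = inverse (X.speed t) *\<^sub>R dsh t"
    using X.dtau_time_of[OF t sh_deriv[OF t]] by (simp add: shape_def[abs_def] sh_def)
qed

lemma dr_cont: "continuous_on {0<..<1} dr"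
  by (intro continuous_at_imp_continuous_on ballI DERIV_isCont) (auto intro: dr_deriv)

lemma h1_primitive_r_powr:
  assumes "0 < a" "b < 1"
  shows "h1_primitive (\<lambda>t. r t powr q) (\<lambda>t. q * r t powr (q - 1) * dr t) a b"
proof (rule h1_primitive_C1)
  fix t assume t: "t \<in> {a..b}"
  then have "((\<lambda>t. r t powr q) has_real_derivative (q * r t powr (q - 1) * dr t)) (at t)"
    using DERIV_fun_powr[OF r_deriv[of t] r_pos[of t], of q] assms by simp
  then show "((\<lambda>t. r t powr q) has_vector_derivative q * r t powr (q - 1) * dr t) (at t)"
    by (simp add: has_real_derivative_iff_has_vector_derivative)
next
  show "continuous_on {a..b} (\<lambda>t. q * r t powr (q - 1) * dr t)"
  proof (intro continuous_intros)
    show "continuous_on {a..b} r" using assms by (intro continuous_on_subset[OF r_cont]) auto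
    show "continuous_on {a..b} dr" using assms by (intro continuous_on_subset[OF dr_cont]) auto
    show "\<forall>t\<in>{a..b}. r t \<noteq> 0" using r_pos assms by (metis atLeastAtMost_iff less_irrefl less_le_trans le_less_trans less_imp_le)
  qed
qed

lemma h1_primitive_x:
  assumes "0 < a" "b < 1" shows "h1_primitive x (velocity x) a b"
  using assms by (intro h1_primitive_C1 x_deriv continuous_on_subset[OF v_cont]) auto

lemma h1_primitive_components:
  assumes ab: "0 < a" "b < 1" and \<phi>: "h1_primitive \<phi> g a b"
  obtains zd vd where "h1_primitive (zeta_t \<phi>) zd a b" "h1_primitive (v_t \<phi>) vd a b"
proof -
  note xp = h1_primitive_bilinear[OF bounded_bilinear_minner h1_primitive_x[OF ab] \<phi>]
  obtain zd where z: "h1_primitive (\<lambda>t. r t powr ((2 - \<alpha>) / 4 - 2) * minner m (x t) (\<phi> t)) zd a b"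
    using h1_primitive_bilinear[OF bounded_bilinear_mult h1_primitive_r_powr[OF ab] xp] by blast
  have "h1_primitive (\<lambda>t. (2 - \<alpha>) / 4) (\<lambda>t. 0) a b"
    by (rule h1_primitive_C1) auto
  from h1_primitive_bilinear[OF bounded_bilinear_mult this z]
  obtain zd' where z': "h1_primitive (\<lambda>t. (2 - \<alpha>) / 4 * (r t powr ((2 - \<alpha>) / 4 - 2) * minner m (x t) (\<phi> t))) zd' a b"
    by blast
  obtain vd1 where v1: "h1_primitive (\<lambda>t. r t powr (-1) *\<^sub>R \<phi> t) vd1 a b"
    using h1_primitive_bilinear[OF bounded_bilinear_scaleR h1_primitive_r_powr[OF ab] \<phi>] by blast
  obtain vd2 where "h1_primitive (\<lambda>t. r t powr (-3) * minner m (x t) (\<phi> t)) vd2 a b"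
    using h1_primitive_bilinear[OF bounded_bilinear_mult h1_primitive_r_powr[OF ab] xp] by blast
  from h1_primitive_bilinear[OF bounded_bilinear_scaleR this h1_primitive_x[OF ab]]
  obtain vd3 where v3: "h1_primitive (\<lambda>t. (r t powr (-3) * minner m (x t) (\<phi> t)) *\<^sub>R x t) vd3 a b"
    by blast
  show thesis
    using that z' h1_primitive_diff[OF v1 v3]
    by (simp add: zeta_t_def[abs_def] v_t_def[abs_def] mult.assoc)
qed

lemma components_eq_0:
  assumes "0 \<le> t" "t < 1" "zeta_t \<phi> t = 0" "v_t \<phi> t = 0"
  shows "\<phi> t = 0"
proof -
  have r: "r t > 0" using r_pos assms by simp
  then have "minner m (x t) (\<phi> t) = 0"
    using assms(3) alpha_less by (simp add: zeta_t_def)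
  then show ?thesis using assms(4) r by (simp add: v_t_def)
qed

end

section \<open>Positivity of the second differential\<close>

lemma variation_support:
  assumes "variation_in m \<alpha> x t0 \<phi>" "\<exists>t\<in>{0..1}. \<phi> t \<noteq> 0"
  obtains a b where "t0 < a" "a < b" "b < 1" "\<forall>t\<in>{0..1} - {a<..<b}. \<phi> t = 0"
proof -
  define C where "C = closure {t\<in>{0..1}. \<phi> t \<noteq> 0}"
  have sub: "C \<subseteq> {t0<..<1}" using assms(1) by (simp add: variation_in_def C_def)
  have "bounded {t\<in>{0..1::real}. \<phi> t \<noteq> 0}" by (rule bounded_subset[OF bounded_closed_interval[of 0 1]]) blast
  then have "compact C" unfolding C_def by (rule compact_closure[THEN iffD2])
  moreover have "C \<noteq> {}" using assms(2) unfolding C_def closure_eq_empty by blast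
  ultimately obtain l u where l: "l \<in> C" "\<And>c. c \<in> C \<Longrightarrow> l \<le> c" and u: "u \<in> C" "\<And>c. c \<in> C \<Longrightarrow> c \<le> u"
    using compact_attains_inf[of C] compact_attains_sup[of C] by blast
  have lu: "t0 < l" "u < 1" "l \<le> u" using l u sub by auto
  show thesis
  proof (rule that[of "(t0 + l) / 2" "(u + 1) / 2"])
    show "\<forall>t\<in>{0..1} - {(t0 + l) / 2<..<(u + 1) / 2}. \<phi> t = 0"
    proof (rule ballI, rule ccontr)
      fix t assume t: "t \<in> {0..1} - {(t0 + l) / 2<..<(u + 1) / 2}"
      assume "\<phi> t \<noteq> 0"
      then have "t \<in> C" using t closure_subset[of "{t\<in>{0..1}. \<phi> t \<noteq> 0}"] unfolding C_def by blast
      then have "l \<le> t" "t \<le> u" using l u by auto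
      then show False using t lu by auto
    qed
  qed (use lu in auto)
qed

text \<open>
  The pointwise inequality. In the application \<open>A\<close>, \<open>B\<close> and \<open>\<sigma>\<close> are the mass norms of \<open>v'\<close>, \<open>v\<close> and the
  derivative of the shape, \<open>i1\<close> and \<open>u1\<close> are the two parts of the mixed term, \<open>h\<close> is the Hessian term and
  \<open>j\<close> is the product of \<open>v\<close> and \<open>v'\<close>. Half of \<open>\<rho>\<^sup>2 A\<^sup>2\<close> absorbs the mixed term with \<open>i1\<close>; the other half is
  bounded below by \<open>e \<rho>\<^sup>2 j - e\<^sup>2 \<rho>\<^sup>2 B\<^sup>2 / 2\<close>, and the remaining \<open>e\<^sup>2 \<rho>\<^sup>2 B\<^sup>2 / 2\<close>, which is
  \<open>\<alpha> \<Lambda>\<^sup>2 \<rho>\<^sup>2 B\<^sup>2 / 2\<close>, absorbs all terms in \<open>\<rho>\<^sup>2 B\<^sup>2\<close>.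
\<close>

lemma quadratic_form_bound:
  fixes P z' Z \<rho> U \<sigma> i1 u1 A B h j e :: real
  assumes "P \<ge> 0" and U: "U \<ge> mp - \<alpha> * l" and \<sigma>: "\<sigma>\<^sup>2 \<le> \<alpha> * C4" "\<sigma> \<ge> 0"
    and i1: "\<bar>i1\<bar> \<le> \<sigma> * A" and u1: "\<bar>u1\<bar> \<le> \<alpha> * C * B" and h: "h \<ge> - (\<alpha> * C' * B\<^sup>2)"
    and j: "\<bar>j\<bar> \<le> B * A" and e: "e\<^sup>2 = \<alpha> * \<Lambda>\<^sup>2" "e \<ge> 0"
    and pos: "A \<ge> 0" "B \<ge> 0" "\<rho> \<ge> 0" "\<alpha> > 0" "C \<ge> 0"
    and small: "\<alpha> * (2 * l + 7 * C4 + 4 * C\<^sup>2) \<le> mp" and big: "\<Lambda>\<^sup>2 \<ge> 2 * (2 + C')"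
  shows "P * z'\<^sup>2 + Z\<^sup>2 * (\<sigma>\<^sup>2 + 2 * U) + 4 * (\<rho> * Z * (i1 + u1)) + \<rho>\<^sup>2 * (A\<^sup>2 + h)
     \<ge> e * \<rho>\<^sup>2 * j - e\<^sup>2 * \<rho>\<^sup>2 * B\<^sup>2 + mp * Z\<^sup>2 + \<alpha> * \<rho>\<^sup>2 * B\<^sup>2"
proof -
  have 1: "4 * (\<rho> * Z * i1) \<ge> - (\<rho>\<^sup>2 * A\<^sup>2 / 2 + 8 * Z\<^sup>2 * \<sigma>\<^sup>2)"
  proof -
    have "\<bar>4 * (\<rho> * Z * i1)\<bar> = 4 * (\<rho> * \<bar>Z\<bar>) * \<bar>i1\<bar>"
      using pos by (simp add: abs_mult)
    also have "\<dots> \<le> 4 * (\<rho> * \<bar>Z\<bar>) * (\<sigma> * A)"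
      using i1 pos by (intro mult_left_mono) auto
    also have "\<dots> = 4 * (\<rho> * A) * (\<bar>Z\<bar> * \<sigma>)" by simp
    also have "\<dots> \<le> (\<rho> * A)\<^sup>2 / 2 + 8 * (\<bar>Z\<bar> * \<sigma>)\<^sup>2"
    proof -
      have "(\<rho> * A - 4 * (\<bar>Z\<bar> * \<sigma>))\<^sup>2 \<ge> 0" by simp
      then show ?thesis unfolding power2_diff by (simp add: power_mult_distrib)
    qed
    finally show ?thesis by (simp add: power_mult_distrib abs_le_iff)
  qed
  have 2: "4 * (\<rho> * Z * u1) \<ge> - (\<alpha> * (4 * C\<^sup>2 * Z\<^sup>2 + \<rho>\<^sup>2 * B\<^sup>2))"
  proof -
    have "\<bar>4 * (\<rho> * Z * u1)\<bar> = 4 * (\<rho> * \<bar>Z\<bar>) * \<bar>u1\<bar>"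
      using pos by (simp add: abs_mult)
    also have "\<dots> \<le> 4 * (\<rho> * \<bar>Z\<bar>) * (\<alpha> * C * B)"
      using u1 pos by (intro mult_left_mono) auto
    also have "\<dots> = \<alpha> * (2 * (2 * C * \<bar>Z\<bar>) * (\<rho> * B))" by simp
    also have "\<dots> \<le> \<alpha> * ((2 * C * \<bar>Z\<bar>)\<^sup>2 + (\<rho> * B)\<^sup>2)"
      using pos(4) by (intro mult_left_mono sum_squares_bound) simp
    finally show ?thesis by (simp add: power_mult_distrib abs_le_iff)
  qed
  have 3: "\<rho>\<^sup>2 * h \<ge> - (\<alpha> * C' * (\<rho>\<^sup>2 * B\<^sup>2))"
    using mult_left_mono[OF h, of "\<rho>\<^sup>2"] by (simp add: mult_ac)
  have 4: "\<rho>\<^sup>2 * A\<^sup>2 / 2 \<ge> e * \<rho>\<^sup>2 * j - e\<^sup>2 * (\<rho>\<^sup>2 * B\<^sup>2) / 2"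
  proof -
    have "e * j \<le> (e * B) * A" using e(2) j by (simp add: mult.assoc mult_left_mono abs_le_iff)
    also have "\<dots> \<le> A\<^sup>2 / 2 + (e * B)\<^sup>2 / 2"
      using sum_squares_bound[of "e * B" A] by simp
    finally have "\<rho>\<^sup>2 * (e * j) \<le> \<rho>\<^sup>2 * (A\<^sup>2 / 2 + (e * B)\<^sup>2 / 2)" by (intro mult_left_mono) auto
    then show ?thesis by (simp add: algebra_simps power_mult_distrib)
  qed
  have 5: "Z\<^sup>2 * (\<sigma>\<^sup>2 + 2 * U) - 8 * Z\<^sup>2 * \<sigma>\<^sup>2 - \<alpha> * (4 * C\<^sup>2 * Z\<^sup>2) \<ge> mp * Z\<^sup>2"
  proof -
    have "mp \<le> 2 * (mp - \<alpha> * l) - 7 * (\<alpha> * C4) - 4 * \<alpha> * C\<^sup>2"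
      using small by (simp add: algebra_simps)
    also have "\<dots> \<le> 2 * U - 7 * \<sigma>\<^sup>2 - 4 * \<alpha> * C\<^sup>2" using U \<sigma> by simp
    finally have "Z\<^sup>2 * mp \<le> Z\<^sup>2 * (2 * U - 7 * \<sigma>\<^sup>2 - 4 * \<alpha> * C\<^sup>2)" by (intro mult_left_mono) auto
    then show ?thesis by (simp add: algebra_simps)
  qed
  have 6: "e\<^sup>2 * (\<rho>\<^sup>2 * B\<^sup>2) / 2 - \<alpha> * (\<rho>\<^sup>2 * B\<^sup>2) - \<alpha> * C' * (\<rho>\<^sup>2 * B\<^sup>2) \<ge> \<alpha> * (\<rho>\<^sup>2 * B\<^sup>2)"
  proof -
    have "(\<alpha> * (\<rho>\<^sup>2 * B\<^sup>2)) * (2 * (2 + C')) \<le> (\<alpha> * (\<rho>\<^sup>2 * B\<^sup>2)) * \<Lambda>\<^sup>2"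
      using big pos by (intro mult_left_mono) auto
    then show ?thesis unfolding e by (simp add: algebra_simps)
  qed
  have 7: "P * z'\<^sup>2 \<ge> 0" using assms(1) by simp
  have "4 * (\<rho> * Z * (i1 + u1)) = 4 * (\<rho> * Z * i1) + 4 * (\<rho> * Z * u1)"
    "\<rho>\<^sup>2 * (A\<^sup>2 + h) = \<rho>\<^sup>2 * A\<^sup>2 + \<rho>\<^sup>2 * h" "\<alpha> * (4 * C\<^sup>2 * Z\<^sup>2 + \<rho>\<^sup>2 * B\<^sup>2) = \<alpha> * (4 * C\<^sup>2 * Z\<^sup>2) + \<alpha> * (\<rho>\<^sup>2 * B\<^sup>2)"
    by (simp_all add: algebra_simps)
  then show ?thesis using 1 2 3 4 5 6 7 by (simp only: mult.assoc)
qed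

context collapse
begin

text \<open>
  The second differential is \<open>\<integral> (Q1 + 4 Q2 + Q3) d\<tau>\<close>, where \<open>d\<tau> = speed dt\<close>. The inequality \<open>lower\<close>
  below bounds the integrand from below by \<open>e / 2\<close> times the derivative \<open>Gd\<close> of \<open>\<rho>\<^sup>2 |v|\<^sup>2\<close> plus
  the nonnegative continuous function \<open>\<kappa>\<close>; the contraction rate enters through the term of \<open>Gd\<close> in
  which \<open>\<rho>\<^sup>2\<close> is differentiated.
\<close>

lemma second_variation_pos:
  fixes d C4 \<Lambda> t0 :: real and \<phi> :: "real \<Rightarrow> real^'d^'n::{finite,linorder}"
  assumes t0: "0 \<le> t0" and d: "0 < d" "d \<le> 1" and alpha_le: "\<alpha> \<le> 1" and Lam: "\<Lambda> \<ge> 0"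
    and sep: "\<And>t. t0 < t \<Longrightarrow> t < 1 \<Longrightarrow> separated d (sh t)"
    and speed2: "\<And>t. t0 < t \<Longrightarrow> t < 1 \<Longrightarrow> shape_speed2 t \<le> C4"
    and rate: "\<And>t. t0 < t \<Longrightarrow> t < 1 \<Longrightarrow> \<Lambda> * Y.speed t \<le> (2 - \<alpha>) / 4 * (- dr t / r t)"
    and small: "\<alpha> * (2 * logdiam + 7 * C4 + 4 * (mass_pairs m * diam / d\<^sup>2)\<^sup>2) \<le> mass_pairs m"
    and big: "\<Lambda>\<^sup>2 \<ge> 2 * (2 + mass_pairs m * diam\<^sup>2 / d ^ 3)"
    and var: "variation_in m \<alpha> x t0 \<phi>" and nz: "\<exists>t\<in>{0..1}. \<phi> t \<noteq> 0"
  shows "d2_action m \<alpha> x \<phi> > 0"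
proof -
  interpret minn: bounded_bilinear "minner m" by (rule bounded_bilinear_minner)
  let ?w = X.speed
  let ?Z = "zeta_t \<phi>" and ?W = "v_t \<phi>"
  let ?p = "(2 - \<alpha>) / 4"
  let ?P = "(4 / (2 - \<alpha>))\<^sup>2"
  obtain a b where ab: "t0 < a" "a < b" "b < 1" and \<phi>0': "\<forall>t\<in>{0..1} - {a<..<b}. \<phi> t = 0"
    using variation_support[OF var nz] by blast
  note \<phi>0 = bspec[OF \<phi>0']
  have a0: "0 < a" using ab t0 by simp
  have in01: "t0 < t" "0 < t" "t < 1" "0 \<le> t" if "t \<in> {a..b}" for t using that ab a0 by auto
  have sub01: "{a..b} \<subseteq> {0<..<1}" using in01 by auto
  obtain g where "h1_primitive \<phi> g 0 1"
    using sobolev_H1_imp_h1_primitive var by (auto simp: variation_in_def)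
  then have "h1_primitive \<phi> g a b" by (rule h1_primitive_subinterval) (use a0 ab in auto)
  from h1_primitive_components[OF a0 ab(3) this]
  obtain zd0 vd0 where Zh: "h1_primitive ?Z zd0 a b" and Wh: "h1_primitive ?W vd0 a b" by blast
  obtain N1 where N1: "negligible N1" "\<And>t. t \<in> {a<..<b} - N1 \<Longrightarrow> (?Z has_vector_derivative zd0 t) (at t)"
    using h1_primitive_AE_derivative[OF Zh] by blast
  obtain N2 where N2: "negligible N2" "\<And>t. t \<in> {a<..<b} - N2 \<Longrightarrow> (?W has_vector_derivative vd0 t) (at t)"
    using h1_primitive_AE_derivative[OF Wh] by blast
  define N where "N = N1 \<union> N2 \<union> {a, b}"
  have N: "negligible N" using N1(1) N2(1) by (simp add: N_def)
  \<comment> \<open>Outside \<open>{a..b}\<close> the components vanish locally, so their derivative there is \<open>0\<close>.\<close>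
  define zd where "zd t = (if t \<in> {a..b} then zd0 t else 0)" for t
  define vd where "vd t = (if t \<in> {a..b} then vd0 t else 0)" for t
  have ZW0: "?Z t = 0" "?W t = 0" if "t \<in> {0..<1} - {a<..<b}" for t
    using \<phi>0[of t] that by (simp_all add: zeta_t_def v_t_def minn.zero_right)
  have Zd: "(?Z has_vector_derivative zd t) (at t)" if t: "t \<in> {0<..<1} - N" for t
  proof (cases "t \<in> {a..b}")
    case True
    then show ?thesis using N1(2)[of t] t by (auto simp: zd_def N_def)
  next
    case False
    then have "(?Z has_vector_derivative 0) (at t)"
      using t ZW0 by (intro has_vector_derivative_off_support[of t a b]) auto
    then show ?thesis by (simp only: zd_def False if_False)
  qed
  have Wd: "(?W has_vector_derivative vd t) (at t)" if t: "t \<in> {0<..<1} - N" for t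
  proof (cases "t \<in> {a..b}")
    case True
    then show ?thesis using N2(2)[of t] t by (auto simp: vd_def N_def)
  next
    case False
    then have "(?W has_vector_derivative 0) (at t)"
      using t ZW0 by (intro has_vector_derivative_off_support[of t a b]) auto
    then show ?thesis by (simp only: vd_def False if_False)
  qed
  define s' where "s' t = inverse (?w t) *\<^sub>R dsh t" for t
  define Q1 where "Q1 t = ?P * (zd t / ?w t)\<^sup>2 + (?Z t)\<^sup>2 * ((mnorm m (s' t))\<^sup>2 + 2 * potential m \<alpha> (sh t))" for t
  define Q2 where "Q2 t = r t powr ?p * ?Z t * (minner m (s' t) (inverse (?w t) *\<^sub>R vd t) + dpot m \<alpha> (sh t) (?W t))" for t
  define Q3 where "Q3 t = (r t powr ?p)\<^sup>2 * ((mnorm m (inverse (?w t) *\<^sub>R vd t))\<^sup>2 + d2pot_E m \<alpha> (sh t) (?W t))" for t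
  have wpos: "?w t > 0" if "t \<in> {a..b}" for t using X.speed_pos in01[OF that] by auto
  have cw: "continuous_on {a..b} ?w" "continuous_on {a..b} (\<lambda>t. inverse (?w t))"
    using sub01 wpos by (auto intro!: continuous_on_inverse continuous_on_subset[OF X.continuous_on_speed] simp: less_imp_neq[symmetric])
  have cZ: "continuous_on {a..b} ?Z" and cW: "continuous_on {a..b} ?W"
    using h1_primitive_continuous[OF Zh] h1_primitive_continuous[OF Wh] by auto
  have csh: "continuous_on {a..b} sh" using sub01 by (intro continuous_on_subset[OF sh_cont]) auto
  have cr: "continuous_on {a..b} r" using sub01 by (intro continuous_on_subset[OF r_cont]) auto
  have rpos: "r t > 0" if "t \<in> {a..b}" for t using r_pos in01[OF that] by auto
  have crp: "continuous_on {a..b} (\<lambda>t. r t powr q)" for q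
    using cr rpos by (intro continuous_intros) (auto simp: less_imp_neq[symmetric])
  have cdsh: "continuous_on {a..b} dsh"
    unfolding dsh_def[abs_def] using sub01 rpos
    by (intro continuous_intros cr continuous_on_subset[OF dr_cont] continuous_on_subset[OF v_cont] continuous_on_subset[OF x_cont])
      (auto simp: less_imp_neq[symmetric])
  have cs': "continuous_on {a..b} s'"
    unfolding s'_def[abs_def] by (intro continuous_intros cw cdsh)
  have nc: "sh t \<notin> collisions" if "t \<in> {a..b}" for t using sh_noncollision in01[OF that] by auto
  have cU: "continuous_on {a..b} (\<lambda>t. potential m \<alpha> (sh t))"
    using nc by (intro continuous_on_compose2[OF continuous_on_potential csh]) auto
  have cU1: "continuous_on {a..b} (\<lambda>t. dpot m \<alpha> (sh t) (?W t))"
    by (intro continuous_on_dpot csh cW nc)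
  have cM: "continuous_on {a..b} (\<lambda>t. (mnorm m (f t))\<^sup>2)" if "continuous_on {a..b} f" for f
    using that by (simp add: mnorm_power2 minn.continuous_on)
  have cU2: "continuous_on {a..b} (\<lambda>t. d2pot_E m \<alpha> (sh t) (?W t))"
    unfolding d2pot_E_def by (intro continuous_intros cM continuous_on_d2pot csh cW nc cU)
  note zi = h1_primitiveD[OF Zh] and vi = h1_primitiveD[OF Wh]
  \<comment> \<open>The three parts must be integrable separately, because a non-integrable function has integral \<open>0\<close>.\<close>
  have add: "(\<lambda>t. f t + c t) absolutely_integrable_on {a..b}"
    if "f absolutely_integrable_on {a..b}" "continuous_on {a..b} c" for f c :: "real \<Rightarrow> real"
    by (rule set_integral_add(1)[OF that(1) absolutely_integrable_continuous_real[OF that(2)]])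
  have I1: "(\<lambda>t. Q1 t * ?w t) absolutely_integrable_on {a..b}"
  proof -
    have "(\<lambda>t. (?P * inverse (?w t)) * (zd0 t * zd0 t)) absolutely_integrable_on {a..b}"
      by (intro absolutely_integrable_bilinear_continuous[OF bounded_bilinear_mult] continuous_intros cw
          absolutely_integrable_bilinear_L2[OF bounded_bilinear_mult zi zi])
    from add[OF this, of "\<lambda>t. (?Z t)\<^sup>2 * ((mnorm m (s' t))\<^sup>2 + 2 * potential m \<alpha> (sh t)) * ?w t"]
    have "(\<lambda>t. (?P * inverse (?w t)) * (zd0 t * zd0 t)
       + (?Z t)\<^sup>2 * ((mnorm m (s' t))\<^sup>2 + 2 * potential m \<alpha> (sh t)) * ?w t) absolutely_integrable_on {a..b}"
      by (simp add: cZ cM cs' cU cw continuous_intros)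
    then show ?thesis
    proof (rule absolutely_integrable_spike[of _ _ "{}"])
      fix t assume "t \<in> {a..b} - {}"
      then show "Q1 t * ?w t = (?P * inverse (?w t)) * (zd0 t * zd0 t)
       + (?Z t)\<^sup>2 * ((mnorm m (s' t))\<^sup>2 + 2 * potential m \<alpha> (sh t)) * ?w t"
        using wpos[of t] by (simp add: Q1_def zd_def power_divide distrib_right power2_eq_square divide_inverse)
    qed simp
  qed
  have I2: "(\<lambda>t. Q2 t * ?w t) absolutely_integrable_on {a..b}"
  proof -
    have "(\<lambda>t. (r t powr ?p * ?Z t) * minner m (s' t) (vd0 t)) absolutely_integrable_on {a..b}"
      by (intro absolutely_integrable_bilinear_continuous[OF bounded_bilinear_mult] continuous_intros crp cZ
          absolutely_integrable_bilinear_continuous[OF bounded_bilinear_minner] cs' vi)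
    from add[OF this, of "\<lambda>t. r t powr ?p * ?Z t * dpot m \<alpha> (sh t) (?W t) * ?w t"]
    have "(\<lambda>t. (r t powr ?p * ?Z t) * minner m (s' t) (vd0 t)
       + r t powr ?p * ?Z t * dpot m \<alpha> (sh t) (?W t) * ?w t) absolutely_integrable_on {a..b}"
      by (simp add: cZ crp cU1 cw continuous_intros)
    then show ?thesis
    proof (rule absolutely_integrable_spike[of _ _ "{}"])
      fix t assume "t \<in> {a..b} - {}"
      then show "Q2 t * ?w t = (r t powr ?p * ?Z t) * minner m (s' t) (vd0 t)
       + r t powr ?p * ?Z t * dpot m \<alpha> (sh t) (?W t) * ?w t"
        using wpos[of t] by (simp add: Q2_def vd_def minn.scaleR_right distrib_left distrib_right)
    qed simp
  qed
  have I3: "(\<lambda>t. Q3 t * ?w t) absolutely_integrable_on {a..b}"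
  proof -
    have "(\<lambda>t. ((r t powr ?p)\<^sup>2 * inverse (?w t)) * minner m (vd0 t) (vd0 t)) absolutely_integrable_on {a..b}"
      by (intro absolutely_integrable_bilinear_continuous[OF bounded_bilinear_mult] continuous_intros crp cw
          absolutely_integrable_bilinear_L2[OF bounded_bilinear_minner vi vi])
    from add[OF this, of "\<lambda>t. (r t powr ?p)\<^sup>2 * d2pot_E m \<alpha> (sh t) (?W t) * ?w t"]
    have "(\<lambda>t. ((r t powr ?p)\<^sup>2 * inverse (?w t)) * minner m (vd0 t) (vd0 t)
       + (r t powr ?p)\<^sup>2 * d2pot_E m \<alpha> (sh t) (?W t) * ?w t) absolutely_integrable_on {a..b}"
      by (simp add: crp cU2 cw continuous_intros)
    then show ?thesis
    proof (rule absolutely_integrable_spike[of _ _ "{}"])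
      fix t assume "t \<in> {a..b} - {}"
      then show "Q3 t * ?w t = ((r t powr ?p)\<^sup>2 * inverse (?w t)) * minner m (vd0 t) (vd0 t)
       + (r t powr ?p)\<^sup>2 * d2pot_E m \<alpha> (sh t) (?W t) * ?w t"
        using wpos[of t] by (simp add: Q3_def vd_def mnorm_power2 minn.scaleR_right minn.scaleR_left distrib_left distrib_right)
    qed simp
  qed
  have Q0: "Q1 t = 0" "Q2 t = 0" "Q3 t = 0" if "t \<in> {0<..<1} - {a..b}" for t
  proof -
    have t: "?Z t = 0" "?W t = 0" "zd t = 0" "vd t = 0" using ZW0[of t] that by (auto simp: zd_def vd_def)
    have "sh t \<notin> collisions" using that by (intro sh_noncollision) auto
    then have "d2pot m \<alpha> (sh t) 0 = 0" by (simp add: d2pot_eq)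
    then show "Q1 t = 0" "Q2 t = 0" "Q3 t = 0"
      using t by (simp_all add: Q1_def Q2_def Q3_def d2pot_E_def mnorm_power2 minn.zero_right)
  qed
  have E: "(\<lambda>t. Q t * ?w t) absolutely_integrable_on {0<..<1}"
     "integral {0<..<1} (\<lambda>t. Q t * ?w t) = integral {a..b} (\<lambda>t. Q t * ?w t)"
    if "(\<lambda>t. Q t * ?w t) absolutely_integrable_on {a..b}" "\<And>t. t \<in> {0<..<1} - {a..b} \<Longrightarrow> Q t = 0" for Q
    using absolutely_integrable_extend_zero[OF that(1) sub01] that(2) by simp_all
  note E1 = E[of Q1, OF I1 Q0(1)] and E2 = E[of Q2, OF I2 Q0(2)] and E3 = E[of Q3, OF I3 Q0(3)]
  have rr: "d2_rho_rho m \<alpha> x (zeta_comp m \<alpha> x \<phi>) = integral {a..b} (\<lambda>t. Q1 t * ?w t)"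
    unfolding d2_rho_rho_def
  proof (rule trans[OF X.LINT_tau[OF E1(1) N] E1(2)])
    fix t assume t: "t \<in> {0<..<1} - N"
    then have t': "0 < t" "t < 1" "0 \<le> t" by auto
    show "?P * (dtau (zeta_comp m \<alpha> x \<phi>) (X.tau t))\<^sup>2 + (zeta_comp m \<alpha> x \<phi> (X.tau t))\<^sup>2 *
      ((mnorm m (dtau (shape m \<alpha> x) (X.tau t)))\<^sup>2 + 2 * potential m \<alpha> (shape m \<alpha> x (X.tau t))) = Q1 t"
      by (simp only: tau_components[OF t'(3,2)] dtau_components(1)[OF t'(1,2) Zd[OF t]]
          dtau_components(3)[OF t'(1,2)] Q1_def s'_def)
  qed
  have rs: "d2_rho_s m \<alpha> x (zeta_comp m \<alpha> x \<phi>) (v_comp m \<alpha> x \<phi>) = 2 * integral {a..b} (\<lambda>t. Q2 t * ?w t)"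
  proof -
    have "(LINT \<tau>:{0..}|lebesgue. rho m \<alpha> x \<tau> * zeta_comp m \<alpha> x \<phi> \<tau> *
       (minner m (dtau (shape m \<alpha> x) \<tau>) (dtau (v_comp m \<alpha> x \<phi>) \<tau>)
        + dpot m \<alpha> (shape m \<alpha> x \<tau>) (v_comp m \<alpha> x \<phi> \<tau>))) = integral {a..b} (\<lambda>t. Q2 t * ?w t)"
    proof (rule trans[OF X.LINT_tau[OF E2(1) N] E2(2)])
      fix t assume t: "t \<in> {0<..<1} - N"
      then have t': "0 < t" "t < 1" "0 \<le> t" by auto
      show "rho m \<alpha> x (X.tau t) * zeta_comp m \<alpha> x \<phi> (X.tau t) *
       (minner m (dtau (shape m \<alpha> x) (X.tau t)) (dtau (v_comp m \<alpha> x \<phi>) (X.tau t))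
        + dpot m \<alpha> (shape m \<alpha> x (X.tau t)) (v_comp m \<alpha> x \<phi> (X.tau t))) = Q2 t"
        by (simp only: tau_components[OF t'(3,2)] dtau_components(2)[OF t'(1,2) Wd[OF t]]
            dtau_components(3)[OF t'(1,2)] Q2_def s'_def)
    qed
    then show ?thesis unfolding d2_rho_s_def by simp
  qed
  have ss: "d2_s_s m \<alpha> x (v_comp m \<alpha> x \<phi>) = integral {a..b} (\<lambda>t. Q3 t * ?w t)"
    unfolding d2_s_s_def
  proof (rule trans[OF X.LINT_tau[OF E3(1) N] E3(2)])
    fix t assume t: "t \<in> {0<..<1} - N"
    then have t': "0 < t" "t < 1" "0 \<le> t" by auto
    show "(rho m \<alpha> x (X.tau t))\<^sup>2 * ((mnorm m (dtau (v_comp m \<alpha> x \<phi>) (X.tau t)))\<^sup>2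
        + d2pot_E m \<alpha> (shape m \<alpha> x (X.tau t)) (v_comp m \<alpha> x \<phi> (X.tau t))) = Q3 t"
      by (simp only: tau_components[OF t'(3,2)] dtau_components(2)[OF t'(1,2) Wd[OF t]] Q3_def)
  qed
  have Ii: "(\<lambda>t. Q1 t * ?w t) integrable_on {a..b}" "(\<lambda>t. Q2 t * ?w t) integrable_on {a..b}"
      "(\<lambda>t. Q3 t * ?w t) integrable_on {a..b}"
    using I1 I2 I3 by (simp_all add: absolutely_integrable_on_def)
  have tot_int: "(\<lambda>t. (Q1 t + 4 * Q2 t + Q3 t) * ?w t) integrable_on {a..b}"
    and total: "d2_action m \<alpha> x \<phi> = integral {a..b} (\<lambda>t. (Q1 t + 4 * Q2 t + Q3 t) * ?w t)"
  proof -
    have eq: "(\<lambda>t. (Q1 t + 4 * Q2 t + Q3 t) * ?w t) = (\<lambda>t. Q1 t * ?w t + 4 * (Q2 t * ?w t) + Q3 t * ?w t)"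
      by (simp add: fun_eq_iff algebra_simps)
    have J2: "(\<lambda>t. 4 * (Q2 t * ?w t)) integrable_on {a..b}"
      by (rule integrable_on_mult_right[OF Ii(2)])
    show "(\<lambda>t. (Q1 t + 4 * Q2 t + Q3 t) * ?w t) integrable_on {a..b}"
      unfolding eq by (intro integrable_add J2 Ii)
    have "integral {a..b} (\<lambda>t. (Q1 t + 4 * Q2 t + Q3 t) * ?w t)
       = integral {a..b} (\<lambda>t. Q1 t * ?w t) + 4 * integral {a..b} (\<lambda>t. Q2 t * ?w t) + integral {a..b} (\<lambda>t. Q3 t * ?w t)"
      unfolding eq
      by (simp only: Henstock_Kurzweil_Integration.integral_add[OF integrable_add[OF Ii(1) J2] Ii(3)]
          Henstock_Kurzweil_Integration.integral_add[OF Ii(1) J2] integral_mult_right)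
    then show "d2_action m \<alpha> x \<phi> = integral {a..b} (\<lambda>t. (Q1 t + 4 * Q2 t + Q3 t) * ?w t)"
      by (simp add: d2_action_def rr rs ss)
  qed
  \<comment> \<open>\<open>e\<close> is the lower bound of the contraction rate in the collision time of \<open>x\<close>.\<close>
  define e where "e = sqrt \<alpha> * \<Lambda>"
  define Gd where "Gd t = (2 * ?p * r t powr (2 * ?p - 1) * dr t) * minner m (?W t) (?W t)
      + r t powr (2 * ?p) * (minner m (vd0 t) (?W t) + minner m (?W t) (vd0 t))" for t
  have G: "h1_primitive (\<lambda>t. r t powr (2 * ?p) * minner m (?W t) (?W t)) Gd a b"
    unfolding Gd_def[abs_def]
    by (intro h1_primitive_bilinear[OF bounded_bilinear_mult] h1_primitive_r_powr a0 ab
        h1_primitive_bilinear[OF bounded_bilinear_minner Wh Wh])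
  have Gint: "Gd integrable_on {a..b}" using h1_primitiveD(1)[OF G] by (simp add: absolutely_integrable_on_def)
  have G0: "integral {a..b} Gd = 0"
  proof -
    have "?W a = 0" "?W b = 0" using ZW0 a0 ab by auto
    then show ?thesis using h1_primitive_increment[OF G order_refl less_imp_le[OF ab(2)] order_refl]
      by (simp add: minn.zero_right)
  qed
  define \<kappa> where "\<kappa> t = (mass_pairs m * (?Z t)\<^sup>2 + \<alpha> * (r t powr ?p)\<^sup>2 * (mnorm m (?W t))\<^sup>2) * ?w t" for t
  have ck: "continuous_on {a..b} \<kappa>"
    unfolding \<kappa>_def[abs_def] by (intro continuous_intros cM cZ cW crp cw)
  have lower: "e / 2 * Gd t + \<kappa> t \<le> (Q1 t + 4 * Q2 t + Q3 t) * ?w t" if t: "t \<in> {a..b}" for t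
  proof -
    note t' = in01[OF t]
    have w: "?w t > 0" and r: "r t > 0" using wpos rpos t by auto
    have sept: "separated d (sh t)" using sep t' by blast
    let ?v = "inverse (?w t) *\<^sub>R vd t"
    have sig: "(mnorm m (s' t))\<^sup>2 \<le> \<alpha> * C4"
    proof -
      have "(mnorm m (s' t))\<^sup>2 = (mnorm m (dsh t))\<^sup>2 / (?w t)\<^sup>2"
        by (simp add: s'_def mnorm_scaleR power_mult_distrib divide_inverse power_inverse mult.commute)
      also have "\<dots> = \<alpha> * shape_speed2 t"
        using w unfolding mnorm_dsh_speed2(2)[OF t'(2,3)] by simp
      also have "\<dots> \<le> \<alpha> * C4" using speed2[OF t'(1,3)] alpha_pos by simp
      finally show ?thesis .
    qed
    have U0: "potential m \<alpha> (sh t) \<ge> 0"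
      unfolding potential_pairs using mass_pos by (intro sum_nonneg) (simp add: less_imp_le)
    have h: "d2pot_E m \<alpha> (sh t) (?W t) \<ge> - (\<alpha> * (mass_pairs m * diam\<^sup>2 / d ^ 3) * (mnorm m (?W t))\<^sup>2)"
    proof -
      have "\<alpha> * potential m \<alpha> (sh t) * (mnorm m (?W t))\<^sup>2 \<ge> 0"
        using alpha_pos U0 by simp
      then show ?thesis
        using d2pot_ge[OF sept d alpha_pos alpha_le, of "?W t"] unfolding d2pot_E_def by linarith
    qed
    have "?P * (zd t / ?w t)\<^sup>2 + (?Z t)\<^sup>2 * ((mnorm m (s' t))\<^sup>2 + 2 * potential m \<alpha> (sh t))
      + 4 * (r t powr ?p * ?Z t * (minner m (s' t) ?v + dpot m \<alpha> (sh t) (?W t)))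
      + (r t powr ?p)\<^sup>2 * ((mnorm m ?v)\<^sup>2 + d2pot_E m \<alpha> (sh t) (?W t))
      \<ge> e * (r t powr ?p)\<^sup>2 * minner m (?W t) ?v - e\<^sup>2 * (r t powr ?p)\<^sup>2 * (mnorm m (?W t))\<^sup>2
        + mass_pairs m * (?Z t)\<^sup>2 + \<alpha> * (r t powr ?p)\<^sup>2 * (mnorm m (?W t))\<^sup>2"
    proof (rule quadratic_form_bound[OF _ _ sig _ _ _ h])
      show "mass_pairs m - \<alpha> * logdiam \<le> potential m \<alpha> (sh t)"
        using t' alpha_pos by (intro potential_ge mnorm_sh sh_noncollision) auto
      show "\<bar>dpot m \<alpha> (sh t) (?W t)\<bar> \<le> \<alpha> * (mass_pairs m * diam / d\<^sup>2) * mnorm m (?W t)"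
        by (rule dpot_le[OF sept d alpha_pos alpha_le])
      show "e\<^sup>2 = \<alpha> * \<Lambda>\<^sup>2" "0 \<le> e" using alpha_pos Lam by (simp_all add: e_def power_mult_distrib)
      show "0 \<le> mass_pairs m * diam / d\<^sup>2" using mp_pos diam_pos by simp
    qed (use small big alpha_pos minner_le in auto)
    then have "(e * (r t powr ?p)\<^sup>2 * minner m (?W t) ?v - e\<^sup>2 * (r t powr ?p)\<^sup>2 * (mnorm m (?W t))\<^sup>2
        + mass_pairs m * (?Z t)\<^sup>2 + \<alpha> * (r t powr ?p)\<^sup>2 * (mnorm m (?W t))\<^sup>2) * ?w t
       \<le> (Q1 t + 4 * Q2 t + Q3 t) * ?w t"
      unfolding Q1_def Q2_def Q3_def using w by (intro mult_right_mono) (auto simp: less_imp_le)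
    moreover have "(e * (r t powr ?p)\<^sup>2 * minner m (?W t) ?v - e\<^sup>2 * (r t powr ?p)\<^sup>2 * (mnorm m (?W t))\<^sup>2
        + mass_pairs m * (?Z t)\<^sup>2 + \<alpha> * (r t powr ?p)\<^sup>2 * (mnorm m (?W t))\<^sup>2) * ?w t
       = e * (r t powr ?p)\<^sup>2 * minner m (?W t) (vd0 t) - e * (e * ?w t) * ((r t powr ?p)\<^sup>2 * (mnorm m (?W t))\<^sup>2) + \<kappa> t"
      using w t by (simp add: \<kappa>_def vd_def minn.scaleR_right algebra_simps power2_eq_square)
    moreover have "e / 2 * Gd t \<le> e * (r t powr ?p)\<^sup>2 * minner m (?W t) (vd0 t) - e * (e * ?w t) * ((r t powr ?p)\<^sup>2 * (mnorm m (?W t))\<^sup>2)"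
    proof -
      have rp: "(r t powr ?p)\<^sup>2 = r t powr (2 * ?p)"
        by (simp only: power2_eq_square mult_2 powr_add)
      have rq: "r t powr (2 * ?p - 1) = r t powr (2 * ?p) / r t" using r by (simp only: powr_diff) simp
      have "e * ?w t = \<Lambda> * Y.speed t" by (simp add: e_def X_speed Y_speed)
      also have "\<dots> \<le> ?p * (- dr t / r t)" by (rule rate[OF t'(1,3)])
      finally have "e * ?w t \<le> ?p * (- dr t / r t)" .
      then have "(e * (r t powr (2 * ?p) * (mnorm m (?W t))\<^sup>2)) * (e * ?w t)
         \<le> (e * (r t powr (2 * ?p) * (mnorm m (?W t))\<^sup>2)) * (?p * (- dr t / r t))"
        using alpha_pos Lam by (intro mult_left_mono) (auto simp: e_def)
      moreover have "e / 2 * Gd t = e * r t powr (2 * ?p) * minner m (?W t) (vd0 t)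
         - (e * (r t powr (2 * ?p) * (mnorm m (?W t))\<^sup>2)) * (?p * (- dr t / r t))"
      proof -
        have "e / 2 * ((2 * p * (R / c) * c') * B + R * (j + j)) = e * R * j - (e * (R * B)) * (p * (- c' / c))"
          for p R c c' B j :: real by (simp add: algebra_simps)
        then show ?thesis unfolding Gd_def rq mnorm_power2 minner_commute[of "vd0 t"] .
      qed
      ultimately show ?thesis unfolding rp by (simp add: mult_ac)
    qed
    ultimately show ?thesis by linarith
  qed
  have "integral {a..b} (\<lambda>t. e / 2 * Gd t + \<kappa> t) \<le> d2_action m \<alpha> x \<phi>"
    unfolding total
    by (intro integral_le tot_int lower integrable_add integrable_on_mult_right Gint integrable_continuous_real ck)
  moreover have "integral {a..b} (\<lambda>t. e / 2 * Gd t + \<kappa> t) = integral {a..b} \<kappa>"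
    using G0 by (simp add: Henstock_Kurzweil_Integration.integral_add integrable_on_mult_right Gint integrable_continuous_real ck)
  moreover have "integral {a..b} \<kappa> > 0"
  proof -
    have k0: "\<kappa> t \<ge> 0" if "t \<in> {a..b}" for t
      using wpos[OF that] mp_pos alpha_pos by (simp add: \<kappa>_def)
    obtain t where t: "t \<in> {0..1}" "\<phi> t \<noteq> 0" using nz by blast
    then have tab: "t \<in> {a..b}" using \<phi>0[of t] by fastforce
    have "\<kappa> t \<noteq> 0"
    proof
      assume "\<kappa> t = 0"
      then have "mass_pairs m * (?Z t)\<^sup>2 + \<alpha> * (r t powr ?p)\<^sup>2 * (mnorm m (?W t))\<^sup>2 = 0"
        using wpos[OF tab] by (simp add: \<kappa>_def)
      moreover have "mass_pairs m * (?Z t)\<^sup>2 \<ge> 0" "\<alpha> * (r t powr ?p)\<^sup>2 * (mnorm m (?W t))\<^sup>2 \<ge> 0"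
        using mp_pos alpha_pos by simp_all
      ultimately have "mass_pairs m * (?Z t)\<^sup>2 = 0" "\<alpha> * (r t powr ?p)\<^sup>2 * (mnorm m (?W t))\<^sup>2 = 0"
        by linarith+
      then have "?Z t = 0" "?W t = 0" using mp_pos alpha_pos rpos[OF tab] by auto
      then show False using components_eq_0 in01[OF tab] t(2) by blast
    qed
    then have "integral {a..b} \<kappa> \<noteq> 0" using integral_eq_0_iff[OF ck ab(2) k0] tab by blast
    moreover have "integral {a..b} \<kappa> \<ge> 0"
      using k0 by (intro Henstock_Kurzweil_Integration.integral_nonneg integrable_continuous_real ck)
    ultimately show ?thesis by simp
  qed
  ultimately show ?thesis by simp
qed

end

section \<open>Uniformity along the family\<close>

text \<open>
  If two bodies of \<open>s\<close> are close, moving one of them onto the other gives a collision \<open>y\<close> close to \<open>s\<close>,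
  hence close to a point of \<open>K\<close>.
\<close>

lemma (in masses) asymptotic_imp_separated:
  assumes as: "asymptotic_to m x K" and K: "K \<inter> collisions_nbhd m \<delta> = {}" and \<delta>: "\<delta> > 0"
  shows "\<exists>t1 d. 0 < t1 \<and> t1 < 1 \<and> 0 < d \<and> (\<forall>t\<in>{t1..<1}. separated d (s_coord m (x t)))"
proof -
  define M where "M = (\<Sum>i\<in>UNIV. sqrt (m i))"
  have M: "sqrt (m i) \<le> M" for i
    unfolding M_def using mass_pos by (intro member_le_sum) (auto simp: less_imp_le)
  have "sqrt (m undefined) > 0" using mass_pos by simp
  then have M0: "M > 0" using M[of undefined] by linarith
  have near: "separated (\<delta> / 2 / M) s" if s: "msetdist m K s < \<delta> / 2" for s
    unfolding separated_def
  proof (intro allI impI)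
    fix i j :: 'n assume ij: "i \<noteq> j"
    have "(\<lambda>k. mnorm m (s - k)) ` K \<noteq> {}" using as by (simp add: asymptotic_to_def)
    then obtain k where k: "k \<in> K" "mnorm m (s - k) < \<delta> / 2"
      using cInf_lessD[of "(\<lambda>k. mnorm m (s - k)) ` K" "\<delta> / 2"] s by (auto simp: msetdist_def)
    define y where "y = (\<chi> l. if l = i then s $ j else s $ l)"
    have "y $ i = y $ j" using ij by (simp add: y_def)
    then have "y \<in> collisions" using ij unfolding collisions_def by blast
    then have "\<delta> \<le> mnorm m (k - y)" using k(1) K by (force simp: collisions_nbhd_def not_less)
    also have "\<dots> \<le> mnorm m (k - s) + mnorm m (s - y)"
      using mnorm_triangle[of "k - s" "s - y"] by simp
    also have "mnorm m (s - y) = sqrt (m i) * norm (s $ i - s $ j)"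
    proof -
      have "minner m (s - y) (s - y) = (\<Sum>l\<in>UNIV. if l = i then m i * (norm (s $ i - s $ j))\<^sup>2 else 0)"
        unfolding minner_def by (intro sum.cong refl) (simp add: y_def power2_norm_eq_inner)
      then show ?thesis by (simp add: mnorm_def real_sqrt_mult)
    qed
    also have "\<dots> \<le> M * norm (s $ i - s $ j)" using M by (intro mult_right_mono) auto
    finally have "\<delta> / 2 \<le> M * norm (s $ i - s $ j)"
      using k(2) mnorm_minus_commute[of s k] by simp
    then show "\<delta> / 2 / M \<le> norm (s $ i - s $ j)" using M0 by (simp add: field_simps)
  qed
  have "\<forall>\<^sub>F t in at_left 1. msetdist m K (s_coord m (x t)) < \<delta> / 2"
    using as \<delta> by (intro order_tendstoD(2)[of _ 0]) (auto simp: asymptotic_to_def)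
  then obtain b where b: "b < 1" "\<And>t. b < t \<Longrightarrow> t < 1 \<Longrightarrow> msetdist m K (s_coord m (x t)) < \<delta> / 2"
    by (auto simp: eventually_at_left_field)
  show ?thesis
  proof (intro exI conjI ballI)
    show "0 < max (1 / 2) ((b + 1) / 2)" "max (1 / 2) ((b + 1) / 2) < 1" "0 < \<delta> / 2 / M"
      using b(1) \<delta> M0 by auto
    show "separated (\<delta> / 2 / M) (s_coord m (x t))" if "t \<in> {max (1 / 2) ((b + 1) / 2)..<1}" for t
      using that b by (intro near b(2)) auto
  qed
qed

lemma noncollision_imp_separated:
  fixes s :: "real^'d^'n::finite"
  assumes "s \<notin> collisions"
  obtains d where "0 < d" "d \<le> 1" "separated d s"
proof -
  define D where "D = insert 1 ((\<lambda>p. norm (gap s p)) ` {p. fst p \<noteq> snd p})"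
  have ne: "s $ i \<noteq> s $ j" if "i \<noteq> j" for i j
    using assms that unfolding collisions_def by blast
  have D: "finite D" "D \<noteq> {}" "\<And>e. e \<in> D \<Longrightarrow> e > 0"
    using ne by (auto simp: D_def)
  show thesis
  proof (rule that[of "Min D"])
    show "0 < Min D" using D by simp
    show "Min D \<le> 1" using D by (intro Min_le) (auto simp: D_def)
    show "separated (Min D) s"
      unfolding separated_def
    proof (intro allI impI)
      fix i j :: 'n assume "i \<noteq> j"
      then have "norm (s $ i - s $ j) \<in> D" unfolding D_def by (intro insertI2 image_eqI[of _ _ "(i, j)"]) auto
      then show "Min D \<le> norm (s $ i - s $ j)" using D(1) by (intro Min_le)
    qed
  qed
qed

lemma separated_near:
  fixes s s' :: "real^'d^'n::finite"
  assumes "separated (2 * d) s" "dist s' s < d / 2"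
  shows "separated d s'"
  unfolding separated_def
proof (intro allI impI)
  fix i j :: 'n assume "i \<noteq> j"
  then have "2 * d \<le> norm (s $ i - s $ j)" using assms(1) by (simp add: separated_def)
  also have "\<dots> = norm ((s' $ i - s' $ j) - ((s' - s) $ i - (s' - s) $ j))" by simp
  also have "\<dots> \<le> norm (s' $ i - s' $ j) + norm ((s' - s) $ i - (s' - s) $ j)"
    by (rule norm_triangle_ineq4)
  also have "norm ((s' - s) $ i - (s' - s) $ j) \<le> norm ((s' - s) $ i) + norm ((s' - s) $ j)"
    by (rule norm_triangle_ineq4)
  also have "\<dots> \<le> d"
    using assms(2) Finite_Cartesian_Product.norm_nth_le[of "s' - s" i] Finite_Cartesian_Product.norm_nth_le[of "s' - s" j]
    unfolding dist_norm by linarith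
  finally show "d \<le> norm (s' $ i - s' $ j)" by simp
qed

context collapse
begin

lemma rho_rescaled:
  assumes "0 \<le> t" "t < 1"
  shows "rho m \<alpha> (rescaled \<alpha> x) (Y.tau t) = (scale * r t) powr ((2 - \<alpha>) / 4)"
  by (simp add: rho_def Y.time_of_tau[OF assms] rho_coord_def mnorm_rescaled)

lemma shape_rescaled_0: "shape m \<alpha> (rescaled \<alpha> x) 0 = sh 0"
proof -
  have "time_of m \<alpha> (rescaled \<alpha> x) 0 = 0"
    using Y.time_of_tau[of 0] by (simp add: Y.tau_0)
  then show ?thesis using scale_pos by (simp add: shape_def rescaled_eq s_coord_scaleR sh_def)
qed

lemma decreasing_collapseI:
  assumes "rho m \<alpha> (rescaled \<alpha> x) 0 = 1"
    and neg: "\<And>\<tau>. \<tau> \<ge> 0 \<Longrightarrow> dtau (rho m \<alpha> (rescaled \<alpha> x)) \<tau> < 0"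
  shows "decreasing_collapse m \<alpha> x"
proof unfold_locales
  have r0: "scale * r 0 > 0" using scale_pos r_pos[of 0] by simp
  have "(scale * r 0) powr ((2 - \<alpha>) / 4) = 1"
    using assms(1) rho_rescaled[of 0] by (simp add: Y.tau_0)
  then have "((2 - \<alpha>) / 4) * ln (scale * r 0) = 0"
    using r0 ln_powr[of "scale * r 0" "(2 - \<alpha>) / 4"] by simp
  then have "ln (scale * r 0) = 0" using alpha_less by simp
  then show "scale * r 0 = 1" using r0 ln_eq_zero_iff by blast
next
  fix t :: real assume t: "0 < t" "t < 1"
  have sr: "scale * r t > 0" using scale_pos r_pos[of t] t by simp
  have "((\<lambda>u. (scale * r u) powr ((2 - \<alpha>) / 4)) has_real_derivative
      (2 - \<alpha>) / 4 * (scale * r t) powr ((2 - \<alpha>) / 4 - 1) * (scale * dr t)) (at t)"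
    using DERIV_fun_powr[OF DERIV_cmult[OF r_deriv[OF t], of scale] sr, of "(2 - \<alpha>) / 4"] by simp
  then have "((\<lambda>u. rho_coord m \<alpha> (rescaled \<alpha> x u)) has_vector_derivative
      (2 - \<alpha>) / 4 * (scale * r t) powr ((2 - \<alpha>) / 4 - 1) * (scale * dr t)) (at t)"
    by (simp add: rho_coord_def mnorm_rescaled has_real_derivative_iff_has_vector_derivative)
  from Y.dtau_time_of[OF t this]
  have "dtau (rho m \<alpha> (rescaled \<alpha> x)) (Y.tau t)
     = (inverse (Y.speed t) * ((2 - \<alpha>) / 4) * (scale * r t) powr ((2 - \<alpha>) / 4 - 1) * scale) * dr t"
    by (simp add: rho_def[abs_def])
  moreover have c: "inverse (Y.speed t) * ((2 - \<alpha>) / 4) * (scale * r t) powr ((2 - \<alpha>) / 4 - 1) * scale > 0"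
    using Y.speed_pos[of t] t sr alpha_less scale_pos by (intro mult_pos_pos) (auto simp del: mult_pos_pos)
  moreover have "dtau (rho m \<alpha> (rescaled \<alpha> x)) (Y.tau t) < 0"
    using neg[of "Y.tau t"] Y.tau_pos[OF t] by simp
  ultimately show "dr t < 0"
    by (metis mult_less_0_iff less_asym)
qed

end

theorem theorem6p13:
  fixes m :: "'n::{finite,linorder} \<Rightarrow> real"
    and A :: "real set"
    and x :: "real \<Rightarrow> real \<Rightarrow> real^'d^'n::{finite,linorder}"
    and K :: "real \<Rightarrow> (real^'d^'n::{finite,linorder}) set"
    and s0 v0 :: "real^'d^'n::{finite,linorder}"
    and \<delta> :: real
  assumes "CARD('d) \<ge> 2" and "CARD('n) \<ge> 2" and "\<And>i. m i > 0"
    and "A \<subseteq> {0<..<2}" and "0 islimpt A"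
    and "\<And>\<alpha>. \<alpha> \<in> A \<Longrightarrow> total_collision_solution m \<alpha> (x \<alpha>)"
    and "\<And>\<alpha>. \<alpha> \<in> A \<Longrightarrow> K \<alpha> \<subseteq> central_configs m \<alpha>"
    and "\<And>\<alpha>. \<alpha> \<in> A \<Longrightarrow> asymptotic_to m (x \<alpha>) (K \<alpha>)"
    and UC: "\<forall>\<sigma>>0. \<exists>\<tau>\<^sub>\<sigma>>0. \<forall>\<alpha>\<in>A. \<forall>\<tau>\<ge>\<tau>\<^sub>\<sigma>. rho m \<alpha> (rescaled \<alpha> (x \<alpha>)) \<tau> < \<sigma>"
    and IC1: "\<forall>\<alpha>\<in>A. rho m \<alpha> (rescaled \<alpha> (x \<alpha>)) 0 = 1 \<and>
                (\<forall>\<tau>\<ge>0. dtau (rho m \<alpha> (rescaled \<alpha> (x \<alpha>))) \<tau> < 0)"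
    and IC2: "s0 \<in> ellipsoid m"
             "((\<lambda>\<alpha>. shape m \<alpha> (rescaled \<alpha> (x \<alpha>)) 0) \<longlongrightarrow> s0) (at 0 within A)"
             "((\<lambda>\<alpha>. dtau (shape m \<alpha> (rescaled \<alpha> (x \<alpha>))) 0) \<longlongrightarrow> v0) (at 0 within A)"
    and H: "\<forall>\<alpha>\<in>A. \<forall>t\<in>{0<..<1}.
              energy m \<alpha> (x \<alpha>) t = - (\<alpha> powr (- (\<alpha> / (\<alpha> + 2)))) * mass_pairs m"
    and "\<delta> > 0" and "\<And>\<alpha>. \<alpha> \<in> A \<Longrightarrow> K \<alpha> \<subseteq> central_configs m \<alpha> - collisions_nbhd m \<delta>"
  shows "\<exists>t0\<in>{0<..<1}. \<exists>a :: nat \<Rightarrow> real.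
           (\<forall>k. a k \<in> A) \<and> a \<longlonglongrightarrow> 0 \<and>
           (\<forall>k \<phi>. variation_in m (a k) (x (a k)) t0 \<phi> \<and> (\<exists>t\<in>{0..1}. \<phi> t \<noteq> 0)
                \<longrightarrow> d2_action m (a k) (x (a k)) \<phi> > 0)"
proof -
  interpret masses m by unfold_locales (rule assms(3))
  have coll: "collapse m \<alpha> (x \<alpha>)" if \<alpha>: "\<alpha> \<in> A" for \<alpha>
  proof unfold_locales
    show "0 < \<alpha>" "\<alpha> < 2" using \<alpha> assms(4) by auto
    show "2 \<le> CARD('n)" by fact
    show "total_collision_solution m \<alpha> (x \<alpha>)" using \<alpha> by fact
    show "energy m \<alpha> (x \<alpha>) t = - (\<alpha> powr (- (\<alpha> / (\<alpha> + 2)))) * mass_pairs m" if "t \<in> {0<..<1}" for t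
      using H \<alpha> that by blast
    have "K \<alpha> \<inter> collisions_nbhd m \<delta> = {}" using assms(16)[OF \<alpha>] by blast
    with assms(8)[OF \<alpha>] show "\<exists>t1 d. 0 < t1 \<and> t1 < 1 \<and> 0 < d \<and>
      (\<forall>t\<in>{t1..<1}. separated d (s_coord m (x \<alpha> t)))"
      using \<open>\<delta> > 0\<close> by (intro asymptotic_imp_separated)
  qed
  have dec: "decreasing_collapse m \<alpha> (x \<alpha>)" if \<alpha>: "\<alpha> \<in> A" for \<alpha>
    using collapse.decreasing_collapseI[OF coll[OF \<alpha>]] IC1 \<alpha> by blast
  let ?mp = "mass_pairs m"
  have mp: "?mp > 0" using mass_pairs_pos[OF assms(2)] .
  \<comment> \<open>The limit \<open>s0\<close> is not a collision, so \<open>d1\<close> separates the initial shapes for small \<open>\<alpha>\<close>; this gives the lower bound \<open>- B\<close> of the shape energy.\<close>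
  obtain d1' where d1': "0 < d1'" "d1' \<le> 1" "separated d1' s0"
    using noncollision_imp_separated[of s0] IC2(1) by (auto simp: ellipsoid_def config_space_def)
  define d1 where "d1 = d1' / 2"
  have d1: "0 < d1" "d1 \<le> 1" "separated (2 * d1) s0" using d1' by (auto simp: d1_def)
  define B where "B = 2 * ?mp * (- ln d1)"
  have "ln d1 \<le> 0" using d1 by simp
  then have B: "B \<ge> 0" unfolding B_def using mp by (intro mult_nonneg_nonneg) auto
  obtain D where D: "0 < D" "D \<le> 1"
    "\<And>(s::real^'d^'n::{finite,linorder}) \<alpha>. \<lbrakk>mnorm m s = 1; s \<notin> collisions; \<alpha> > 0; potential m \<alpha> s \<le> ?mp + \<alpha> * (1 / 2 + B)\<rbrakk>
      \<Longrightarrow> separated D s"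
    using separated_of_potential_le[of "1 / 2 + B"] B by (metis add_nonneg_nonneg divide_nonneg_nonneg zero_le_numeral zero_le_one)
  define d where "d = D / 2"
  have d: "0 < d" "d \<le> 1" "2 * d = D" using D by (auto simp: d_def)
  define S where "S = 1 / 2 + logdiam + B"
  have S: "S > 0" using logdiam_nonneg B by (simp add: S_def)
  define C4 where "C4 = 2 * (1 / 2 + logdiam + 2 * ?mp * (- ln d))"
  define C' where "C' = ?mp * diam\<^sup>2 / d ^ 3"
  have C': "C' \<ge> 0" using mp d by (simp add: C'_def)
  define q where "q = diam * S / (2 * d)"
  \<comment> \<open>\<open>\<Lambda>\<close> must beat the Hessian constant \<open>C'\<close> and keep the displacement of the shape below \<open>d\<close>.\<close>
  define \<Lambda> where "\<Lambda> = S + q + 2 * C' + 4"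
  have q: "q \<ge> 0" using diam_pos S d by (simp add: q_def)
  have \<Lambda>: "\<Lambda> > 0" "S < 2 * \<Lambda>" "\<Lambda>\<^sup>2 \<ge> 2 * (2 + C')"
  proof -
    show "\<Lambda> > 0" "S < 2 * \<Lambda>" using S q C' by (simp_all add: \<Lambda>_def)
    have "2 * (2 + C') \<le> \<Lambda>" "1 \<le> \<Lambda>" using S q C' by (simp_all add: \<Lambda>_def)
    then show "\<Lambda>\<^sup>2 \<ge> 2 * (2 + C')" using self_le_power[of \<Lambda> 2] by linarith
  qed
  have \<Lambda>4: "diam * (S / (2 * \<Lambda>)) \<le> d"
  proof -
    have "q \<le> \<Lambda>" using S C' by (simp add: \<Lambda>_def)
    then have "diam * S \<le> \<Lambda> * (2 * d)" using d(1) by (simp add: q_def pos_divide_le_eq)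
    then show ?thesis using d \<Lambda>(1) by (simp add: field_simps)
  qed
  \<comment> \<open>For small \<open>\<alpha>\<close>, a rescaled \<open>\<rho> < exp (- L)\<close> forces a contraction rate of at least \<open>\<Lambda>\<close>.\<close>
  define L where "L = (8 * \<Lambda>\<^sup>2 + 1 / 2 + logdiam) / ?mp"
  have L: "L \<ge> 0" "8 * \<Lambda>\<^sup>2 + 1 / 2 + logdiam \<le> ?mp * L"
    using mp logdiam_nonneg by (auto simp: L_def)
  obtain T where T: "T > 0" "\<And>\<alpha> \<tau>. \<alpha> \<in> A \<Longrightarrow> \<tau> \<ge> T \<Longrightarrow> rho m \<alpha> (rescaled \<alpha> (x \<alpha>)) \<tau> < exp (- L)"
    using UC[rule_format, of "exp (- L)"] by auto
  define t0 where "t0 = 1 - exp (- (2 * ((B + 1) * exp (?mp * (T + 1 + 1)) / ?mp)))"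
  have t0: "0 < t0" "t0 < 1" using B mp by (auto simp: t0_def intro!: mult_pos_pos divide_pos_pos)
  \<comment> \<open>All constants above are independent of \<open>\<alpha>\<close>; only the following conditions restrict it.\<close>
  have ev_small: "\<forall>\<^sub>F \<alpha> in at 0 within A. \<alpha> * c \<le> e" if "e > 0" for c e :: real
  proof -
    have "((\<lambda>\<alpha>. \<alpha> * c) \<longlongrightarrow> 0 * c) (at 0 within A)" by (intro tendsto_intros)
    then have "\<forall>\<^sub>F \<alpha> in at 0 within A. \<alpha> * c < e" using that by (intro order_tendstoD(2)) auto
    then show ?thesis by eventually_elim simp
  qed
  define good where "good \<alpha> \<longleftrightarrow> \<alpha> * 1 \<le> 1 \<and> \<alpha> * (2 * L) \<le> 1 \<and> \<alpha> * (- ln d) \<le> 1 \<and> \<alpha> * (- ln d1) \<le> 1 \<and>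
     \<alpha> * (2 * logdiam + 7 * C4 + 4 * (?mp * diam / d\<^sup>2)\<^sup>2) \<le> ?mp \<and>
     dist (shape m \<alpha> (rescaled \<alpha> (x \<alpha>)) 0) s0 < d1 / 2" for \<alpha>
  have "\<forall>\<^sub>F \<alpha> in at 0 within A. good \<alpha>"
    unfolding good_def using d1 mp
    by (intro eventually_conj ev_small tendstoD[OF IC2(2)]) auto
  then obtain \<epsilon> where \<epsilon>: "\<epsilon> > 0" "\<And>\<alpha>. \<alpha> \<in> A \<Longrightarrow> \<alpha> \<noteq> 0 \<Longrightarrow> dist \<alpha> 0 < \<epsilon> \<Longrightarrow> good \<alpha>"
    unfolding eventually_at by blast
  have main: "d2_action m \<alpha> (x \<alpha>) \<phi> > 0"
    if \<alpha>: "\<alpha> \<in> A" and g: "good \<alpha>" and var: "variation_in m \<alpha> (x \<alpha>) t0 \<phi>" "\<exists>t\<in>{0..1}. \<phi> t \<noteq> 0" for \<alpha> \<phi>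
  proof -
    interpret C: decreasing_collapse m \<alpha> "x \<alpha>" by (rule dec[OF \<alpha>])
    have g': "\<alpha> \<le> 1" "2 * L * \<alpha> \<le> 1" "\<alpha> * (- ln d) \<le> 1" "\<alpha> * (- ln d1) \<le> 1"
      "\<alpha> * (2 * logdiam + 7 * C4 + 4 * (?mp * diam / d\<^sup>2)\<^sup>2) \<le> ?mp"
      "dist (C.sh 0) s0 < d1 / 2"
      using g by (auto simp: good_def C.shape_rescaled_0 mult_ac)
    have "separated d1 (C.sh 0)" by (rule separated_near[OF d1(3) g'(6)])
    then have "potential m \<alpha> (C.sh 0) \<le> ?mp + \<alpha> * B"
      unfolding B_def by (rule potential_le[OF _ d1(1,2) C.alpha_pos g'(4)])
    then have lower: "C.shape_energy t \<ge> - B" if "0 < t" "t < 1" for t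
      using C.shape_energy_lower that by blast
    have rate: "\<Lambda> * C.Y.speed t \<le> (2 - \<alpha>) / 4 * (- C.dr t / C.r t)" if t: "0 < t" "t < 1" "T \<le> C.Y.tau t" for t
    proof (rule C.contraction_rate[OF t(1,2) g'(1) L(1) g'(2) _ less_imp_le[OF \<Lambda>(1)] L(2)])
      let ?p = "(2 - \<alpha>) / 4"
      let ?u = "C.scale * C.r t"
      have u: "?u > 0" using C.scale_pos C.r_pos[of t] t by simp
      have p: "?p > 0" "?p \<le> 1 / 2" using C.alpha_less C.alpha_pos by auto
      have "?u powr ?p < exp (- L)"
        using T(2)[OF \<alpha> t(3)] C.rho_rescaled[of t] t by simp
      then have "exp (?p * ln ?u) < exp (- L)" unfolding powr_def using u by (simp only: less_imp_neq[symmetric] if_False)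
      then have 1: "?p * ln ?u < - L" by (simp only: exp_less_cancel_iff)
      have "ln ?u \<le> - (2 * L)"
      proof -
        have "?p * (2 * L) \<le> L" using p L(1) mult_right_mono[of ?p "1 / 2" "2 * L"] by simp
        then have "?p * ln ?u \<le> ?p * (- (2 * L))" using 1 by simp
        then show ?thesis using p(1) by (rule mult_left_le_imp_le)
      qed
      then have "\<alpha> * ln ?u \<le> \<alpha> * (- (2 * L))" using C.alpha_pos by (intro mult_left_mono) auto
      then have "exp (\<alpha> * ln ?u) \<le> exp (- (2 * L * \<alpha>))" by (simp only: exp_le_cancel_iff) (simp add: mult_ac)
      then show "?u powr \<alpha> \<le> exp (- (2 * L * \<alpha>))" unfolding powr_def using u by (simp only: less_imp_neq[symmetric] if_False)
    qed
    have late: "T + 1 \<le> C.Y.tau t" if "t0 < t" "t < 1" for t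
      using C.late_times[OF lower B, of "T + 1" t] T(1) that by (simp add: t0_def)
    have sep: "separated d (C.sh t)" if t: "t0 < t" "t < 1" for t
    proof (rule C.eventually_separated[OF lower \<Lambda>(1) _ _ T(1) rate])
      show "1 / 2 + logdiam + B < 2 * \<Lambda>" "diam * ((1 / 2 + logdiam + B) / (2 * \<Lambda>)) \<le> d"
        using \<Lambda>(2) \<Lambda>4 by (simp_all add: S_def)
      show "separated (2 * d) s" if "mnorm m s = 1" "s \<notin> collisions" "potential m \<alpha> s \<le> ?mp + \<alpha> * (1 / 2 + B)"
        for s :: "real^'d^'n::{finite,linorder}"
        using D(3)[OF that(1,2) C.alpha_pos that(3)] d(3) by simp
    qed (use t t0 late in auto)
    show ?thesis
    proof (rule C.second_variation_pos[OF less_imp_le[OF t0(1)] d(1,2) g'(1) less_imp_le[OF \<Lambda>(1)] sep _ _ g'(5) _ var])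
      fix t assume t: "t0 < t" "t < 1"
      show "C.shape_speed2 t \<le> C4"
        unfolding C4_def using t t0 by (intro C.shape_speed2_bound sep d g') auto
      show "\<Lambda> * C.Y.speed t \<le> (2 - \<alpha>) / 4 * (- C.dr t / C.r t)"
        using t t0 late[OF t] by (intro rate) auto
    qed (use \<Lambda>(3) in \<open>simp_all add: C'_def\<close>)
  qed
  obtain f where f: "\<And>n. f n \<in> A - {0}" "f \<longlonglongrightarrow> 0"
    using assms(5) unfolding islimpt_sequential by blast
  obtain n0 where n0: "\<And>n. n \<ge> n0 \<Longrightarrow> dist (f n) 0 < \<epsilon>"
    using f(2) \<epsilon>(1) unfolding lim_sequentially by blast
  show ?thesis
  proof (intro bexI[of _ t0] exI[of _ "\<lambda>k. f (k + n0)"] conjI allI impI)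
    show "f (k + n0) \<in> A" for k using f(1)[of "k + n0"] by simp
    show "(\<lambda>k. f (k + n0)) \<longlonglongrightarrow> 0" using f(2) by (rule LIMSEQ_ignore_initial_segment)
    fix k \<phi> assume "variation_in m (f (k + n0)) (x (f (k + n0))) t0 \<phi> \<and> (\<exists>t\<in>{0..1}. \<phi> t \<noteq> 0)"
    then show "0 < d2_action m (f (k + n0)) (x (f (k + n0))) \<phi>"
      using f(1)[of "k + n0"] n0[of "k + n0"] by (intro main \<epsilon>(2)) auto
  qed (use t0 in auto)
qed

end
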